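(* Let $k_0\ge 1$ be an integer, $T>0$, $\alpha>1/3$, and let $a\in H^1(\mathbb{T})$ be real-valued with $$\int_{\mathbb{T}}e^{-2i\pi x}a(x)\,dx\neq 0.$$ There exists $\varepsilon_0>0$ such that, for every $\varepsilon\in(0,\varepsilon_0)$ with $k_0/\varepsilon\in\mathbb{Z}$, the initial datum $$u(\varepsilon,0,x)=\varepsilon^{\alpha}\,a\!\left(\frac{k_0x}{\varepsilon}\right)$$ generates a unique solution $u\in C^0([0,4\pi k_0+\varepsilon T],H^1(\mathbb{T}))$ to $$\partial_tu+u\,\partial_xu-\varepsilon\,\partial_x^2u=i,$$ and for all $t\in[0,4\pi k_0+\varepsilon T]$ there holds $$\left|\int_{\mathbb{T}}e^{-2i\pi k_0x/\varepsilon}\,u(\varepsilon,t,x)\,dx\right|\ \ge\ \frac12\,\exp\!\left(\frac{\pi k_0(t-2\pi k_0)^2}{\varepsilon}-\frac{4(\pi k_0)^3}{\varepsilon}\right)\left|\int_{\mathbb{T}}e^{-2i\pi k_0x/\varepsilon}\,u(\varepsilon,0,x)\,dx\right|.$$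
   Context: $\mathbb{T}=\mathbb{R}/\mathbb{Z}$; functions on $\mathbb{T}$ are identified with $1$-periodic functions on $\mathbb{R}$. The unknown $u(\varepsilon,t,x)\in\mathbb{C}$ is complex-valued, with $t\ge 0$, $x\in\mathbb{T}$, and $\varepsilon>0$ is a small viscosity parameter. $H^1(\mathbb{T})$ is the usual $L^2$-based Sobolev space. The datum $x\mapsto\varepsilon^\alpha a(k_0x/\varepsilon)$ and the exponential $e^{-2i\pi k_0x/\varepsilon}$ are well defined on $\mathbb{T}$ since $k_0/\varepsilon\in\mathbb{Z}$. *)

theory Defs
  imports "HOL-Analysis.Analysis"
begin

text \<open>
  Functions on \<open>\<real>/\<int>\<close> are 1-periodic functions on the real line, integrated over \<open>[0,1]\<close>.
  Elements of \<open>L\<^sup>2\<close> and \<open>H\<^sup>1\<close> are represented by functions and identified when equal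
  almost everywhere; every notion below is invariant under this identification.
\<close>

abbreviation torus :: "real measure" where
  "torus \<equiv> lebesgue_on {0..1}"

definition periodic1 :: "(real \<Rightarrow> 'a) \<Rightarrow> bool" where
  "periodic1 f \<longleftrightarrow> (\<forall>x. f (x + 1) = f x)"

definition L2_torus :: "(real \<Rightarrow> complex) \<Rightarrow> bool" where
  "L2_torus f \<longleftrightarrow> periodic1 f \<and> f \<in> borel_measurable torus \<and>
     integrable torus (\<lambda>x. (cmod (f x))\<^sup>2)"

definition smooth :: "(real \<Rightarrow> complex) \<Rightarrow> bool" where
  "smooth \<phi> \<longleftrightarrow> (\<exists>D :: nat \<Rightarrow> real \<Rightarrow> complex. D 0 = \<phi> \<and>
     (\<forall>n x. (D n has_vector_derivative D (Suc n) x) (at x)))"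

definition weak_deriv_of :: "(real \<Rightarrow> complex) \<Rightarrow> (real \<Rightarrow> complex) \<Rightarrow> bool" where
  "weak_deriv_of f g \<longleftrightarrow> L2_torus g \<and>
     (\<forall>\<phi>. smooth \<phi> \<and> periodic1 \<phi> \<longrightarrow>
        (LINT x|torus. f x * vector_derivative \<phi> (at x)) = - (LINT x|torus. g x * \<phi> x))"

definition H1_torus :: "(real \<Rightarrow> complex) \<Rightarrow> bool" where
  "H1_torus f \<longleftrightarrow> L2_torus f \<and> (\<exists>g. weak_deriv_of f g)"

text \<open>The weak derivative is unique almost everywhere; \<open>weak_deriv\<close> picks a representative.\<close>

definition weak_deriv :: "(real \<Rightarrow> complex) \<Rightarrow> real \<Rightarrow> complex" where
  "weak_deriv f = (SOME g. weak_deriv_of f g)"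

definition H1_norm :: "(real \<Rightarrow> complex) \<Rightarrow> real" where
  "H1_norm f = sqrt ((LINT x|torus. (cmod (f x))\<^sup>2) + (LINT x|torus. (cmod (weak_deriv f x))\<^sup>2))"

definition C0_H1 :: "real \<Rightarrow> (real \<Rightarrow> real \<Rightarrow> complex) \<Rightarrow> bool" where
  "C0_H1 T u \<longleftrightarrow> (\<forall>t\<in>{0..T}. H1_torus (u t)) \<and>
     (\<forall>t\<in>{0..T}. ((\<lambda>s. H1_norm (\<lambda>x. u s x - u t x)) \<longlongrightarrow> 0) (at t within {0..T}))"

text \<open>
  \<open>D m n\<close> is the partial derivative of order \<open>m\<close> in the first and \<open>n\<close> in the second variable.
\<close>

definition smooth2 :: "(real \<Rightarrow> real \<Rightarrow> complex) \<Rightarrow> bool" where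
  "smooth2 \<phi> \<longleftrightarrow> (\<exists>D :: nat \<Rightarrow> nat \<Rightarrow> real \<Rightarrow> real \<Rightarrow> complex. D 0 0 = \<phi> \<and>
     (\<forall>m n. continuous_on UNIV (\<lambda>(t, x). D m n t x)) \<and>
     (\<forall>m n t x. ((\<lambda>s. D m n s x) has_vector_derivative D (Suc m) n t x) (at t)) \<and>
     (\<forall>m n t x. ((\<lambda>y. D m n t y) has_vector_derivative D m (Suc n) t x) (at x)))"

text \<open>Smooth functions on \<open>\<real> \<times> \<real>/\<int>\<close> with compact support in \<open>(0,T) \<times> \<real>/\<int>\<close>.\<close>

definition test_function :: "real \<Rightarrow> (real \<Rightarrow> real \<Rightarrow> complex) \<Rightarrow> bool" where
  "test_function T \<phi> \<longleftrightarrow> smooth2 \<phi> \<and> (\<forall>t. periodic1 (\<phi> t)) \<and>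
     (\<exists>c d. 0 < c \<and> d < T \<and> (\<forall>t x. t \<notin> {c..d} \<longrightarrow> \<phi> t x = 0))"

definition dt :: "(real \<Rightarrow> real \<Rightarrow> complex) \<Rightarrow> real \<Rightarrow> real \<Rightarrow> complex" where
  "dt \<phi> t x = vector_derivative (\<lambda>s. \<phi> s x) (at t)"

definition dx :: "(real \<Rightarrow> real \<Rightarrow> complex) \<Rightarrow> real \<Rightarrow> real \<Rightarrow> complex" where
  "dx \<phi> t x = vector_derivative (\<lambda>y. \<phi> t y) (at x)"

text \<open>
  \<open>u\<close> lies in \<open>C\<^sup>0([0,T], H\<^sup>1)\<close>, has initial value \<open>u\<^sub>0\<close>, and solves
  \<open>\<partial>\<^sub>t u + u \<partial>\<^sub>x u - \<epsilon> \<partial>\<^sub>x\<^sup>2 u = \<i>\<close> in the sense of distributions on \<open>(0,T) \<times> \<real>/\<int>\<close>.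
  The integrals are iterated because representatives chosen separately for each \<open>t\<close>
  need not be jointly measurable.
\<close>

definition burgers_solution ::
  "real \<Rightarrow> real \<Rightarrow> (real \<Rightarrow> complex) \<Rightarrow> (real \<Rightarrow> real \<Rightarrow> complex) \<Rightarrow> bool" where
  "burgers_solution \<epsilon> T u0 u \<longleftrightarrow>
     C0_H1 T u \<and>
     (AE x in torus. u 0 x = u0 x) \<and>
     (\<forall>\<phi>. test_function T \<phi> \<longrightarrow>
        (LINT t|lebesgue_on {0..T}. LINT x|torus.
            - u t x * dt \<phi> t x
            + u t x * weak_deriv (u t) x * \<phi> t x
            - of_real \<epsilon> * u t x * dx (dx \<phi>) t x)
        = (LINT t|lebesgue_on {0..T}. LINT x|torus. \<i> * \<phi> t x))"

end

theory Submission
  imports Defs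
begin

text \<open>The forcing \<open>\<i>\<close> acts as a Galilean change of frame with imaginary velocity. Write \<open>N = k\<^sub>0/\<epsilon>\<close>,
let \<open>c\<close> be the (real) mean of the datum and put \<open>u = \<i> t + c + U\<close>. Then \<open>U\<close> solves the viscous
Burgers equation with the additional transport velocity \<open>\<i> t + c\<close>, and the Cole--Hopf substitution
\<open>U = - 2 \<epsilon> \<partial>\<^sub>x \<theta> / \<theta>\<close> makes the problem linear: in the variable \<open>y = N x\<close> the \<open>m\<close>-th Fourier mode
of \<open>\<theta>\<close> is multiplied by
\<open>exp (- 4 \<pi>\<^sup>2 k\<^sub>0 N m\<^sup>2 t + \<pi> N m t\<^sup>2 - 2 \<pi> \<i> N m c t)\<close>. The modulus of this factor for \<open>m = 1\<close> is exactly
the exponential in the theorem. Up to the final time all factors stay below a constant that does not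
depend on \<open>\<epsilon>\<close>: modes \<open>m < 0\<close> decay, \<open>m = 0\<close> is constant, for \<open>m \<ge> 2\<close> the quadratic damping wins, and for \<open>m = 1\<close> the
break-even time \<open>4 \<pi> k\<^sub>0\<close> is exceeded only by \<open>\<epsilon> T\<close> (\<open>linear_growth_bound\<close>).

Existence. Initially \<open>\<theta> = exp (- \<delta> G)\<close>, where \<open>G\<close> is the primitive of \<open>a\<close> minus its mean and
\<open>\<delta> = \<epsilon>\<^sup>\<alpha> / (2 k\<^sub>0)\<close>, so the nonconstant modes of \<open>\<theta>\<close> are \<open>O(\<delta>)\<close> in total (\<open>b_deriv_sum\<close>). As the growth
factors are bounded, \<open>\<theta>\<close> keeps away from zero for small \<open>\<epsilon>\<close>. The quotient is a classical
solution for positive times (\<open>u_burgers_solution\<close>) and continuous in \<open>H\<^sup>1\<close> down to \<open>t = 0\<close> (\<open>u_C0_H1\<close>); for the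
latter the Fourier series of the second derivative of \<open>\<theta>\<close> is compared in \<open>L\<^sup>2\<close>, using \<open>Parseval\<close>.

Lower bound. The wanted Fourier coefficient is the integral of \<open>exp (- 2 \<pi> \<i> z) \<theta>' / \<theta>\<close> over a period. Shift the line
of integration to the height \<open>\<sigma>\<close> at which \<open>exp (2 \<pi> \<sigma>)\<close> equals the growth factor of the first mode. There
mode \<open>m\<close> has modulus \<open>exp (- 4 \<pi>\<^sup>2 k\<^sub>0 N t (m\<^sup>2 - m)) \<le> 1\<close> relative to its initial value, with equality for
\<open>m = 1\<close>. Hence on this line nothing has grown: the quotient is its linear part, of size \<open>\<delta>\<close>, up
to an error \<open>O(\<delta>\<^sup>2)\<close>, and the growth factor stands in front
(\<open>quotient_mode_lower_bound\<close>).

Uniqueness. Each Fourier mode of a weak solution satisfies an integral equation (\<open>burgers_mode_equation\<close>). For the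
difference of two solutions the viscous damping absorbs the derivative in the nonlinearity, uniformly in the mode
(\<open>mode_energy_bound\<close>); summing over the modes and applying Gronwall's inequality gives
\<open>burgers_solution_unique\<close>. The test functions needed here are products of
Fourier modes with smooth cutoffs in time.\<close>

section \<open>Square integrable functions on the torus\<close>

definition sq_int :: "(real \<Rightarrow> complex) \<Rightarrow> bool" where
  "sq_int f \<longleftrightarrow> f \<in> borel_measurable torus \<and> integrable torus (\<lambda>x. (cmod (f x))\<^sup>2)"

definition sqn :: "(real \<Rightarrow> complex) \<Rightarrow> real" where
  "sqn f = (LINT x|torus. (cmod (f x))\<^sup>2)"

lemma finite_measure_torus: "finite_measure torus"
  by (simp add: finite_measure_lebesgue_on)

lemma measure_torus [simp]: "measure torus {0..1} = 1"
  by (simp add: measure_restrict_space)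

lemma integrable_const_torus [simp]: "integrable torus (\<lambda>x. c :: 'a :: {banach, second_countable_topology})"
  using finite_measure.integrable_const[OF finite_measure_torus] .

lemma integral_const_torus [simp]:
  "(LINT x|torus. c) = (c :: 'a :: {banach, second_countable_topology})"
  by (simp add: lebesgue_integral_const)

lemma continuous_integrable_torus:
  fixes f :: "real \<Rightarrow> 'b::euclidean_space"
  assumes "continuous_on {0..1} f" shows "integrable torus f"
  using continuous_imp_integrable_real[OF assms] .

lemma LINT_torus_eq_integral:
  fixes f :: "real \<Rightarrow> 'b::euclidean_space"
  assumes "integrable torus f" shows "(LINT x|torus. f x) = integral {0..1} f"
  using lebesgue_integral_eq_integral[OF assms] by simp

lemma continuous_measurable_torus:
  fixes f :: "real \<Rightarrow> 'b::euclidean_space"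
  assumes "continuous_on {0..1} f" shows "f \<in> borel_measurable torus"
  using continuous_integrable_torus[OF assms] by simp

lemma sq_int_bounded:
  assumes "f \<in> borel_measurable torus" "AE x in torus. cmod (f x) \<le> B"
  shows "sq_int f"
proof -
  have "integrable torus (\<lambda>x. (cmod (f x))\<^sup>2)"
  proof (rule Bochner_Integration.integrable_bound[of _ "\<lambda>x. B\<^sup>2"])
    show "AE x in torus. norm ((cmod (f x))\<^sup>2) \<le> norm (B\<^sup>2)"
      using assms(2) by eventually_elim (auto intro!: power_mono)
  qed (use assms in auto)
  then show ?thesis using assms by (simp add: sq_int_def)
qed

lemma sq_int_continuous: "continuous_on {0..1} f \<Longrightarrow> sq_int f"
  unfolding sq_int_def
  by (auto intro!: continuous_measurable_torus continuous_integrable_torus continuous_intros)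

lemma sq_int_mult:
  assumes "sq_int f" "sq_int g"
  shows "integrable torus (\<lambda>x. f x * g x)"
proof (rule Bochner_Integration.integrable_bound[of _ "\<lambda>x. (cmod (f x))\<^sup>2 + (cmod (g x))\<^sup>2"])
  show "AE x in torus. norm (f x * g x) \<le> norm ((cmod (f x))\<^sup>2 + (cmod (g x))\<^sup>2)"
  proof (rule AE_I2)
    fix x
    have "0 \<le> (cmod (f x) - cmod (g x))\<^sup>2" by simp
    moreover have "0 \<le> cmod (f x) * cmod (g x)" by simp
    ultimately have "cmod (f x) * cmod (g x) \<le> (cmod (f x))\<^sup>2 + (cmod (g x))\<^sup>2"
      unfolding power2_diff by linarith
    then show "norm (f x * g x) \<le> norm ((cmod (f x))\<^sup>2 + (cmod (g x))\<^sup>2)"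
      by (simp add: norm_mult)
  qed
qed (use assms in \<open>auto simp: sq_int_def\<close>)

lemma sq_int_const: "sq_int (\<lambda>x. c)"
  by (rule sq_int_continuous) auto

lemma sq_int_integrable: "sq_int f \<Longrightarrow> integrable torus f"
  using sq_int_mult[OF _ sq_int_const[of 1], of f] by simp

lemma sq_int_cong:
  assumes "sq_int f" "AE x in torus. f x = g x" "g \<in> borel_measurable torus"
  shows "sq_int g"
proof -
  have "integrable torus (\<lambda>x. (cmod (g x))\<^sup>2)"
    using assms(1)[unfolded sq_int_def, THEN conjunct2]
    by (rule Bochner_Integration.integrable_cong_AE_imp)
       (use assms in \<open>auto simp: sq_int_def elim!: eventually_mono\<close>)
  then show ?thesis using assms by (simp add: sq_int_def)
qed

lemma sq_int_add:
  assumes "sq_int f" "sq_int g"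
  shows "sq_int (\<lambda>x. f x + g x)"
  unfolding sq_int_def
proof
  show "(\<lambda>x. f x + g x) \<in> borel_measurable torus" using assms by (auto simp: sq_int_def)
  show "integrable torus (\<lambda>x. (cmod (f x + g x))\<^sup>2)"
  proof (rule Bochner_Integration.integrable_bound[of _ "\<lambda>x. 2 * (cmod (f x))\<^sup>2 + 2 * (cmod (g x))\<^sup>2"])
    show "AE x in torus. norm ((cmod (f x + g x))\<^sup>2) \<le> norm (2 * (cmod (f x))\<^sup>2 + 2 * (cmod (g x))\<^sup>2)"
    proof (rule AE_I2)
      fix x
      have "(cmod (f x + g x))\<^sup>2 \<le> (cmod (f x) + cmod (g x))\<^sup>2"
        by (intro power_mono norm_triangle_ineq) auto
      also have "\<dots> \<le> 2 * (cmod (f x))\<^sup>2 + 2 * (cmod (g x))\<^sup>2"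
        using zero_le_power2[of "cmod (f x) - cmod (g x)"] by (simp add: power2_eq_square algebra_simps)
      finally show "norm ((cmod (f x + g x))\<^sup>2) \<le> norm (2 * (cmod (f x))\<^sup>2 + 2 * (cmod (g x))\<^sup>2)" by simp
    qed
  qed (use assms in \<open>auto simp: sq_int_def\<close>)
qed

lemma sq_int_cmult: "sq_int f \<Longrightarrow> sq_int (\<lambda>x. c * f x)"
  by (auto simp: sq_int_def norm_mult power_mult_distrib)

lemma sq_int_minus: "sq_int f \<Longrightarrow> sq_int (\<lambda>x. - f x)"
  using sq_int_cmult[of f "-1"] by simp

lemma sq_int_diff: "sq_int f \<Longrightarrow> sq_int g \<Longrightarrow> sq_int (\<lambda>x. f x - g x)"
  using sq_int_add[OF _ sq_int_minus, of f g] by simp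

lemma sq_int_sum: "(\<And>i. i \<in> I \<Longrightarrow> sq_int (f i)) \<Longrightarrow> sq_int (\<lambda>x. \<Sum>i\<in>I. f i x)"
  by (induction I rule: infinite_finite_induct) (auto intro: sq_int_add sq_int_const)

lemma sq_int_bounded_mult:
  assumes f: "sq_int f" and h: "h \<in> borel_measurable torus" "AE x in torus. cmod (h x) \<le> B"
  shows "sq_int (\<lambda>x. h x * f x)"
  unfolding sq_int_def
proof
  show "(\<lambda>x. h x * f x) \<in> borel_measurable torus" using assms by (auto simp: sq_int_def)
  show "integrable torus (\<lambda>x. (cmod (h x * f x))\<^sup>2)"
  proof (rule Bochner_Integration.integrable_bound[of _ "\<lambda>x. B\<^sup>2 * (cmod (f x))\<^sup>2"])
    show "AE x in torus. norm ((cmod (h x * f x))\<^sup>2) \<le> norm (B\<^sup>2 * (cmod (f x))\<^sup>2)"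
      using h(2)
    proof eventually_elim
      fix x assume "cmod (h x) \<le> B"
      then have "(cmod (h x))\<^sup>2 * (cmod (f x))\<^sup>2 \<le> B\<^sup>2 * (cmod (f x))\<^sup>2"
        by (intro mult_right_mono power_mono) auto
      then show "norm ((cmod (h x * f x))\<^sup>2) \<le> norm (B\<^sup>2 * (cmod (f x))\<^sup>2)"
        by (simp add: norm_mult power_mult_distrib)
    qed
  qed (use assms in \<open>auto simp: sq_int_def\<close>)
qed

lemma sq_int_cnj: "sq_int f \<Longrightarrow> sq_int (\<lambda>x. cnj (f x))"
  by (auto simp: sq_int_def intro: borel_measurable_continuous_on[of cnj, OF continuous_on_cnj[OF continuous_on_id]])

lemma sqn_nonneg [simp]: "sqn f \<ge> 0"
  by (auto simp: sqn_def)

lemma sqn_cong: "AE x in torus. f x = g x \<Longrightarrow> f \<in> borel_measurable torus \<Longrightarrow> g \<in> borel_measurable torus \<Longrightarrow> sqn f = sqn g"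
  unfolding sqn_def by (intro integral_cong_AE) (auto elim: eventually_mono)

lemma sqn_bounded_mult:
  assumes f: "sq_int f" and h: "h \<in> borel_measurable torus" "AE x in torus. cmod (h x) \<le> B"
  shows "sqn (\<lambda>x. h x * f x) \<le> B\<^sup>2 * sqn f"
proof -
  have "sqn (\<lambda>x. h x * f x) \<le> (LINT x|torus. B\<^sup>2 * (cmod (f x))\<^sup>2)"
    unfolding sqn_def
  proof (rule integral_mono_AE)
    show "integrable torus (\<lambda>x. (cmod (h x * f x))\<^sup>2)"
      using sq_int_bounded_mult[OF assms] by (simp add: sq_int_def)
    show "AE x in torus. (cmod (h x * f x))\<^sup>2 \<le> B\<^sup>2 * (cmod (f x))\<^sup>2"
      using h(2) by eventually_elim
        (auto simp: norm_mult power_mult_distrib intro!: mult_right_mono power_mono)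
  qed (use f in \<open>auto simp: sq_int_def\<close>)
  then show ?thesis by (simp add: sqn_def)
qed

lemma sqn_bounded:
  assumes "sq_int f" "AE x in torus. cmod (f x) \<le> B" shows "sqn f \<le> B\<^sup>2"
  using sqn_bounded_mult[OF sq_int_const[of 1], of f B] assms by (auto simp: sq_int_def sqn_def)

lemma sqn_cmult: "sqn (\<lambda>x. c * f x) = (cmod c)\<^sup>2 * sqn f"
  by (simp add: sqn_def norm_mult power_mult_distrib)

lemma sqn_minus_commute: "sqn (\<lambda>x. f x - g x) = sqn (\<lambda>x. g x - f x)"
  by (simp add: sqn_def norm_minus_commute)

lemma sqn_zero_imp_AE:
  assumes "sq_int f" "sqn f = 0" shows "AE x in torus. f x = 0"
  using integral_nonneg_eq_0_iff_AE[of torus "\<lambda>x. (cmod (f x))\<^sup>2"] assms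
  by (auto simp: sq_int_def sqn_def)

text \<open>The quadratic polynomial \<open>\<integral> (|f| + t |g|)\<^sup>2\<close> in \<open>t\<close> is nonnegative, so its
  discriminant is not positive.\<close>

lemma Cauchy_Schwarz_abs:
  assumes "sq_int f" "sq_int g"
  shows "(LINT x|torus. cmod (f x * g x)) \<le> sqrt (sqn f) * sqrt (sqn g)"
proof -
  define B where "B = (LINT x|torus. cmod (f x * g x))"
  have int: "integrable torus (\<lambda>x. cmod (f x * g x))" using sq_int_mult[OF assms] by simp
  have "B \<ge> 0" by (auto simp: B_def)
  have q: "0 \<le> sqn f + 2 * t * B + t\<^sup>2 * sqn g" for t
  proof -
    have "0 \<le> (LINT x|torus. (cmod (f x) + t * cmod (g x))\<^sup>2)" by auto
    also have "\<dots> = (LINT x|torus. (cmod (f x))\<^sup>2 + (2 * t) * cmod (f x * g x) + t\<^sup>2 * (cmod (g x))\<^sup>2)"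
      by (rule Bochner_Integration.integral_cong) (auto simp: norm_mult power2_sum power_mult_distrib)
    also have "\<dots> = sqn f + 2 * t * B + t\<^sup>2 * sqn g"
      using assms int by (simp add: sq_int_def sqn_def B_def)
    finally show ?thesis .
  qed
  have "B\<^sup>2 \<le> sqn f * sqn g"
  proof (cases "sqn g = 0")
    case True
    have "B = 0"
    proof (rule ccontr)
      assume "B \<noteq> 0"
      then show False using q[of "- (sqn f + 1) / (2 * B)"] True by (simp add: field_simps)
    qed
    then show ?thesis by simp
  next
    case False
    then have "sqn g > 0" using sqn_nonneg[of g] by linarith
    then show ?thesis using q[of "- B / sqn g"]
      by (simp add: field_simps power2_eq_square)
  qed
  then have "sqrt (B\<^sup>2) \<le> sqrt (sqn f * sqn g)" by (rule real_sqrt_le_mono)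
  then show ?thesis using \<open>B \<ge> 0\<close> by (simp add: B_def real_sqrt_mult)
qed

lemma Cauchy_Schwarz_torus:
  assumes "sq_int f" "sq_int g"
  shows "cmod (LINT x|torus. f x * g x) \<le> sqrt (sqn f) * sqrt (sqn g)"
  using Cauchy_Schwarz_abs[OF assms] integral_norm_bound[of torus "\<lambda>x. f x * g x"]
  by linarith

lemma sqn_triangle:
  assumes "sq_int f" "sq_int g"
  shows "sqrt (sqn (\<lambda>x. f x + g x)) \<le> sqrt (sqn f) + sqrt (sqn g)"
proof -
  have int: "integrable torus (\<lambda>x. cmod (f x * g x))" using sq_int_mult[OF assms] by simp
  have "sqn (\<lambda>x. f x + g x) \<le> (LINT x|torus. (cmod (f x))\<^sup>2 + 2 * cmod (f x * g x) + (cmod (g x))\<^sup>2)"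
    unfolding sqn_def
  proof (rule integral_mono)
    show "integrable torus (\<lambda>x. (cmod (f x + g x))\<^sup>2)" using sq_int_add[OF assms] by (simp add: sq_int_def)
    show "integrable torus (\<lambda>x. (cmod (f x))\<^sup>2 + 2 * cmod (f x * g x) + (cmod (g x))\<^sup>2)"
      using assms int by (auto simp: sq_int_def)
    fix x
    have "(cmod (f x + g x))\<^sup>2 \<le> (cmod (f x) + cmod (g x))\<^sup>2"
      by (intro power_mono norm_triangle_ineq) auto
    then show "(cmod (f x + g x))\<^sup>2 \<le> (cmod (f x))\<^sup>2 + 2 * cmod (f x * g x) + (cmod (g x))\<^sup>2"
      by (simp add: power2_sum norm_mult)
  qed
  also have "\<dots> = sqn f + 2 * (LINT x|torus. cmod (f x * g x)) + sqn g"
    using assms int by (simp add: sq_int_def sqn_def)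
  also have "\<dots> \<le> (sqrt (sqn f) + sqrt (sqn g))\<^sup>2"
    using Cauchy_Schwarz_abs[OF assms] by (simp add: power2_sum)
  finally show ?thesis by (meson real_le_lsqrt real_sqrt_ge_zero add_nonneg_nonneg sqn_nonneg)
qed

lemma sqn_triangle_diff:
  assumes "sq_int f" "sq_int g" "sq_int h"
  shows "sqrt (sqn (\<lambda>x. f x - h x)) \<le> sqrt (sqn (\<lambda>x. f x - g x)) + sqrt (sqn (\<lambda>x. g x - h x))"
  using sqn_triangle[OF sq_int_diff[OF assms(1,2)] sq_int_diff[OF assms(2,3)]] by simp

lemma sqn_reverse_triangle:
  assumes "sq_int f" "sq_int g"
  shows "\<bar>sqrt (sqn f) - sqrt (sqn g)\<bar> \<le> sqrt (sqn (\<lambda>x. f x - g x))"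
proof -
  have "sqrt (sqn f) \<le> sqrt (sqn (\<lambda>x. f x - g x)) + sqrt (sqn g)"
    using sqn_triangle[OF sq_int_diff[OF assms] assms(2)] by simp
  moreover have "sqrt (sqn g) \<le> sqrt (sqn (\<lambda>x. g x - f x)) + sqrt (sqn f)"
    using sqn_triangle[OF sq_int_diff[OF assms(2,1)] assms(1)] by simp
  ultimately show ?thesis using sqn_minus_commute[of f g] by simp
qed

text \<open>Strong convergence in \<open>L\<^sup>2\<close> is all that is needed to pass to the limit in a pairing; this is how identities for trigonometric polynomials are transferred to \<open>L\<^sup>2\<close> functions.\<close>

lemma tendsto_LINT_mult:
  assumes f: "\<And>i. sq_int (f i)" "sq_int f0" and g: "sq_int g"
    and lim: "((\<lambda>i. sqn (\<lambda>x. f i x - f0 x)) \<longlongrightarrow> 0) F"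
  shows "((\<lambda>i. LINT x|torus. f i x * g x) \<longlongrightarrow> (LINT x|torus. f0 x * g x)) F"
proof (rule LIM_zero_cancel, rule Lim_null_comparison)
  show "((\<lambda>i. norm (sqrt (sqn (\<lambda>x. f i x - f0 x)) * sqrt (sqn g))) \<longlongrightarrow> 0) F"
    using tendsto_norm_zero[OF tendsto_mult_left_zero[OF tendsto_real_sqrt[OF lim, simplified]]] .
  show "\<forall>\<^sub>F i in F. norm ((LINT x|torus. f i x * g x) - (LINT x|torus. f0 x * g x))
      \<le> norm (sqrt (sqn (\<lambda>x. f i x - f0 x)) * sqrt (sqn g))"
  proof (rule always_eventually, rule allI)
    fix i
    have "(LINT x|torus. f i x * g x) - (LINT x|torus. f0 x * g x) = (LINT x|torus. (f i x - f0 x) * g x)"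
      using sq_int_mult[OF f(1)[of i] g] sq_int_mult[OF f(2) g] by (simp add: left_diff_distrib)
    then show "norm ((LINT x|torus. f i x * g x) - (LINT x|torus. f0 x * g x))
        \<le> norm (sqrt (sqn (\<lambda>x. f i x - f0 x)) * sqrt (sqn g))"
      using Cauchy_Schwarz_torus[OF sq_int_diff[OF f(1)[of i] f(2)] g] by simp
  qed
qed

section \<open>Fourier coefficients\<close>

abbreviation freq :: "int \<Rightarrow> complex" where
  "freq n \<equiv> 2 * of_real pi * \<i> * of_int n"

definition emode :: "int \<Rightarrow> real \<Rightarrow> complex" where
  "emode n x = cis (2 * pi * of_int n * x)"

definition fc :: "(real \<Rightarrow> complex) \<Rightarrow> int \<Rightarrow> complex" where
  "fc f n = (LINT x|torus. emode (- n) x * f x)"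

lemma norm_emode [simp]: "cmod (emode n x) = 1"
  by (simp add: emode_def)

lemma emode_mult: "emode m x * emode n x = emode (m + n) x"
  by (simp add: emode_def cis_mult ring_distribs)

lemma emode_0 [simp]: "emode 0 x = 1"
  by (simp add: emode_def)

lemma cnj_emode: "cnj (emode n x) = emode (- n) x"
  by (simp add: emode_def cis_cnj)

lemma emode_periodic: "emode n (x + 1) = emode n x"
proof -
  have "2 * pi * of_int n * (x + 1) = 2 * pi * of_int n * x + 2 * pi * of_int n"
    by (simp add: ring_distribs)
  then have "emode n (x + 1) = emode n x * cis (2 * pi * of_int n)"
    by (simp only: emode_def cis_mult)
  moreover have "cis (2 * pi * of_int n) = 1" by (rule cis_multiple_2pi) auto
  ultimately show ?thesis by simp
qed

lemma emode_has_vector_derivative [derivative_intros]: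
  "((emode n) has_vector_derivative (freq n) * emode n x) (at x within S)"
proof -
  have "((\<lambda>z. exp ((freq n) * z)) has_field_derivative
      (freq n) * exp ((freq n) * of_real x)) (at (of_real x))"
    by (auto intro!: derivative_eq_intros)
  from has_vector_derivative_real_field[OF this] show ?thesis
    by (simp add: emode_def[abs_def] cis_conv_exp mult_ac has_vector_derivative_at_within)
qed

lemma continuous_emode [continuous_intros]: "continuous_on S (emode n)"
  unfolding emode_def[abs_def] by (intro continuous_intros)

lemma sq_int_emode: "sq_int (emode n)"
  by (intro sq_int_continuous continuous_intros)

lemma sq_int_emode_mult: "sq_int f \<Longrightarrow> sq_int (\<lambda>x. emode n x * f x)"
  by (rule sq_int_bounded_mult[where B=1]) (auto intro!: continuous_measurable_torus continuous_intros)

lemma integral_emode: "(LINT x|torus. emode n x) = (if n = 0 then 1 else 0)"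
proof (cases "n = 0")
  case False
  define c where "c = 2 * of_real pi * \<i> * (of_int n :: complex)"
  have "c \<noteq> 0" using False by (simp add: c_def)
  have "((\<lambda>x. c * emode n x) has_integral (emode n 1 - emode n 0)) {0..1}"
    by (rule fundamental_theorem_of_calculus) (auto simp: c_def intro!: emode_has_vector_derivative)
  then have "integral {0..1} (\<lambda>x. c * emode n x) = 0"
    using emode_periodic[of n 0] by (subst integral_unique) auto
  then have "(LINT x|torus. c * emode n x) = 0"
    by (subst LINT_torus_eq_integral) (auto intro!: continuous_integrable_torus continuous_intros)
  then show ?thesis using \<open>c \<noteq> 0\<close> False by simp
qed simp

lemma fc_emode: "fc (emode m) n = (if m = n then 1 else 0)"
  by (auto simp: fc_def emode_mult integral_emode)

lemma fc_add: "sq_int f \<Longrightarrow> sq_int g \<Longrightarrow> fc (\<lambda>x. f x + g x) n = fc f n + fc g n"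
  using sq_int_mult[OF sq_int_emode[of "-n"], of f] sq_int_mult[OF sq_int_emode[of "-n"], of g]
  by (simp add: fc_def ring_distribs)

lemma fc_cmult: "fc (\<lambda>x. c * f x) n = c * fc f n"
  by (simp add: fc_def mult.left_commute)

lemma fc_diff: "sq_int f \<Longrightarrow> sq_int g \<Longrightarrow> fc (\<lambda>x. f x - g x) n = fc f n - fc g n"
  using sq_int_mult[OF sq_int_emode[of "-n"], of f] sq_int_mult[OF sq_int_emode[of "-n"], of g]
  by (simp add: fc_def ring_distribs)

lemma fc_sum: "(\<And>i. i \<in> I \<Longrightarrow> sq_int (f i)) \<Longrightarrow> fc (\<lambda>x. \<Sum>i\<in>I. f i x) n = (\<Sum>i\<in>I. fc (f i) n)"
proof (induction I rule: infinite_finite_induct)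
  case (insert i I)
  then show ?case by (simp add: fc_add sq_int_sum)
qed (auto simp: fc_def)

lemma fc_cong: "AE x in torus. f x = g x \<Longrightarrow> f \<in> borel_measurable torus \<Longrightarrow> g \<in> borel_measurable torus \<Longrightarrow> fc f n = fc g n"
  unfolding fc_def
  using continuous_measurable_torus[OF continuous_emode[of "{0..1}" "-n"]]
  by (intro integral_cong_AE borel_measurable_times) (auto elim: eventually_mono)

lemma norm_fc_le: "sq_int f \<Longrightarrow> cmod (fc f n) \<le> sqrt (sqn f)"
  using Cauchy_Schwarz_torus[OF sq_int_emode[of "-n"], of f] by (simp add: fc_def sqn_def del: space_restrict_space)

definition trig :: "int set \<Rightarrow> (int \<Rightarrow> complex) \<Rightarrow> real \<Rightarrow> complex" where
  "trig F c x = (\<Sum>n\<in>F. c n * emode n x)"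

lemma continuous_trig [continuous_intros]: "continuous_on S (trig F c)"
  unfolding trig_def[abs_def] by (intro continuous_intros)

lemma sq_int_trig: "sq_int (trig F c)"
  by (intro sq_int_continuous continuous_intros)

lemma fc_trig: "finite F \<Longrightarrow> fc (trig F c) n = (if n \<in> F then c n else 0)"
  unfolding trig_def[abs_def]
  by (subst fc_sum) (auto simp: fc_cmult fc_emode sq_int_cmult sq_int_emode if_distrib cong: if_cong)

text \<open>Among all trigonometric polynomials with frequencies in \<open>F\<close> the Fourier partial sum is the
  closest one in \<open>L\<^sup>2\<close>; Bessel's inequality and completeness both come out of this identity.\<close>

lemma sqn_diff_trig:
  assumes f: "sq_int f" and F: "finite F"
  shows "sqn (\<lambda>x. f x - trig F c x)
    = sqn f - (\<Sum>n\<in>F. (cmod (fc f n))\<^sup>2) + (\<Sum>n\<in>F. (cmod (fc f n - c n))\<^sup>2)"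
proof -
  let ?p = "trig F c"
  have cs: "sq_int (\<lambda>x. cnj (f x))" using f by (rule sq_int_cnj)
  have e: "complex_of_real (sqn f) = (LINT x|torus. f x * cnj (f x))" if "sq_int f" for f
    unfolding sqn_def integral_complex_of_real[symmetric]
    by (simp add: complex_norm_square del: of_real_power)
  have fp: "(LINT x|torus. f x * cnj (?p x)) = (\<Sum>n\<in>F. fc f n * cnj (c n))" if f: "sq_int f" for f
  proof -
    have "(LINT x|torus. f x * cnj (?p x)) = (LINT x|torus. (\<Sum>n\<in>F. cnj (c n) * (emode (- n) x * f x)))"
      by (intro Bochner_Integration.integral_cong)
         (auto simp: trig_def sum_distrib_left cnj_emode algebra_simps)
    also have "\<dots> = (\<Sum>n\<in>F. LINT x|torus. cnj (c n) * (emode (- n) x * f x))"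
      using sq_int_mult[OF sq_int_emode f] by (intro Bochner_Integration.integral_sum) auto
    finally show ?thesis by (simp add: fc_def mult.commute)
  qed
  have pc: "sq_int (\<lambda>x. cnj (?p x))" by (intro sq_int_cnj sq_int_trig)
  have pf: "(LINT x|torus. ?p x * cnj (f x)) = cnj (\<Sum>n\<in>F. fc f n * cnj (c n))"
  proof -
    have "(LINT x|torus. ?p x * cnj (f x)) = (LINT x|torus. cnj (f x * cnj (?p x)))"
      by (simp add: mult.commute)
    also have "\<dots> = cnj (LINT x|torus. f x * cnj (?p x))"
      by (rule integral_bounded_linear[OF bounded_linear_cnj sq_int_mult[OF f pc]])
    finally show ?thesis using fp[OF f] by simp
  qed
  have pp: "(LINT x|torus. ?p x * cnj (?p x)) = (\<Sum>n\<in>F. c n * cnj (c n))"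
    using fp[OF sq_int_trig] F by (simp add: fc_trig)
  have "complex_of_real (sqn (\<lambda>x. f x - ?p x)) = (LINT x|torus. (f x - ?p x) * cnj (f x - ?p x))"
    by (rule e) (intro sq_int_diff f sq_int_trig)
  also have "\<dots> = (LINT x|torus. f x * cnj (f x) - f x * cnj (?p x) - ?p x * cnj (f x) + ?p x * cnj (?p x))"
    by (intro Bochner_Integration.integral_cong) (auto simp: algebra_simps)
  also have "\<dots> = sqn f - (\<Sum>n\<in>F. fc f n * cnj (c n)) - cnj (\<Sum>n\<in>F. fc f n * cnj (c n)) + (\<Sum>n\<in>F. c n * cnj (c n))"
    using sq_int_mult[OF f cs] sq_int_mult[OF f pc] sq_int_mult[OF sq_int_trig[of F c] cs]
      sq_int_mult[OF sq_int_trig[of F c] pc]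
    by (simp add: fp[OF f] pf pp e[OF f])
  also have "\<dots> = complex_of_real (sqn f - (\<Sum>n\<in>F. (cmod (fc f n))\<^sup>2) + (\<Sum>n\<in>F. (cmod (fc f n - c n))\<^sup>2))"
    by (simp add: complex_norm_square sum.distrib[symmetric] sum_subtractf[symmetric] cnj_sum
        del: of_real_power) (simp add: algebra_simps sum.distrib sum_subtractf)
  finally show ?thesis unfolding of_real_eq_iff .
qed

lemma Bessel: "sq_int f \<Longrightarrow> finite F \<Longrightarrow> (\<Sum>n\<in>F. (cmod (fc f n))\<^sup>2) \<le> sqn f"
  using sqn_diff_trig[of f F "fc f"] sqn_nonneg[of "\<lambda>x. f x - trig F (fc f) x"] by simp

section \<open>Completeness of the trigonometric system\<close>

definition is_trig :: "(real \<Rightarrow> complex) \<Rightarrow> bool" where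
  "is_trig f \<longleftrightarrow> (\<exists>F c. finite F \<and> f = trig F c)"

lemma is_trig_mode: "is_trig (\<lambda>x. c * emode n x)"
  unfolding is_trig_def by (rule exI[of _ "{n}"], rule exI[of _ "\<lambda>_. c"]) (auto simp: trig_def)

lemma is_trig_const: "is_trig (\<lambda>x. c)"
  using is_trig_mode[of c 0] by simp

lemma is_trig_add:
  assumes "is_trig f" "is_trig g" shows "is_trig (\<lambda>x. f x + g x)"
proof -
  obtain F c G d where F: "finite F" "f = trig F c" and G: "finite G" "g = trig G d"
    using assms by (auto simp: is_trig_def)
  define C where "C n = (if n \<in> F then c n else 0) + (if n \<in> G then d n else 0)" for n
  have "f x + g x = trig (F \<union> G) C x" for x
  proof -
    have "f x = (\<Sum>n\<in>F \<union> G. (if n \<in> F then c n else 0) * emode n x)"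
      unfolding F trig_def by (rule sum.mono_neutral_cong_left) (use F G in auto)
    moreover have "g x = (\<Sum>n\<in>F \<union> G. (if n \<in> G then d n else 0) * emode n x)"
      unfolding G trig_def by (rule sum.mono_neutral_cong_left) (use F G in auto)
    ultimately show ?thesis by (simp add: trig_def C_def sum.distrib ring_distribs)
  qed
  then show ?thesis unfolding is_trig_def using F G by (intro exI[of _ "F \<union> G"] exI[of _ C]) auto
qed

lemma is_trig_sum: "(\<And>i. i \<in> I \<Longrightarrow> is_trig (f i)) \<Longrightarrow> is_trig (\<lambda>x. \<Sum>i\<in>I. f i x)"
  by (induction I rule: infinite_finite_induct) (auto intro: is_trig_add is_trig_const)

lemma is_trig_mult:
  assumes "is_trig f" "is_trig g" shows "is_trig (\<lambda>x. f x * g x)"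
proof -
  obtain F c G d where F: "finite F" "f = trig F c" and G: "finite G" "g = trig G d"
    using assms by (auto simp: is_trig_def)
  have "f x * g x = (\<Sum>n\<in>F. \<Sum>m\<in>G. (c n * d m) * emode (n + m) x)" for x
    unfolding F G trig_def sum_product by (simp add: emode_mult[symmetric] mult_ac)
  then show ?thesis by (simp add: is_trig_sum is_trig_mode)
qed

lemma is_trig_real_polynomial:
  fixes p :: "complex \<Rightarrow> real"
  assumes "real_polynomial_function p"
  shows "is_trig (\<lambda>x. complex_of_real (p (emode 1 x)))"
  using assms
proof (induction p rule: real_polynomial_function.induct)
  case (linear f)
  interpret bounded_linear f by fact
  have eq: "complex_of_real (f z) = (f 1 - \<i> * f \<i>) / 2 * z + (f 1 + \<i> * f \<i>) / 2 * cnj z" for z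
  proof -
    have "z = Re z *\<^sub>R 1 + Im z *\<^sub>R \<i>" by (simp add: complex_eq_iff)
    then have "f z = f (Re z *\<^sub>R 1 + Im z *\<^sub>R \<i>)" by (rule arg_cong)
    then have "f z = Re z * f 1 + Im z * f \<i>" by (simp add: add scaleR)
    then show ?thesis by (simp add: complex_eq_iff) (simp add: field_simps)
  qed
  show ?case unfolding eq[of "emode 1 _"] cnj_emode by (intro is_trig_add is_trig_mode)
qed (auto intro: is_trig_add is_trig_mult is_trig_const)

lemma is_trig_polynomial:
  fixes p :: "complex \<Rightarrow> complex"
  assumes "polynomial_function p"
  shows "is_trig (\<lambda>x. p (emode 1 x))"
proof -
  have "real_polynomial_function (Re \<circ> p)" "real_polynomial_function (Im \<circ> p)"
    using assms bounded_linear_Re bounded_linear_Im by (auto simp: polynomial_function_def)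
  from this[THEN is_trig_real_polynomial]
  have "is_trig (\<lambda>x. complex_of_real (Re (p (emode 1 x))) + \<i> * complex_of_real (Im (p (emode 1 x))))"
    by (intro is_trig_add is_trig_mult is_trig_const) (auto simp: o_def)
  then show ?thesis by (simp flip: complex_eq)
qed

text \<open>A closed curve factors through the circle. The factor is continuous because \<open>[0,1]\<close> is
  compact, so the Stone--Weierstrass theorem applies to it on the circle, where polynomials in
  \<open>Re z\<close> and \<open>Im z\<close> are trigonometric polynomials.\<close>

lemma loop_trig_approx:
  assumes h: "continuous_on {0..1} h" "h 0 = h 1" and e: "0 < e"
  obtains p where "is_trig p" "\<And>x. x \<in> {0..1} \<Longrightarrow> cmod (h x - p x) < e"
proof -
  define H where "H z = h (Arg2pi z / (2 * pi))" for z
  have He: "H (emode 1 x) = h x" if "x \<in> {0..1}" for x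
  proof (cases "x = 1")
    case True
    then have "emode 1 x = 1" using emode_periodic[of 1 0] by (simp add: emode_def)
    then show ?thesis using True h(2) by (simp add: H_def Arg2pi_of_real[of 1, simplified])
  next
    case False
    then have "Arg2pi (emode 1 x) = 2 * pi * x"
      using that by (intro Arg2pi_unique[of 1]) (auto simp: emode_def cis_conv_exp)
    then show ?thesis by (simp add: H_def)
  qed
  have im: "emode 1 ` {0..1} = sphere 0 1"
  proof (intro equalityI subsetI)
    fix z :: complex assume "z \<in> sphere 0 1"
    then have "cis (Arg2pi z) = z" by (simp add: complex_norm_eq_1_exp cis_conv_exp)
    then have "z = emode 1 (Arg2pi z / (2 * pi))" by (simp add: emode_def)
    moreover have "Arg2pi z / (2 * pi) \<in> {0..1}"
      using Arg2pi_ge_0[of z] Arg2pi_lt_2pi[of z] by (simp add: field_simps)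
    ultimately show "z \<in> emode 1 ` {0..1}" by blast
  qed auto
  have "continuous_on (sphere 0 1) H"
  proof (subst continuous_on_closed_vimage, simp, intro allI impI)
    fix B :: "complex set" assume "closed B"
    then have "closed (h -` B \<inter> {0..1})" using h(1) by (simp add: continuous_on_closed_vimage)
    then have "compact (h -` B \<inter> {0..1})"
      by (metis Int_lower2 bounded_subset bounded_closed_interval compact_eq_bounded_closed)
    then have "compact (emode 1 ` (h -` B \<inter> {0..1}))"
      by (intro compact_continuous_image continuous_intros)
    moreover have "emode 1 ` (h -` B \<inter> {0..1}) = H -` B \<inter> sphere 0 1"
      unfolding im[symmetric] using He by force
    ultimately show "closed (H -` B \<inter> sphere 0 1)" by (simp add: compact_imp_closed)
  qed
  from Stone_Weierstrass_polynomial_function[OF compact_sphere this e]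
  obtain g where g: "polynomial_function g" "\<And>z. z \<in> sphere 0 1 \<Longrightarrow> cmod (H z - g z) < e" by auto
  show ?thesis
  proof
    show "is_trig (\<lambda>x. g (emode 1 x))" using g(1) by (rule is_trig_polynomial)
    show "cmod (h x - g (emode 1 x)) < e" if "x \<in> {0..1}" for x
      using g(2)[of "emode 1 x"] He[OF that] by simp
  qed
qed

text \<open>A measurable function is an almost everywhere limit of continuous ones. Projecting these onto a disc keeps the bound, and a cutoff at both ends of the interval turns them into closed curves.\<close>

lemma bounded_loop_limit:
  assumes f: "f \<in> borel_measurable torus" and B: "\<And>x. cmod (f x) \<le> B" "B > 0"
  obtains h :: "nat \<Rightarrow> real \<Rightarrow> complex" where
    "\<And>n. continuous_on {0..1} (h n)" "\<And>n. h n 0 = h n 1" "\<And>n x. x \<in> {0..1} \<Longrightarrow> cmod (h n x) \<le> B"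
    "AE x in torus. (\<lambda>n. h n x) \<longlonglongrightarrow> f x"
proof -
  have "f measurable_on {0..1}" using f by (simp add: measurable_on_iff_borel_measurable)
  then obtain N g where N: "negligible N" and g: "\<And>n. continuous_on UNIV (g n)"
    and lim: "\<And>x. x \<notin> N \<Longrightarrow> (\<lambda>n. g n x) \<longlonglongrightarrow> (if x \<in> {0..1} then f x else 0)"
    unfolding measurable_on_def by metis
  define r where "r z = z / of_real (max 1 (cmod z / B))" for z :: complex
  define k where "k n x = min 1 (real n * (x * (1 - x)))" for n and x :: real
  define h where "h n x = of_real (k n x) * r (g n x)" for n x
  have r: "continuous_on UNIV r" unfolding r_def
    using B by (intro continuous_intros) (auto simp: max_def)
  have nr: "cmod (r z) \<le> B" for z
  proof -
    have "cmod z \<le> B * max 1 (cmod z / B)" using B by (auto simp: max_def field_simps)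
    then show ?thesis using B by (auto simp: r_def norm_divide divide_le_eq max_def)
  qed
  have rid: "r z = z" if "cmod z \<le> B" for z using that B by (simp add: r_def max_def divide_le_eq)
  have "continuous_on {0..1} (h n)" for n
    unfolding h_def k_def
    by (intro continuous_intros continuous_on_compose2[OF r] continuous_on_subset[OF g]) auto
  moreover have "h n 0 = h n 1" for n by (simp add: h_def k_def)
  moreover have "cmod (h n x) \<le> B" if "x \<in> {0..1}" for n x
  proof -
    have "0 \<le> k n x" "k n x \<le> 1" using that by (auto simp: k_def)
    then have "cmod (h n x) \<le> 1 * B" unfolding h_def norm_mult
      using nr[of "g n x"] by (intro mult_mono) auto
    then show ?thesis by simp
  qed
  moreover have "AE x in torus. (\<lambda>n. h n x) \<longlonglongrightarrow> f x"
  proof -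
    have "AE x in lebesgue. x \<notin> N \<union> {0, 1}"
      using N by (intro AE_not_in) (simp flip: negligible_iff_null_sets)
    then have "AE x in torus. x \<notin> N \<union> {0, 1}"
      by (subst AE_restrict_space_iff) (simp, erule eventually_mono, blast)
    then show ?thesis
    proof (rule AE_mp, intro AE_I2 impI)
      fix x assume "x \<in> space torus" "x \<notin> N \<union> {0, 1}"
      then have x: "0 < x" "x < 1" "x \<notin> N" by auto
      have "(\<lambda>n. r (g n x)) \<longlonglongrightarrow> r (f x)"
        using lim[OF x(3)] x r
        by (intro isCont_tendsto_compose[of "f x" r]) (auto simp: continuous_on_eq_continuous_at)
      moreover have "(\<lambda>n. k n x) \<longlonglongrightarrow> 1"
      proof (rule tendsto_eventually)
        obtain m where m: "1 / (x * (1 - x)) \<le> real m" using real_arch_simple by blast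
        show "\<forall>\<^sub>F n in sequentially. k n x = 1"
          using eventually_ge_at_top[of m]
        proof eventually_elim
          fix n assume "m \<le> n"
          then have "1 / (x * (1 - x)) \<le> real n" using m by linarith
          then show "k n x = 1" using x by (simp add: k_def pos_divide_le_eq)
        qed
      qed
      ultimately have "(\<lambda>n. h n x) \<longlonglongrightarrow> of_real 1 * r (f x)"
        unfolding h_def by (intro tendsto_intros)
      then show "(\<lambda>n. h n x) \<longlonglongrightarrow> f x" using rid B by simp
    qed
  qed
  ultimately show ?thesis using that by blast
qed

lemma sqn_dominated_convergence:
  assumes [measurable]: "\<And>n. s n \<in> borel_measurable torus" "f \<in> borel_measurable torus"
    and w: "integrable torus w"
    and b: "\<And>n. AE x in torus. (cmod (f x - s n x))\<^sup>2 \<le> w x"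
    and lim: "AE x in torus. (\<lambda>n. s n x) \<longlonglongrightarrow> f x"
  shows "(\<lambda>n. sqn (\<lambda>x. f x - s n x)) \<longlonglongrightarrow> 0"
proof -
  have "(\<lambda>n. LINT x|torus. (cmod (f x - s n x))\<^sup>2) \<longlonglongrightarrow> (LINT x|torus. 0)"
  proof (rule integral_dominated_convergence)
    show "AE x in torus. (\<lambda>n. (cmod (f x - s n x))\<^sup>2) \<longlonglongrightarrow> 0"
      using lim by eventually_elim (auto intro!: tendsto_eq_intros)
    show "AE x in torus. norm ((cmod (f x - s n x))\<^sup>2) \<le> w x" for n
      using b[of n] by eventually_elim auto
  qed (use w in auto)
  then show ?thesis by (simp add: sqn_def)
qed

lemma is_trig_sq_int: "is_trig p \<Longrightarrow> sq_int p"
  by (auto simp: is_trig_def sq_int_trig)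

lemma is_trig_measurable: "is_trig p \<Longrightarrow> p \<in> borel_measurable torus"
  using is_trig_sq_int by (auto simp: sq_int_def)

text \<open>The approximating curves are uniformly bounded, so pointwise convergence almost everywhere improves to convergence in \<open>L\<^sup>2\<close>.\<close>

lemma bounded_trig_dense:
  assumes f: "f \<in> borel_measurable torus" and B: "\<And>x. cmod (f x) \<le> B" "B > 0" and e: "0 < e"
  obtains p where "is_trig p" "sqn (\<lambda>x. f x - p x) < e"
proof -
  obtain h where h: "\<And>n. continuous_on {0..1} (h n)" "\<And>n. h n 0 = h n 1"
    "\<And>n x. x \<in> {0..1} \<Longrightarrow> cmod (h n x) \<le> B" "AE x in torus. (\<lambda>n. h n x) \<longlonglongrightarrow> f x"
    by (rule bounded_loop_limit[OF f B]) (rule that)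
  have "\<exists>p. is_trig p \<and> (\<forall>x\<in>{0..1}. cmod (h n x - p x) < inverse (real (Suc n)))" for n
  proof -
    have "0 < inverse (real (Suc n))" by simp
    obtain p where "is_trig p" "\<And>x. x \<in> {0..1} \<Longrightarrow> cmod (h n x - p x) < inverse (real (Suc n))"
      by (rule loop_trig_approx[OF h(1)[of n] h(2)[of n] \<open>0 < inverse (real (Suc n))\<close>]) (rule that)
    then show ?thesis by auto
  qed
  then obtain p where p: "\<And>n. is_trig (p n)"
    "\<And>n x. x \<in> {0..1} \<Longrightarrow> cmod (h n x - p n x) < inverse (real (Suc n))" by metis
  have "(\<lambda>n. sqn (\<lambda>x. f x - p n x)) \<longlonglongrightarrow> 0"
  proof (rule sqn_dominated_convergence)
    show "p n \<in> borel_measurable torus" for n using p(1) by (rule is_trig_measurable)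
    show "integrable torus (\<lambda>x. (2 * B + 1)\<^sup>2)" by simp
    show "AE x in torus. (cmod (f x - p n x))\<^sup>2 \<le> (2 * B + 1)\<^sup>2" for n
    proof (intro AE_I2 power_mono)
      fix x assume "x \<in> space torus"
      then have x: "x \<in> {0..1}" by simp
      have "cmod (f x - p n x) \<le> cmod (f x) + cmod (h n x) + cmod (h n x - p n x)"
        using norm_triangle_ineq4[of "f x" "h n x"] norm_triangle_ineq[of "f x - h n x" "h n x - p n x"] by simp
      moreover have "inverse (real (Suc n)) \<le> 1" by (simp add: field_simps)
      ultimately show "cmod (f x - p n x) \<le> 2 * B + 1"
        using B(1)[of x] h(3)[OF x, of n] p(2)[OF x, of n] by linarith
    qed auto
    show "AE x in torus. (\<lambda>n. p n x) \<longlonglongrightarrow> f x"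
      using h(4)
    proof (rule AE_mp, intro AE_I2 impI)
      fix x assume x: "x \<in> space torus" and l: "(\<lambda>n. h n x) \<longlonglongrightarrow> f x"
      have "(\<lambda>n. h n x - p n x) \<longlonglongrightarrow> 0"
        by (rule Lim_null_comparison[OF _ LIMSEQ_inverse_real_of_nat])
           (use p(2)[of x] x in \<open>auto intro!: always_eventually less_imp_le\<close>)
      from tendsto_diff[OF l this] show "(\<lambda>n. p n x) \<longlonglongrightarrow> f x" by simp
    qed
  qed (use f in auto)
  then have "\<forall>\<^sub>F n in sequentially. sqn (\<lambda>x. f x - p n x) < e" using e by (rule order_tendstoD)
  then obtain n where "sqn (\<lambda>x. f x - p n x) < e" by (auto simp: eventually_sequentially)
  then show ?thesis using that p(1) by blast
qed

text \<open>Truncating the values at a large level reduces the claim to bounded functions.\<close>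

theorem trig_dense:
  assumes f: "sq_int f" and e: "0 < e"
  obtains p where "is_trig p" "sqn (\<lambda>x. f x - p x) < e"
proof -
  have [measurable]: "f \<in> borel_measurable torus" using f by (simp add: sq_int_def)
  define s where "s n x = (if cmod (f x) \<le> real n then f x else 0)" for n :: nat and x
  have [measurable]: "s n \<in> borel_measurable torus" for n
    unfolding s_def by (intro measurable_If) measurable
  have "(\<lambda>n. sqn (\<lambda>x. f x - s n x)) \<longlonglongrightarrow> 0"
  proof (rule sqn_dominated_convergence)
    show "integrable torus (\<lambda>x. (cmod (f x))\<^sup>2)" using f by (simp add: sq_int_def)
    show "AE x in torus. (cmod (f x - s n x))\<^sup>2 \<le> (cmod (f x))\<^sup>2" for n
      by (intro AE_I2) (auto simp: s_def)
    show "AE x in torus. (\<lambda>n. s n x) \<longlonglongrightarrow> f x"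
    proof (intro AE_I2 tendsto_eventually)
      fix x
      obtain m where "cmod (f x) \<le> real m" using real_arch_simple by blast
      then have "n \<ge> m \<Longrightarrow> s n x = f x" for n by (simp add: s_def)
      then show "\<forall>\<^sub>F n in sequentially. s n x = f x"
        unfolding eventually_sequentially by blast
    qed
  qed auto
  then have "\<forall>\<^sub>F n in sequentially. sqn (\<lambda>x. f x - s n x) < e / 4" using e by (intro order_tendstoD) auto
  then obtain n where n: "sqn (\<lambda>x. f x - s n x) < e / 4" by (auto simp: eventually_sequentially)
  have bs: "cmod (s n x) \<le> real n + 1" for x by (simp add: s_def)
  have ss: "sq_int (s n)" by (rule sq_int_bounded[where B="real n + 1"]) (use bs in auto)
  obtain p where p: "is_trig p" "sqn (\<lambda>x. s n x - p x) < e / 4"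
    using bounded_trig_dense[of "s n" "real n + 1" "e / 4"] bs e by auto
  have "sqrt (sqn (\<lambda>x. f x - p x)) \<le> sqrt (sqn (\<lambda>x. f x - s n x)) + sqrt (sqn (\<lambda>x. s n x - p x))"
    by (rule sqn_triangle_diff[OF f ss is_trig_sq_int[OF p(1)]])
  also have "\<dots> < sqrt (e / 4) + sqrt (e / 4)" using n p(2) by (intro add_strict_mono) auto
  also have "\<dots> = sqrt e" by (simp add: real_sqrt_divide)
  finally show ?thesis using that p(1) by simp
qed

text \<open>By \<open>sqn_diff_trig\<close> the defect \<open>\<parallel>f\<parallel>\<^sup>2 - \<Sum> |f\<^sub>n|\<^sup>2\<close> is at most the squared distance from \<open>f\<close> to any trigonometric polynomial with frequencies in the range of summation.\<close>

theorem Parseval: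
  assumes f: "sq_int f"
  shows "((\<lambda>n. (cmod (fc f n))\<^sup>2) has_sum sqn f) UNIV"
  unfolding has_sum_def
proof (rule tendstoI)
  fix e :: real assume "e > 0"
  then obtain p where p: "is_trig p" "sqn (\<lambda>x. f x - p x) < e" by (rule trig_dense[OF f])
  then obtain F c where F: "finite F" "p = trig F c" by (auto simp: is_trig_def)
  have "dist (\<Sum>n\<in>G. (cmod (fc f n))\<^sup>2) (sqn f) < e" if "finite G" "F \<subseteq> G" for G
  proof -
    have "sqn f - (\<Sum>n\<in>F. (cmod (fc f n))\<^sup>2) \<le> sqn (\<lambda>x. f x - p x)"
      unfolding F(2) sqn_diff_trig[OF f F(1)] by (simp add: sum_nonneg)
    moreover have "(\<Sum>n\<in>F. (cmod (fc f n))\<^sup>2) \<le> (\<Sum>n\<in>G. (cmod (fc f n))\<^sup>2)"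
      using that by (intro sum_mono2) auto
    ultimately show ?thesis using Bessel[OF f that(1)] p(2) by (simp add: dist_real_def)
  qed
  then show "\<forall>\<^sub>F G in finite_subsets_at_top UNIV. dist (\<Sum>n\<in>G. (cmod (fc f n))\<^sup>2) (sqn f) < e"
    unfolding eventually_finite_subsets_at_top using F(1) by blast
qed

lemma Fourier_partial_sums_tendsto:
  assumes f: "sq_int f"
  shows "((\<lambda>F. sqn (\<lambda>x. trig F (fc f) x - f x)) \<longlongrightarrow> 0) (finite_subsets_at_top UNIV)"
proof -
  have "((\<lambda>F. sqn f - (\<Sum>n\<in>F. (cmod (fc f n))\<^sup>2)) \<longlongrightarrow> sqn f - sqn f) (finite_subsets_at_top UNIV)"
    using Parseval[OF f] unfolding has_sum_def by (intro tendsto_intros)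
  moreover have "\<forall>\<^sub>F F in finite_subsets_at_top UNIV.
      sqn f - (\<Sum>n\<in>F. (cmod (fc f n))\<^sup>2) = sqn (\<lambda>x. trig F (fc f) x - f x)"
    unfolding sqn_minus_commute[of "trig _ _"]
    by (rule eventually_finite_subsets_at_top_weakI) (simp add: sqn_diff_trig[OF f])
  ultimately show ?thesis using tendsto_cong by fastforce
qed

lemma fc_zero_imp_AE_zero:
  assumes "sq_int f" "\<And>n. fc f n = 0" shows "AE x in torus. f x = 0"
  using has_sum_unique[OF Parseval[OF assms(1)], of 0] assms by (simp add: sqn_zero_imp_AE)

lemma fc_eq_imp_AE_eq:
  assumes "sq_int f" "sq_int g" "\<And>n. fc f n = fc g n" shows "AE x in torus. f x = g x"
  using fc_zero_imp_AE_zero[OF sq_int_diff[OF assms(1,2)]] assms by (simp add: fc_diff)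

section \<open>Weak derivatives in Fourier coefficients\<close>

lemma L2_torus_iff: "L2_torus f \<longleftrightarrow> periodic1 f \<and> sq_int f"
  by (auto simp: L2_torus_def sq_int_def)

text \<open>The second function is the weak derivative of the first (\<open>weak_deriv_of_iff\<close>). Phrased with Fourier
coefficients the relation is visibly linear, insensitive to null sets and meaningful before any regularity is
known.\<close>

definition H1_pair :: "(real \<Rightarrow> complex) \<Rightarrow> (real \<Rightarrow> complex) \<Rightarrow> bool" where
  "H1_pair f g \<longleftrightarrow> sq_int f \<and> sq_int g \<and> (\<forall>n. fc g n = freq n * fc f n)"

lemma H1_pairD:
  assumes "H1_pair f g"
  shows "sq_int f" "sq_int g" "fc g n = freq n * fc f n"
  using assms by (auto simp: H1_pair_def)

text \<open>Replace \<open>f\<close> and \<open>g\<close> by Fourier partial sums: mode by mode the identity is the hypothesis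
  on the coefficients, and both sides are continuous in \<open>L\<^sup>2\<close>.\<close>

lemma H1_pair_parts:
  assumes fg: "H1_pair f g" and hk: "H1_pair h k"
  shows "(LINT x|torus. f x * k x) = - (LINT x|torus. g x * h x)"
proof -
  note f = H1_pairD[OF fg] and h = H1_pairD[OF hk]
  have tr: "(LINT x|torus. trig F c x * w x) = (\<Sum>n\<in>F. c n * fc w (- n))" if "finite F" "sq_int w" for F c w
  proof -
    have "(LINT x|torus. trig F c x * w x) = (LINT x|torus. (\<Sum>n\<in>F. c n * (emode n x * w x)))"
      by (simp add: trig_def sum_distrib_right mult.assoc)
    also have "\<dots> = (\<Sum>n\<in>F. LINT x|torus. c n * (emode n x * w x))"
      using sq_int_mult[OF sq_int_emode that(2)] by (intro Bochner_Integration.integral_sum) auto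
    finally show ?thesis by (simp add: fc_def)
  qed
  have lhs: "((\<lambda>F. LINT x|torus. trig F (fc f) x * k x) \<longlongrightarrow> (LINT x|torus. f x * k x)) (finite_subsets_at_top UNIV)"
    by (intro tendsto_LINT_mult sq_int_trig f h Fourier_partial_sums_tendsto)
  have rhs: "((\<lambda>F. - (LINT x|torus. trig F (fc g) x * h x)) \<longlongrightarrow> - (LINT x|torus. g x * h x)) (finite_subsets_at_top UNIV)"
    by (intro tendsto_minus tendsto_LINT_mult sq_int_trig f h Fourier_partial_sums_tendsto)
  have "\<forall>\<^sub>F F in finite_subsets_at_top UNIV.
      (LINT x|torus. trig F (fc f) x * k x) = - (LINT x|torus. trig F (fc g) x * h x)"
    by (rule eventually_finite_subsets_at_top_weakI)
       (simp add: tr h(1,2), simp add: f h sum_negf[symmetric] mult_ac)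
  from Lim_transform_eventually[OF lhs this] rhs show ?thesis
    by (rule tendsto_unique[OF finite_subsets_at_top_neq_bot])
qed

lemma H1_pair_emode_mult:
  assumes "H1_pair f g"
  shows "H1_pair (\<lambda>x. emode k x * f x) (\<lambda>x. emode k x * g x + freq k * (emode k x * f x))"
proof -
  note f = H1_pairD[OF assms]
  have fcm: "fc (\<lambda>x. emode k x * w x) n = fc w (n - k)" for w n
    by (simp add: fc_def mult.assoc[symmetric] emode_mult)
  show ?thesis
    unfolding H1_pair_def
  proof (intro conjI allI)
    show "fc (\<lambda>x. emode k x * g x + freq k * (emode k x * f x)) n
        = freq n * fc (\<lambda>x. emode k x * f x) n" for n
      using f by (simp add: fc_add sq_int_emode_mult sq_int_cmult fc_cmult fcm ring_distribs)
  qed (use f in \<open>auto intro!: sq_int_add sq_int_cmult sq_int_emode_mult\<close>)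
qed

text \<open>Integrate by parts against the second function multiplied by a Fourier mode. With \<open>h = f\<close> this evaluates the nonlinearity \<open>u \<partial>\<^sub>x u\<close> of a weak solution.\<close>

lemma H1_pair_product_fc:
  assumes fg: "H1_pair f g" and hk: "H1_pair h k"
  shows "(LINT x|torus. emode (- n) x * (g x * h x)) + (LINT x|torus. emode (- n) x * (f x * k x))
    = freq n * (LINT x|torus. emode (- n) x * (f x * h x))"
proof -
  note f = H1_pairD[OF fg] and h = H1_pairD[OF hk]
  let ?c = "freq n"
  have i1: "integrable torus (\<lambda>x. emode (- n) x * (f x * k x))"
    using sq_int_mult[OF sq_int_emode_mult[OF f(1)] h(2)] by (simp add: mult.assoc)
  have i2: "integrable torus (\<lambda>x. emode (- n) x * (f x * h x))"
    using sq_int_mult[OF sq_int_emode_mult[OF f(1)] h(1)] by (simp add: mult.assoc)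
  have "(LINT x|torus. f x * (emode (- n) x * k x + freq (- n) * (emode (- n) x * h x)))
      = (LINT x|torus. emode (- n) x * (f x * k x) - ?c * (emode (- n) x * (f x * h x)))"
    by (rule Bochner_Integration.integral_cong) (auto simp: algebra_simps)
  also have "\<dots> = (LINT x|torus. emode (- n) x * (f x * k x)) - ?c * (LINT x|torus. emode (- n) x * (f x * h x))"
    using i1 i2 by simp
  also have "(LINT x|torus. f x * (emode (- n) x * k x + freq (- n) * (emode (- n) x * h x)))
      = - (LINT x|torus. emode (- n) x * (g x * h x))"
    unfolding H1_pair_parts[OF fg H1_pair_emode_mult[OF hk]]
    by (intro arg_cong[of _ _ uminus] Bochner_Integration.integral_cong) auto
  finally show ?thesis by (simp add: algebra_simps)
qed

lemma H1_pair_product: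
  assumes fg: "H1_pair f g" and hk: "H1_pair h k"
    and sq: "sq_int (\<lambda>x. f x * h x)" "sq_int (\<lambda>x. g x * h x)" "sq_int (\<lambda>x. f x * k x)"
  shows "H1_pair (\<lambda>x. f x * h x) (\<lambda>x. g x * h x + f x * k x)"
  unfolding H1_pair_def
  using H1_pair_product_fc[OF fg hk] sq sq_int_add[OF sq(2,3)]
  by (simp add: fc_add) (simp add: fc_def)

lemma H1_pair_add:
  "H1_pair f g \<Longrightarrow> H1_pair h k \<Longrightarrow> H1_pair (\<lambda>x. f x + h x) (\<lambda>x. g x + k x)"
  by (auto simp: H1_pair_def fc_add ring_distribs intro: sq_int_add)

lemma H1_pair_cmult: "H1_pair f g \<Longrightarrow> H1_pair (\<lambda>x. c * f x) (\<lambda>x. c * g x)"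
  by (auto simp: H1_pair_def fc_cmult intro: sq_int_cmult)

lemma H1_pair_diff:
  "H1_pair f g \<Longrightarrow> H1_pair h k \<Longrightarrow> H1_pair (\<lambda>x. f x - h x) (\<lambda>x. g x - k x)"
  using H1_pair_add[OF _ H1_pair_cmult[of h k "-1"]] by simp

lemma H1_pair_cong:
  assumes "H1_pair f g" "AE x in torus. f x = f' x" "AE x in torus. g x = g' x"
    "f' \<in> borel_measurable torus" "g' \<in> borel_measurable torus"
  shows "H1_pair f' g'"
proof -
  note f = H1_pairD[OF assms(1)]
  have "sq_int f'" "sq_int g'" using assms f by (auto intro: sq_int_cong)
  moreover have "fc f' n = fc f n" "fc g' n = fc g n" for n
    using assms f fc_cong[of f f'] fc_cong[of g g'] by (auto simp: sq_int_def)
  ultimately show ?thesis using f by (simp add: H1_pair_def)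
qed

lemma H1_pair_unique: "H1_pair f g \<Longrightarrow> H1_pair f h \<Longrightarrow> AE x in torus. g x = h x"
  by (rule fc_eq_imp_AE_eq) (auto simp: H1_pair_def)

lemma H1_pair_classical:
  assumes d: "\<And>x. x \<in> {0..1} \<Longrightarrow> (f has_vector_derivative f' x) (at x within {0..1})"
    and c: "continuous_on {0..1} f'" and p: "f 0 = f 1"
  shows "H1_pair f f'"
proof -
  have cf: "continuous_on {0..1} f"
    using has_vector_derivative_continuous[OF d] by (auto simp: continuous_on_eq_continuous_within)
  have "fc f' n = freq n * fc f n" for n
  proof -
    let ?c = "freq n"
    have "((\<lambda>x. emode (- n) x * f' x + (freq (- n)) * emode (- n) x * f x)
        has_integral (emode (- n) 1 * f 1 - emode (- n) 0 * f 0)) {0..1}"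
      by (rule fundamental_theorem_of_calculus, simp,
          rule has_vector_derivative_mult[OF emode_has_vector_derivative d])
    moreover have "emode (- n) 1 * f 1 - emode (- n) 0 * f 0 = 0"
      using emode_periodic[of "- n" 0] p by simp
    ultimately have "integral {0..1} (\<lambda>x. emode (- n) x * f' x - ?c * (emode (- n) x * f x)) = 0"
      by (simp add: integral_unique mult.assoc)
    then have "(LINT x|torus. emode (- n) x * f' x - ?c * (emode (- n) x * f x)) = 0"
      by (subst LINT_torus_eq_integral) (intro continuous_integrable_torus continuous_intros c cf, simp)
    moreover have "integrable torus (\<lambda>x. emode (- n) x * f' x)" "integrable torus (\<lambda>x. emode (- n) x * f x)"
      by (intro continuous_integrable_torus continuous_intros c cf)+
    ultimately show ?thesis by (simp add: fc_def)
  qed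
  then show ?thesis using c cf by (simp add: H1_pair_def sq_int_continuous)
qed

lemma smooth_trig: "smooth (trig F c)"
  unfolding smooth_def
proof (intro exI[of _ "\<lambda>k. trig F (\<lambda>n. (freq n) ^ k * c n)"] conjI allI)
  show "trig F (\<lambda>n. (freq n) ^ 0 * c n) = trig F c" by simp
  show "(trig F (\<lambda>n. (freq n) ^ k * c n) has_vector_derivative
      trig F (\<lambda>n. (freq n) ^ Suc k * c n) x) (at x)" for k x
    unfolding trig_def[abs_def]
    by (rule has_vector_derivative_sum)
       (auto intro!: derivative_eq_intros has_vector_derivative_eq_rhs[OF has_vector_derivative_mult_right[OF emode_has_vector_derivative]])
qed

lemma periodic_trig: "periodic1 (trig F c)"
  by (auto simp: periodic1_def trig_def emode_periodic)

lemma smooth_H1_pair: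
  assumes "smooth \<phi>" "periodic1 \<phi>"
  shows "H1_pair \<phi> (\<lambda>x. vector_derivative \<phi> (at x))"
proof -
  obtain D where D: "D 0 = \<phi>" "\<And>n x. (D n has_vector_derivative D (Suc n) x) (at x)"
    using assms(1) by (auto simp: smooth_def)
  have eq: "(\<lambda>x. vector_derivative \<phi> (at x)) = D 1"
    using D(2)[of 0] by (auto simp: D(1) vector_derivative_at)
  show ?thesis
    unfolding eq
  proof (rule H1_pair_classical)
    show "(\<phi> has_vector_derivative D 1 x) (at x within {0..1})" for x
      using D(2)[of 0 x] by (simp add: D(1) has_vector_derivative_at_within)
    show "continuous_on {0..1} (D 1)"
      using has_vector_derivative_continuous[OF D(2)[of 1]]
      by (auto simp: continuous_on_eq_continuous_within intro: continuous_at_imp_continuous_within)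
    show "\<phi> 0 = \<phi> 1" using assms(2)[unfolded periodic1_def, rule_format, of 0] by simp
  qed
qed

text \<open>Fourier modes are admissible test functions, which gives the relation between coefficients. Conversely every test function is itself the first component of an \<open>H1_pair\<close>, so \<open>H1_pair_parts\<close> applies.\<close>

theorem weak_deriv_of_iff:
  assumes "L2_torus f"
  shows "weak_deriv_of f g \<longleftrightarrow> periodic1 g \<and> H1_pair f g"
proof
  assume w: "weak_deriv_of f g"
  then have g: "periodic1 g" "sq_int g" by (auto simp: weak_deriv_of_def L2_torus_iff)
  have "fc g n = freq n * fc f n" for n
  proof -
    have "smooth (emode (- n))" "periodic1 (emode (- n))"
      using smooth_trig[of "{- n}" "\<lambda>_. 1"] periodic_trig[of "{- n}" "\<lambda>_. 1"] by (simp_all add: trig_def[abs_def])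
    then have "(LINT x|torus. f x * vector_derivative (emode (- n)) (at x)) = - (LINT x|torus. g x * emode (- n) x)"
      using w by (simp add: weak_deriv_of_def)
    moreover have "vector_derivative (emode (- n)) (at x) = (freq (- n)) * emode (- n) x" for x
      by (rule vector_derivative_at) (rule emode_has_vector_derivative)
    moreover have "(LINT x|torus. f x * ((freq (- n)) * emode (- n) x))
        = (freq (- n)) * (LINT x|torus. emode (- n) x * f x)"
      by (subst integral_mult_right_zero[symmetric], rule Bochner_Integration.integral_cong) auto
    ultimately show ?thesis by (simp add: fc_def mult.commute)
  qed
  then show "periodic1 g \<and> H1_pair f g"
    using g assms by (auto simp: H1_pair_def L2_torus_iff)
next
  assume g: "periodic1 g \<and> H1_pair f g"
  then show "weak_deriv_of f g"
    unfolding weak_deriv_of_def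
    using H1_pair_parts[OF _ smooth_H1_pair] by (auto simp: L2_torus_iff H1_pair_def[of f g])
qed

lemma H1_torus_iff: "H1_torus f \<longleftrightarrow> periodic1 f \<and> (\<exists>g. periodic1 g \<and> H1_pair f g)"
  using weak_deriv_of_iff[of f] by (auto simp: H1_torus_def L2_torus_iff H1_pair_def)

lemma H1_torusI: "periodic1 f \<Longrightarrow> periodic1 g \<Longrightarrow> H1_pair f g \<Longrightarrow> H1_torus f"
  by (auto simp: H1_torus_iff)

lemma weak_deriv_H1_pair:
  assumes "H1_torus f" shows "H1_pair f (weak_deriv f)" "periodic1 (weak_deriv f)"
proof -
  have "weak_deriv_of f (weak_deriv f)"
    using assms unfolding H1_torus_def weak_deriv_def by (metis someI)
  then show "H1_pair f (weak_deriv f)" "periodic1 (weak_deriv f)"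
    using assms weak_deriv_of_iff[of f] by (auto simp: H1_torus_def)
qed

lemma weak_deriv_AE:
  assumes "periodic1 f" "periodic1 g" "H1_pair f g"
  shows "AE x in torus. weak_deriv f x = g x"
  using weak_deriv_H1_pair(1)[OF H1_torusI[OF assms]] assms(3) by (rule H1_pair_unique)

lemma H1_norm_eq:
  assumes "periodic1 f" "periodic1 g" "H1_pair f g"
  shows "H1_norm f = sqrt (sqn f + sqn g)"
proof -
  have "sqn (weak_deriv f) = sqn g"
    using weak_deriv_AE[OF assms] weak_deriv_H1_pair(1)[OF H1_torusI[OF assms]] assms(3)
    by (intro sqn_cong) (auto simp: H1_pair_def sq_int_def)
  then show ?thesis by (simp add: H1_norm_def sqn_def)
qed

lemma periodic1_diff: "periodic1 f \<Longrightarrow> periodic1 g \<Longrightarrow> periodic1 (\<lambda>x. f x - g x :: 'a :: minus)"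
  by (simp add: periodic1_def)

text \<open>Continuity in \<open>H\<^sup>1\<close> may be checked with any family of weak derivatives, for instance classical ones; \<open>C0_H1D\<close> goes back to the chosen representatives.\<close>

lemma C0_H1I:
  assumes p: "\<And>t. t \<in> {0..T} \<Longrightarrow> periodic1 (u t)" "\<And>t. t \<in> {0..T} \<Longrightarrow> periodic1 (w t)"
    and uw: "\<And>t. t \<in> {0..T} \<Longrightarrow> H1_pair (u t) (w t)"
    and lim: "\<And>t. t \<in> {0..T} \<Longrightarrow> ((\<lambda>s. sqn (\<lambda>x. u s x - u t x)) \<longlongrightarrow> 0) (at t within {0..T})"
      "\<And>t. t \<in> {0..T} \<Longrightarrow> ((\<lambda>s. sqn (\<lambda>x. w s x - w t x)) \<longlongrightarrow> 0) (at t within {0..T})"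
  shows "C0_H1 T u"
  unfolding C0_H1_def
proof (intro conjI ballI)
  show "H1_torus (u t)" if "t \<in> {0..T}" for t using p[OF that] uw[OF that] by (rule H1_torusI)
  fix t assume t: "t \<in> {0..T}"
  have "((\<lambda>s. sqrt (sqn (\<lambda>x. u s x - u t x) + sqn (\<lambda>x. w s x - w t x))) \<longlongrightarrow> sqrt (0 + 0)) (at t within {0..T})"
    by (intro tendsto_intros lim t)
  moreover have "\<forall>\<^sub>F s in at t within {0..T}.
      sqrt (sqn (\<lambda>x. u s x - u t x) + sqn (\<lambda>x. w s x - w t x)) = H1_norm (\<lambda>x. u s x - u t x)"
    unfolding eventually_at_topological using t
    by (intro exI[of _ UNIV]) (auto intro!: H1_norm_eq[symmetric] periodic1_diff H1_pair_diff p uw)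
  ultimately show "((\<lambda>s. H1_norm (\<lambda>x. u s x - u t x)) \<longlongrightarrow> 0) (at t within {0..T})"
    using Lim_transform_eventually[of _ "sqrt (0 + 0)"] by simp
qed

lemma C0_H1D:
  assumes u: "C0_H1 T u" and t: "t \<in> {0..T}"
  shows "H1_pair (u t) (weak_deriv (u t))" "periodic1 (u t)"
    "((\<lambda>s. sqn (\<lambda>x. u s x - u t x)) \<longlongrightarrow> 0) (at t within {0..T})"
    "((\<lambda>s. sqn (\<lambda>x. weak_deriv (u s) x - weak_deriv (u t) x)) \<longlongrightarrow> 0) (at t within {0..T})"
proof -
  have H: "H1_torus (u s)" if "s \<in> {0..T}" for s using u that by (auto simp: C0_H1_def)
  show "H1_pair (u t) (weak_deriv (u t))" "periodic1 (u t)"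
    using weak_deriv_H1_pair[OF H[OF t]] H[OF t] by (auto simp: H1_torus_iff)
  have "((\<lambda>s. (H1_norm (\<lambda>x. u s x - u t x))\<^sup>2) \<longlongrightarrow> 0\<^sup>2) (at t within {0..T})"
    using u t unfolding C0_H1_def by (intro tendsto_power) auto
  then have lim: "((\<lambda>s. (H1_norm (\<lambda>x. u s x - u t x))\<^sup>2) \<longlongrightarrow> 0) (at t within {0..T})" by simp
  have eq: "(H1_norm (\<lambda>x. u s x - u t x))\<^sup>2 = sqn (\<lambda>x. u s x - u t x) + sqn (\<lambda>x. weak_deriv (u s) x - weak_deriv (u t) x)"
    if "s \<in> {0..T}" for s
    using weak_deriv_H1_pair[OF H[OF t]] H[OF t] weak_deriv_H1_pair[OF H[OF that]] H[OF that]
    by (subst H1_norm_eq[OF periodic1_diff periodic1_diff H1_pair_diff]) (auto simp: H1_torus_iff)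
  have ev: "\<forall>\<^sub>F s in at t within {0..T}. norm (sqn (\<lambda>x. u s x - u t x)) \<le> (H1_norm (\<lambda>x. u s x - u t x))\<^sup>2"
    "\<forall>\<^sub>F s in at t within {0..T}. norm (sqn (\<lambda>x. weak_deriv (u s) x - weak_deriv (u t) x)) \<le> (H1_norm (\<lambda>x. u s x - u t x))\<^sup>2"
    unfolding eventually_at_topological by (intro exI[of _ UNIV]; simp add: eq)+
  show "((\<lambda>s. sqn (\<lambda>x. u s x - u t x)) \<longlongrightarrow> 0) (at t within {0..T})"
    "((\<lambda>s. sqn (\<lambda>x. weak_deriv (u s) x - weak_deriv (u t) x)) \<longlongrightarrow> 0) (at t within {0..T})"
    using Lim_null_comparison[OF ev(1) lim] Lim_null_comparison[OF ev(2) lim] .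
qed

section \<open>Absolutely convergent Fourier series\<close>

lemma Fourier_series_uniform:
  assumes "(\<lambda>n. cmod (c n)) summable_on UNIV"
  shows "uniform_limit UNIV (\<lambda>F. trig F c) (\<lambda>x. \<Sum>\<^sub>\<infinity>n. c n * emode n x) (finite_subsets_at_top UNIV)"
  unfolding trig_def[abs_def]
  by (rule Weierstrass_m_test_general[OF _ assms]) (simp add: norm_mult)

lemma continuous_Fourier_series:
  assumes "(\<lambda>n. cmod (c n)) summable_on UNIV"
  shows "continuous_on S (\<lambda>x. \<Sum>\<^sub>\<infinity>n. c n * emode n x)"
  by (rule continuous_on_subset[OF uniform_limit_theorem[OF _ Fourier_series_uniform[OF assms]]])
     (auto intro!: always_eventually continuous_intros)

text \<open>The partial sums converge uniformly, and coefficients are continuous in the supremum norm.\<close>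

lemma fc_Fourier_series:
  assumes c: "(\<lambda>n. cmod (c n)) summable_on UNIV"
  shows "fc (\<lambda>x. \<Sum>\<^sub>\<infinity>n. c n * emode n x) n = c n"
proof -
  let ?f = "\<lambda>x. \<Sum>\<^sub>\<infinity>n. c n * emode n x"
  have sf: "sq_int ?f" by (intro sq_int_continuous continuous_Fourier_series c)
  have "((\<lambda>F. fc (trig F c) n) \<longlongrightarrow> fc ?f n) (finite_subsets_at_top UNIV)"
  proof (rule tendstoI)
    fix e :: real assume e: "e > 0"
    have "\<forall>\<^sub>F F in finite_subsets_at_top UNIV. \<forall>x\<in>UNIV. dist (trig F c x) (?f x) < e / 2"
      using Fourier_series_uniform[OF c] e by (intro uniform_limitD) auto
    then show "\<forall>\<^sub>F F in finite_subsets_at_top UNIV. dist (fc (trig F c) n) (fc ?f n) < e"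
    proof eventually_elim
      fix F assume F: "\<forall>x\<in>UNIV. dist (trig F c x) (?f x) < e / 2"
      have s: "sq_int (\<lambda>x. trig F c x - ?f x)" by (intro sq_int_diff sq_int_trig sf)
      have "sqn (\<lambda>x. trig F c x - ?f x) \<le> (e / 2)\<^sup>2"
        by (rule sqn_bounded[OF s]) (use F in \<open>auto simp: dist_norm less_imp_le\<close>)
      then have "sqrt (sqn (\<lambda>x. trig F c x - ?f x)) \<le> e / 2"
        using e by (metis real_sqrt_le_mono real_sqrt_abs abs_of_pos half_gt_zero)
      then show "dist (fc (trig F c) n) (fc ?f n) < e"
        using norm_fc_le[OF s, of n] e by (simp add: dist_norm fc_diff[OF sq_int_trig sf])
    qed
  qed
  moreover have "((\<lambda>F. fc (trig F c) n) \<longlongrightarrow> c n) (finite_subsets_at_top UNIV)"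
  proof (rule tendsto_eventually)
    show "\<forall>\<^sub>F F in finite_subsets_at_top UNIV. fc (trig F c) n = c n"
      unfolding eventually_finite_subsets_at_top
      by (intro exI[of _ "{n}"]) (auto simp: fc_trig)
  qed
  ultimately show ?thesis using tendsto_unique[OF finite_subsets_at_top_neq_bot] by blast
qed

lemma periodic1_int: "periodic1 f \<Longrightarrow> f (x + of_int k) = f x"
proof (induction k arbitrary: x rule: int_induct[where k=0])
  case (step1 i)
  have "f (x + of_int i + 1) = f (x + of_int i)" using step1.prems by (simp add: periodic1_def)
  then show ?case using step1 by (simp add: add.assoc)
next
  case (step2 i)
  have "f (x + of_int (i - 1) + 1) = f (x + of_int (i - 1))"
    using step2.prems by (simp add: periodic1_def del: of_int_diff)
  then show ?case using step2 by (simp add: algebra_simps)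
qed simp

lemma summable_on_int_inverse_squares: "(\<lambda>n::int. 1 / (of_int n)\<^sup>2 :: real) summable_on UNIV"
proof -
  let ?f = "\<lambda>n::int. 1 / (of_int n)\<^sup>2 :: real"
  have s: "(\<lambda>k::nat. 1 / (real (Suc k))\<^sup>2) summable_on UNIV"
    using inverse_power_summable[of 2, where 'a=real] summable_Suc_iff[of "\<lambda>n. inverse (real n ^ 2)"]
    by (intro summable_nonneg_imp_summable_on) (auto simp: field_simps)
  have "?f summable_on range (\<lambda>k. int (Suc k))"
    by (subst summable_on_reindex) (use s in \<open>auto simp: inj_on_def o_def\<close>)
  moreover have "?f summable_on range (\<lambda>k. - int (Suc k))"
    by (subst summable_on_reindex) (use s in \<open>auto simp: inj_on_def o_def power2_eq_square algebra_simps\<close>)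
  moreover have "?f summable_on {0}" by simp
  ultimately have "?f summable_on (range (\<lambda>k. int (Suc k)) \<union> range (\<lambda>k. - int (Suc k)) \<union> {0})"
    by (intro summable_on_union)
  moreover have "range (\<lambda>k. int (Suc k)) \<union> range (\<lambda>k. - int (Suc k)) \<union> {0} = UNIV"
  proof (intro equalityI subsetI UNIV_I)
    fix n :: int
    consider "n > 0" | "n < 0" | "n = 0" by linarith
    then show "n \<in> range (\<lambda>k. int (Suc k)) \<union> range (\<lambda>k. - int (Suc k)) \<union> {0}"
    proof cases
      case 1 then have "n = int (Suc (nat (n - 1)))" by simp
      then show ?thesis by blast
    next
      case 2 then have "n = - int (Suc (nat (- n - 1)))" by simp
      then show ?thesis by blast
    qed auto
  qed
  ultimately show ?thesis by simp
qed

text \<open>The constant of the embedding of \<open>H\<^sup>1\<close> into bounded functions (\<open>H1_AE_bound\<close>).\<close>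

definition sobolev :: real where
  "sobolev = sqrt (\<Sum>\<^sub>\<infinity>n::int. 1 / (of_int n)\<^sup>2)"

lemma sobolev_nonneg: "sobolev \<ge> 0"
  by (auto simp: sobolev_def intro!: infsum_nonneg)

text \<open>For \<open>n \<noteq> 0\<close> one has \<open>|f\<^sub>n| = |g\<^sub>n| / (2 \<pi> |n|)\<close>, and the Cauchy--Schwarz inequality
  applies; \<open>1 / 0 = 0\<close> removes the mean from the sum.\<close>

lemma H1_fc_summable:
  assumes "H1_pair f g"
  shows "(\<lambda>n. cmod (fc f n)) summable_on UNIV"
    "(\<Sum>\<^sub>\<infinity>n. cmod (fc f n)) \<le> cmod (fc f 0) + sobolev * sqrt (sqn g)"
proof -
  note f = H1_pairD[OF assms]
  have fin: "(\<Sum>n\<in>F. cmod (fc f n)) \<le> cmod (fc f 0) + sobolev * sqrt (sqn g)" if F: "finite F" for F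
  proof -
    have "(\<Sum>n\<in>F - {0}. cmod (fc f n)) \<le> (\<Sum>n\<in>F - {0}. (1 / \<bar>of_int n\<bar>) * cmod (fc g n))"
    proof (rule sum_mono)
      fix n assume n: "n \<in> F - {0}"
      have "(1 / \<bar>of_int n\<bar>) * cmod (fc g n) = 2 * pi * cmod (fc f n)"
        using n by (simp add: f(3) norm_mult)
      moreover have "1 * cmod (fc f n) \<le> 2 * pi * cmod (fc f n)"
        using pi_gt3 by (intro mult_right_mono) auto
      ultimately show "cmod (fc f n) \<le> (1 / \<bar>of_int n\<bar>) * cmod (fc g n)" by simp
    qed
    also have "\<dots> \<le> L2_set (\<lambda>n. 1 / \<bar>of_int n\<bar>) (F - {0}) * L2_set (\<lambda>n. cmod (fc g n)) (F - {0})"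
      using L2_set_mult_ineq[of "\<lambda>n. 1 / \<bar>of_int n\<bar>" "\<lambda>n. cmod (fc g n)" "F - {0}"] by simp
    also have "\<dots> \<le> sobolev * sqrt (sqn g)"
    proof (rule mult_mono)
      have "(\<Sum>n\<in>F - {0}. 1 / (of_int n)\<^sup>2) \<le> (\<Sum>\<^sub>\<infinity>n::int. 1 / (of_int n)\<^sup>2 :: real)"
        using F by (intro finite_sum_le_infsum summable_on_int_inverse_squares) auto
      then show "L2_set (\<lambda>n. 1 / \<bar>of_int n\<bar>) (F - {0}) \<le> sobolev"
        by (simp add: L2_set_def sobolev_def power_divide)
      show "L2_set (\<lambda>n. cmod (fc g n)) (F - {0}) \<le> sqrt (sqn g)"
        using Bessel[OF f(2), of "F - {0}"] F by (simp add: L2_set_def)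
    qed (auto simp: sobolev_nonneg)
    finally have "(\<Sum>n\<in>F - {0}. cmod (fc f n)) \<le> sobolev * sqrt (sqn g)" .
    moreover have "(\<Sum>n\<in>F. cmod (fc f n)) \<le> cmod (fc f 0) + (\<Sum>n\<in>F - {0}. cmod (fc f n))"
      using F by (cases "0 \<in> F") (auto simp: sum.remove)
    ultimately show ?thesis by linarith
  qed
  show s: "(\<lambda>n. cmod (fc f n)) summable_on UNIV"
    by (rule nonneg_bdd_above_summable_on) (auto intro!: bdd_aboveI fin)
  show "(\<Sum>\<^sub>\<infinity>n. cmod (fc f n)) \<le> cmod (fc f 0) + sobolev * sqrt (sqn g)"
    by (rule infsum_le_finite_sums[OF s]) (use fin in auto)
qed

lemma Fourier_series_bound:
  assumes "(\<lambda>n. cmod (c n)) summable_on UNIV"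
  shows "cmod (\<Sum>\<^sub>\<infinity>n. c n * emode n x) \<le> (\<Sum>\<^sub>\<infinity>n. cmod (c n))"
proof -
  have "(\<lambda>n. norm (c n * emode n x)) summable_on UNIV" using assms by (simp add: norm_mult)
  from norm_infsum_bound[OF this] show ?thesis by (simp add: norm_mult)
qed

lemma H1_AE_Fourier_series:
  assumes "H1_pair f g"
  shows "AE x in torus. f x = (\<Sum>\<^sub>\<infinity>n. fc f n * emode n x)"
proof (rule fc_eq_imp_AE_eq)
  note s = H1_fc_summable(1)[OF assms]
  show "sq_int f" using assms by (simp add: H1_pair_def)
  show "sq_int (\<lambda>x. \<Sum>\<^sub>\<infinity>n. fc f n * emode n x)"
    by (intro sq_int_continuous continuous_Fourier_series s)
  show "fc f n = fc (\<lambda>x. \<Sum>\<^sub>\<infinity>n. fc f n * emode n x) n" for n by (simp add: fc_Fourier_series[OF s])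
qed

lemma H1_AE_bound:
  assumes "H1_pair f g"
  shows "AE x in torus. cmod (f x) \<le> sqrt (sqn f) + sobolev * sqrt (sqn g)"
  using H1_AE_Fourier_series[OF assms]
proof eventually_elim
  fix x assume "f x = (\<Sum>\<^sub>\<infinity>n. fc f n * emode n x)"
  then have "cmod (f x) \<le> (\<Sum>\<^sub>\<infinity>n. cmod (fc f n))"
    using Fourier_series_bound[OF H1_fc_summable(1)[OF assms]] by simp
  then show "cmod (f x) \<le> sqrt (sqn f) + sobolev * sqrt (sqn g)"
    using H1_fc_summable(2)[OF assms] norm_fc_le[of f 0] assms by (auto simp: H1_pair_def)
qed

section \<open>Smooth cutoff functions in time\<close>

text \<open>The derivatives of \<open>exp (- 1 / (x (1 - x)))\<close> on \<open>(0,1)\<close>, extended by zero, all have this form.\<close>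

definition bumpf :: "real poly \<Rightarrow> nat \<Rightarrow> real \<Rightarrow> real" where
  "bumpf p k x = (if 0 < x \<and> x < 1 then poly p x / (x * (1 - x)) ^ k * exp (- 1 / (x * (1 - x))) else 0)"

text \<open>Compare with a single term of the exponential series at \<open>1 / q\<close>.\<close>

lemma exp_neg_inverse_le:
  assumes "0 < (q::real)" shows "exp (- 1 / q) \<le> fact n * q ^ n"
proof -
  have "(1 / q) ^ n / fact n \<le> exp (1 / q)"
  proof -
    have "(\<lambda>k. (1 / q) ^ k /\<^sub>R fact k) sums exp (1 / q)" by (rule exp_converges)
    then have "(1 / q) ^ n /\<^sub>R fact n \<le> exp (1 / q)"
      using sum_le_suminf[of "\<lambda>k. (1 / q) ^ k /\<^sub>R fact k" "{n}"] assms by (simp add: sums_iff)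
    then show ?thesis by (simp add: divide_inverse mult.commute)
  qed
  then show ?thesis using assms by (simp add: exp_minus field_simps power_divide)
qed

text \<open>Quadratic decay at both ends is what makes the extension by zero differentiable there.\<close>

lemma bumpf_bound:
  obtains C where "C \<ge> 0" "\<And>x. \<bar>bumpf p k x\<bar> \<le> C * x\<^sup>2" "\<And>x. \<bar>bumpf p k x\<bar> \<le> C * (x - 1)\<^sup>2"
proof -
  have "bounded (poly p ` {0..1})"
    by (intro compact_imp_bounded compact_continuous_image continuous_intros compact_Icc)
  then obtain P where P: "P > 0" "\<And>x. x \<in> {0..1} \<Longrightarrow> \<bar>poly p x\<bar> \<le> P"
    unfolding bounded_pos by auto
  define C where "C = P * fact (k + 2)"
  have b: "\<bar>bumpf p k x\<bar> \<le> C * (x * (1 - x))\<^sup>2" if x: "0 < x" "x < 1" for x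
  proof -
    define q where "q = x * (1 - x)"
    have q: "q > 0" using x by (simp add: q_def)
    have "\<bar>bumpf p k x\<bar> = \<bar>poly p x\<bar> * (exp (- 1 / q) / q ^ k)"
      using x q by (simp add: bumpf_def q_def[symmetric] abs_mult)
    also have "\<dots> \<le> P * (fact (k + 2) * q ^ (k + 2) / q ^ k)"
      using P(2)[of x] x q exp_neg_inverse_le[OF q, of "k + 2"] P(1)
      by (intro mult_mono divide_right_mono) auto
    also have "\<dots> = C * q\<^sup>2" using q by (simp add: C_def power_add field_simps power2_eq_square)
    finally show ?thesis by (simp add: q_def)
  qed
  have "C \<ge> 0" using P by (simp add: C_def)
  show ?thesis
  proof
    show "C \<ge> 0" by fact
    fix x :: real
    show "\<bar>bumpf p k x\<bar> \<le> C * x\<^sup>2"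
    proof (cases "0 < x \<and> x < 1")
      case True
      then have "x * (1 - x) \<le> x * 1" by (intro mult_left_mono) auto
      then have "(x * (1 - x))\<^sup>2 \<le> x\<^sup>2" using True by (intro power_mono) auto
      then have "C * (x * (1 - x))\<^sup>2 \<le> C * x\<^sup>2" using \<open>C \<ge> 0\<close> by (intro mult_left_mono) auto
      then show ?thesis using b True by fastforce
    qed (use \<open>C \<ge> 0\<close> in \<open>auto simp: bumpf_def\<close>)
    show "\<bar>bumpf p k x\<bar> \<le> C * (x - 1)\<^sup>2"
    proof (cases "0 < x \<and> x < 1")
      case True
      then have "x * (1 - x) \<le> 1 * (1 - x)" by (intro mult_right_mono) auto
      then have "(x * (1 - x))\<^sup>2 \<le> (1 - x)\<^sup>2" using True by (intro power_mono) auto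
      then have "C * (x * (1 - x))\<^sup>2 \<le> C * (x - 1)\<^sup>2"
        using \<open>C \<ge> 0\<close> by (intro mult_left_mono) (auto simp: power2_commute)
      then show ?thesis using b True by fastforce
    qed (use \<open>C \<ge> 0\<close> in \<open>auto simp: bumpf_def\<close>)
  qed
qed

lemma has_derivative_zero_quadratic:
  fixes f :: "real \<Rightarrow> real"
  assumes "f x = 0" "\<And>y. \<bar>f y\<bar> \<le> C * (y - x)\<^sup>2"
  shows "(f has_real_derivative 0) (at x)"
  unfolding has_field_derivative_iff
proof (rule Lim_null_comparison)
  show "\<forall>\<^sub>F y in at x. norm ((f y - f x) / (y - x)) \<le> C * \<bar>y - x\<bar>"
  proof (rule eventually_at_filter[THEN iffD2], intro always_eventually allI impI)
    fix y assume "y \<noteq> x"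
    then have "\<bar>f y\<bar> / \<bar>y - x\<bar> \<le> C * (y - x)\<^sup>2 / \<bar>y - x\<bar>"
      using assms(2)[of y] by (intro divide_right_mono) auto
    also have "\<dots> = C * \<bar>y - x\<bar>"
    proof -
      have "(y - x)\<^sup>2 = \<bar>y - x\<bar> * \<bar>y - x\<bar>" by (simp add: power2_eq_square)
      then show ?thesis using \<open>y \<noteq> x\<close> by (simp only: times_divide_eq_right[symmetric]) simp
    qed
    finally show "norm ((f y - f x) / (y - x)) \<le> C * \<bar>y - x\<bar>" using assms(1) by simp
  qed
  show "((\<lambda>y. C * \<bar>y - x\<bar>) \<longlongrightarrow> 0) (at x)" by (auto intro!: tendsto_eq_intros)
qed

lemma bumpf_derivative:
  fixes p k
  defines "q \<equiv> [:0, 1, -1:] :: real poly"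
  defines "p' \<equiv> pderiv p * q ^ 2 - smult (real k) (p * pderiv q * q) + p * pderiv q"
  shows "(bumpf p k has_real_derivative bumpf p' (k + 2) x) (at x)"
proof -
  obtain C where C: "\<And>x. \<bar>bumpf p k x\<bar> \<le> C * x\<^sup>2" "\<And>x. \<bar>bumpf p k x\<bar> \<le> C * (x - 1)\<^sup>2"
    using bumpf_bound by metis
  consider "x < 0" | "x > 1" | "x = 0" | "x = 1" | "0 < x" "x < 1" by linarith
  then show ?thesis
  proof cases
    case 1
    then have "(bumpf p k has_real_derivative 0) (at x)"
      by (intro has_field_derivative_transform_within_open[OF DERIV_const[of 0], of "{..<0}"]) (auto simp: bumpf_def)
    then show ?thesis using 1 by (simp add: bumpf_def)
  next
    case 2
    then have "(bumpf p k has_real_derivative 0) (at x)"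
      by (intro has_field_derivative_transform_within_open[OF DERIV_const[of 0], of "{1<..}"]) (auto simp: bumpf_def)
    then show ?thesis using 2 by (simp add: bumpf_def)
  next
    case 3
    then have "(bumpf p k has_real_derivative 0) (at x)"
      using C(1) by (intro has_derivative_zero_quadratic[where C=C]) (simp_all add: bumpf_def[of _ _ 0])
    then show ?thesis using 3 by (simp add: bumpf_def)
  next
    case 4
    then have "(bumpf p k has_real_derivative 0) (at x)"
      using C(2) by (intro has_derivative_zero_quadratic[where C=C]) (simp_all add: bumpf_def[of _ _ 1])
    then show ?thesis using 4 by (simp add: bumpf_def)
  next
    case 5
    have q: "poly q x = x * (1 - x)" for x by (simp add: q_def algebra_simps)
    have qp: "poly q x > 0" unfolding q using 5 by simp
    let ?g = "\<lambda>x. poly p x / poly q x ^ k * exp (- 1 / poly q x)"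
    have "(?g has_real_derivative
        (poly (pderiv p) x * poly q x ^ k - poly p x * (real k * poly q x ^ (k - 1) * poly (pderiv q) x)) / (poly q x ^ k * poly q x ^ k) * exp (- 1 / poly q x)
        + poly p x / poly q x ^ k * (exp (- 1 / poly q x) * (poly (pderiv q) x / (poly q x)\<^sup>2))) (at x)"
      using qp by (auto intro!: derivative_eq_intros poly_DERIV simp: power2_eq_square) (simp add: field_simps)
    also have "(poly (pderiv p) x * poly q x ^ k - poly p x * (real k * poly q x ^ (k - 1) * poly (pderiv q) x)) / (poly q x ^ k * poly q x ^ k) * exp (- 1 / poly q x)
        + poly p x / poly q x ^ k * (exp (- 1 / poly q x) * (poly (pderiv q) x / (poly q x)\<^sup>2)) = bumpf p' (k + 2) x"
    proof -
      have "real k * poly q x ^ (k - 1) = real k * poly q x ^ k / poly q x"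
        using qp by (cases k) auto
      then show ?thesis
        using 5 qp by (simp add: bumpf_def q[symmetric] p'_def power_add) (simp add: field_simps power2_eq_square)
    qed
    finally show ?thesis
      by (rule has_field_derivative_transform_within_open[of _ _ _ "{0<..<1}"]) (use 5 in \<open>auto simp: bumpf_def q\<close>)
  qed
qed

text \<open>Functions of the form \<open>bumpf p k\<close> are closed under differentiation, so iterating the derivative yields the whole sequence of derivatives; the step is the normalised primitive of the simplest one.\<close>

lemma smooth_step_exists:
  obtains S :: "nat \<Rightarrow> real \<Rightarrow> real" where
    "\<And>n x. (S n has_real_derivative S (Suc n) x) (at x)"
    "\<And>x. x \<le> 0 \<Longrightarrow> S 0 x = 0" "\<And>x. x \<ge> 1 \<Longrightarrow> S 0 x = 1"
    "\<And>x. S 1 x \<ge> 0" "\<And>x. x \<notin> {0..1} \<Longrightarrow> S 1 x = 0"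
proof -
  define X where "X = {bumpf p k |p k. True}"
  have "\<forall>f\<in>X. \<exists>g\<in>X. \<forall>x. (f has_real_derivative g x) (at x)"
    unfolding X_def using bumpf_derivative by blast
  then obtain d where d: "\<And>f. f \<in> X \<Longrightarrow> d f \<in> X" "\<And>f x. f \<in> X \<Longrightarrow> (f has_real_derivative d f x) (at x)"
    by metis
  define b where "b = bumpf 1 0"
  define B where "B n = (d ^^ n) b" for n
  have B: "B n \<in> X" for n
    by (induction n) (auto simp: B_def b_def X_def d(1)[unfolded X_def, simplified])
  have DB: "(B n has_real_derivative B (Suc n) x) (at x)" for n x
    using d(2)[OF B[of n]] by (simp add: B_def)
  have b0: "b x \<ge> 0" "x \<notin> {0<..<1} \<Longrightarrow> b x = 0" for x by (auto simp: b_def bumpf_def)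
  have cb: "continuous_on S b" for S
    using DB[of 0] by (auto simp: B_def intro!: DERIV_continuous_on intro: DERIV_subset)
  have ib: "b integrable_on {u..v}" for u v by (intro integrable_continuous_real cb)
  define I where "I = integral {0..1} b"
  have "I > 0"
  proof -
    have "I \<noteq> 0"
    proof
      assume "I = 0"
      then have "(b has_integral 0) (cbox 0 1)" using ib[of 0 1] by (simp add: I_def has_integral_iff)
      then have "b (1/2) = 0"
        using has_integral_0_cbox_imp_0[of 0 1 b "1/2"] cb b0(1) by auto
      then show False by (simp add: b_def bumpf_def)
    qed
    moreover have "I \<ge> 0" unfolding I_def by (intro integral_nonneg ib b0)
    ultimately show ?thesis by simp
  qed
  \<comment> \<open>starting at \<open>- 1\<close> keeps the points \<open>x \<ge> 0\<close> in the interior of the domain of integration\<close>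
  define s where "s x = integral {-1..x} b" for x
  have s0: "s x = 0" if "x \<le> 0" for x
    unfolding s_def using that by (intro integral_eq_0_iff[THEN iffD2] integral_unique has_integral_is_0) (auto intro!: b0)
  have Ds: "(s has_real_derivative b x) (at x)" for x
  proof (cases "x < 0")
    case True
    then have "(s has_real_derivative 0) (at x)"
      by (intro has_field_derivative_transform_within_open[OF DERIV_const[of 0], of "{..<0}"]) (auto simp: s0)
    then show ?thesis using b0(2)[of x] True by simp
  next
    case False
    then have "(s has_real_derivative b x) (at x within {-1..x + 1})"
      unfolding s_def by (intro integral_has_real_derivative cb) auto
    moreover have "at x within {-1..x + 1} = at x"
      using False by (intro at_within_interior) auto
    ultimately show ?thesis by simp
  qed
  have s1: "s x = I" if "x \<ge> 1" for x
  proof -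
    have "s 0 + integral {0..x} b = s x"
      unfolding s_def using that by (intro Henstock_Kurzweil_Integration.integral_combine ib) auto
    moreover have "I + integral {1..x} b = integral {0..x} b"
      unfolding I_def using that by (intro Henstock_Kurzweil_Integration.integral_combine ib) auto
    moreover have "integral {1..x} b = 0"
      by (intro integral_unique has_integral_is_0) (auto intro!: b0)
    ultimately show ?thesis using s0[of 0] by simp
  qed
  define S where "S n x = (case n of 0 \<Rightarrow> s x / I | Suc m \<Rightarrow> B m x / I)" for n x
  show ?thesis
  proof
    show "(S n has_real_derivative S (Suc n) x) (at x)" for n x
    proof (cases n)
      case 0
      then show ?thesis using DERIV_cdivide[OF Ds, of I x] by (simp add: S_def[abs_def] B_def)
    next
      case (Suc m)
      then show ?thesis using DERIV_cdivide[OF DB, of m I x] by (simp add: S_def[abs_def])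
    qed
    show "S 0 x = 0" if "x \<le> 0" for x using s0[OF that] by (simp add: S_def)
    show "S 0 x = 1" if "x \<ge> 1" for x using s1[OF that] \<open>I > 0\<close> by (simp add: S_def)
    show "S 1 x \<ge> 0" for x using b0(1)[of x] \<open>I > 0\<close> by (simp add: S_def B_def)
    show "S 1 x = 0" if "x \<notin> {0..1}" for x using b0(2)[of x] that by (auto simp: S_def B_def)
  qed
qed

text \<open>The sequence \<open>\<eta> 0, \<eta> 1, ...\<close> consists of a cutoff function and all its derivatives; carrying them along
provides the witnesses required by \<open>smooth2\<close>.\<close>

definition time_cutoff :: "real \<Rightarrow> (nat \<Rightarrow> real \<Rightarrow> real) \<Rightarrow> bool" where
  "time_cutoff T \<eta> \<longleftrightarrow> (\<forall>n t. (\<eta> n has_real_derivative \<eta> (Suc n) t) (at t)) \<and>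
     (\<exists>c d. 0 < c \<and> d < T \<and> (\<forall>t. t \<notin> {c..d} \<longrightarrow> \<eta> 0 t = 0))"

lemma time_cutoff_continuous:
  assumes "time_cutoff T \<eta>" shows "continuous_on S (\<eta> n)"
  using assms by (auto simp: time_cutoff_def intro!: DERIV_continuous_on intro: DERIV_subset)

text \<open>The lemma of du Bois-Reymond. The difference of two steepening steps at \<open>a\<close> and \<open>b\<close> is an
  admissible cutoff, and its derivative converges to the difference of the Dirac masses
  at \<open>a\<close> and \<open>b\<close>.\<close>

lemma du_Bois_Reymond_constant:
  fixes h :: "real \<Rightarrow> complex"
  assumes h: "continuous_on {0..T} h"
    and orth: "\<And>\<eta>. time_cutoff T \<eta> \<Longrightarrow> integral {0..T} (\<lambda>t. of_real (\<eta> 1 t) * h t) = 0"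
    and ab: "0 < a" "a < T" "0 < b" "b < T" "a < b"
  shows "h a = h b"
proof -
  obtain S :: "nat \<Rightarrow> real \<Rightarrow> real" where S: "\<And>n x. (S n has_real_derivative S (Suc n) x) (at x)"
    "\<And>x. x \<le> 0 \<Longrightarrow> S 0 x = 0" "\<And>x. x \<ge> 1 \<Longrightarrow> S 0 x = 1"
    "\<And>x. S 1 x \<ge> 0" "\<And>x. x \<notin> {0..1} \<Longrightarrow> S 1 x = 0"
    by (rule smooth_step_exists) (rule that)
  have DS: "((\<lambda>t. S n ((t - c) / r) / r ^ n) has_real_derivative S (Suc n) ((t - c) / r) / r ^ Suc n) (at t)"
    if "r > 0" for n c r t
  proof -
    have "((\<lambda>t. S n ((t - c) / r)) has_real_derivative S (Suc n) ((t - c) / r) * (1 / r)) (at t)"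
      by (rule DERIV_chain2[OF S(1)]) (use that in \<open>auto intro!: derivative_eq_intros\<close>)
    from DERIV_cdivide[OF this, of "r ^ n"] show ?thesis using that by (simp add: field_simps)
  qed
  have cS: "continuous_on A (\<lambda>t. S 1 ((t - c) / r) / r)" if "r > 0" for A c r
    using DS[OF that, of 1 c] that
    by (auto intro!: DERIV_continuous_on intro: DERIV_subset)
  have step: "cmod (integral {0..T} (\<lambda>t. of_real (S 1 ((t - c) / r) / r) * h t) - h c) \<le> e"
    if c: "0 < c" "c + r \<le> T" "r > 0" and e: "\<And>t. t \<in> {c..c + r} \<Longrightarrow> cmod (h t - h c) \<le> e" for c r e
  proof -
    let ?w = "\<lambda>t. S 1 ((t - c) / r) / r"
    have "e \<ge> 0" using e[of c] c by auto
    have "(?w has_integral (S 0 ((T - c) / r) - S 0 ((0 - c) / r))) {0..T}"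
      using DS[OF c(3), of 0 c] c
      by (intro fundamental_theorem_of_calculus)
         (auto simp: has_real_derivative_iff_has_vector_derivative[symmetric] intro: DERIV_subset)
    moreover have "S 0 ((T - c) / r) = 1" "S 0 ((0 - c) / r) = 0"
      using c by (auto intro!: S simp: field_simps)
    ultimately have w: "(?w has_integral 1) {0..T}" by simp
    have i1: "(\<lambda>t. of_real (?w t) * h t) integrable_on {0..T}"
      by (intro integrable_continuous_real continuous_intros cS[OF c(3)] h)
    have i2: "((\<lambda>t. of_real (?w t) * h c) has_integral h c) {0..T}"
      using has_integral_mult_left[OF has_integral_of_real[OF w], of "h c"] by simp
    have "integral {0..T} (\<lambda>t. of_real (?w t) * h t) - h c = integral {0..T} (\<lambda>t. of_real (?w t) * h t - of_real (?w t) * h c)"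
      using i1 i2 by (subst Henstock_Kurzweil_Integration.integral_diff) (auto simp: has_integral_iff)
    also have "cmod \<dots> \<le> integral {0..T} (\<lambda>t. e * ?w t)"
    proof (rule integral_norm_bound_integral)
      show "(\<lambda>t. of_real (?w t) * h t - of_real (?w t) * h c) integrable_on {0..T}"
        using i1 i2 by (intro integrable_diff) auto
      show "(\<lambda>t. e * ?w t) integrable_on {0..T}"
        using has_integral_mult_right[OF w, of e] by auto
      fix t assume "t \<in> {0..T}"
      show "cmod (of_real (?w t) * h t - of_real (?w t) * h c) \<le> e * ?w t"
      proof (cases "t \<in> {c..c + r}")
        case True
        have "cmod (of_real (?w t) * h t - of_real (?w t) * h c) = \<bar>?w t\<bar> * cmod (h t - h c)"
          by (simp only: right_diff_distrib[symmetric] norm_mult norm_of_real)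
        also have "\<dots> \<le> ?w t * e"
          using S(4)[of "(t - c) / r"] c e[OF True] by (intro mult_mono) auto
        finally show ?thesis by (simp add: mult.commute)
      next
        case False
        then have "S 1 ((t - c) / r) = 0" using c by (intro S(5)) (auto simp: field_simps)
        then show ?thesis by simp
      qed
    qed
    also have "integral {0..T} (\<lambda>t. e * ?w t) = e * 1"
      using has_integral_mult_right[OF w, of e] by (rule integral_unique)
    finally show ?thesis by simp
  qed
  have "cmod (h a - h b) \<le> 0"
  proof (rule field_le_epsilon)
    fix e :: real assume "e > 0"
    then have e2: "e / 2 > 0" by simp
    have cont: "\<exists>r>0. \<forall>t\<in>{0..T}. dist t c < r \<longrightarrow> dist (h t) (h c) < e / 2" if "c \<in> {0..T}" for c
      using h that e2 unfolding continuous_on_iff by blast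
    obtain r1 where r1: "r1 > 0" "\<And>t. t \<in> {0..T} \<Longrightarrow> dist t a < r1 \<Longrightarrow> dist (h t) (h a) < e / 2"
      using cont[of a] ab by auto
    obtain r2 where r2: "r2 > 0" "\<And>t. t \<in> {0..T} \<Longrightarrow> dist t b < r2 \<Longrightarrow> dist (h t) (h b) < e / 2"
      using cont[of b] ab by auto
    \<comment> \<open>the two transition layers must lie in the neighbourhoods of \<open>a\<close> and \<open>b\<close>, and the cutoff must vanish before \<open>T\<close>\<close>
    define r where "r = Min {r1, r2, T - b} / 2"
    have r: "r > 0" "r < r1" "r < r2" "r < T - b" using r1 r2 ab by (auto simp: r_def)
    define \<eta> where "\<eta> n t = S n ((t - a) / r) / r ^ n - S n ((t - b) / r) / r ^ n" for n t
    have "time_cutoff T \<eta>"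
      unfolding time_cutoff_def
    proof (intro conjI allI)
      show "(\<eta> n has_real_derivative \<eta> (Suc n) t) (at t)" for n t
        unfolding \<eta>_def[abs_def] by (intro DERIV_diff DS r)
      have "\<eta> 0 t = 0" if "t \<notin> {a..b + r}" for t
      proof (cases "t < a")
        case True
        then have "S 0 ((t - a) / r) = 0" "S 0 ((t - b) / r) = 0"
          using ab r by (auto intro!: S simp: field_simps)
        then show ?thesis by (simp add: \<eta>_def)
      next
        case False
        then have "S 0 ((t - a) / r) = 1" "S 0 ((t - b) / r) = 1"
          using ab r that by (auto intro!: S simp: field_simps)
        then show ?thesis by (simp add: \<eta>_def)
      qed
      then show "\<exists>c d. 0 < c \<and> d < T \<and> (\<forall>t. t \<notin> {c..d} \<longrightarrow> \<eta> 0 t = 0)"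
        using ab r by - (rule exI[of _ a], rule exI[of _ "b + r"], auto)
    qed
    then have "0 = integral {0..T} (\<lambda>t. of_real (\<eta> 1 t) * h t)" using orth by simp
    also have "\<dots> = integral {0..T} (\<lambda>t. of_real (S 1 ((t - a) / r) / r) * h t - of_real (S 1 ((t - b) / r) / r) * h t)"
      by (intro integral_cong) (simp add: \<eta>_def algebra_simps)
    also have "\<dots> = integral {0..T} (\<lambda>t. of_real (S 1 ((t - a) / r) / r) * h t)
        - integral {0..T} (\<lambda>t. of_real (S 1 ((t - b) / r) / r) * h t)" (is "_ = ?A - ?B")
      by (intro Henstock_Kurzweil_Integration.integral_diff integrable_continuous_real continuous_intros cS[OF r(1)] h)
    finally have AB: "?A = ?B" by simp
    have A: "cmod (?A - h a) \<le> e / 2"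
    proof (rule step)
      show "cmod (h t - h a) \<le> e / 2" if "t \<in> {a..a + r}" for t
        using r1(2)[of t] that ab r by (simp add: dist_norm)
    qed (use ab r in auto)
    have B: "cmod (?B - h b) \<le> e / 2"
    proof (rule step)
      show "cmod (h t - h b) \<le> e / 2" if "t \<in> {b..b + r}" for t
        using r2(2)[of t] that ab r by (simp add: dist_norm)
    qed (use ab r in auto)
    have "cmod (h a - h b) \<le> cmod (?A - h a) + cmod (?B - h b)"
      using dist_triangle3[of "h a" "h b" ?A] by (simp only: dist_norm AB)
    then show "cmod (h a - h b) \<le> 0 + e" using A B by simp
  qed
  then show ?thesis by simp
qed

text \<open>Subtracting the primitive of \<open>g\<close> moves all the derivatives onto the cutoff, which leaves the case of a constant.\<close>

lemma du_Bois_Reymond: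
  fixes f g :: "real \<Rightarrow> complex"
  assumes f: "continuous_on {0..T} f" and g: "continuous_on {0..T} g"
    and orth: "\<And>\<eta>. time_cutoff T \<eta> \<Longrightarrow> integral {0..T} (\<lambda>t. of_real (\<eta> 1 t) * f t + of_real (\<eta> 0 t) * g t) = 0"
    and t: "t \<in> {0..T}"
  shows "f t = f 0 + integral {0..t} g"
proof (cases "T > 0")
  case True
  define h where "h t = f t - integral {0..t} g" for t
  have DG: "((\<lambda>t. integral {0..t} g) has_vector_derivative g t) (at t within {0..T})" if "t \<in> {0..T}" for t
    by (rule integral_has_vector_derivative[OF g that])
  have cG: "continuous_on {0..T} (\<lambda>t. integral {0..t} g)"
    using has_vector_derivative_continuous[OF DG] by (auto simp: continuous_on_eq_continuous_within)
  have h: "continuous_on {0..T} h" unfolding h_def by (intro continuous_intros f cG)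
  have orth_h: "integral {0..T} (\<lambda>t. of_real (\<eta> 1 t) * h t) = 0" if \<eta>: "time_cutoff T \<eta>" for \<eta>
  proof -
    have D: "((\<lambda>t. complex_of_real (\<eta> 0 t)) has_vector_derivative of_real (\<eta> 1 t)) (at t within {0..T})" for t
      using \<eta> by (auto simp: time_cutoff_def intro!: has_vector_derivative_of_real
          simp: has_real_derivative_iff_has_vector_derivative[symmetric] intro: DERIV_subset)
    have c: "\<eta> 0 0 = 0" "\<eta> 0 T = 0" using \<eta> unfolding time_cutoff_def by force+
    have "((\<lambda>t. of_real (\<eta> 0 t) * g t + of_real (\<eta> 1 t) * integral {0..t} g) has_integral
        (of_real (\<eta> 0 T) * integral {0..T} g - of_real (\<eta> 0 0) * integral {0..0} g)) {0..T}"
      using True by (intro fundamental_theorem_of_calculus has_vector_derivative_mult D DG) auto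
    then have p: "integral {0..T} (\<lambda>t. of_real (\<eta> 0 t) * g t + of_real (\<eta> 1 t) * integral {0..t} g) = 0"
      by (simp add: c integral_unique)
    note cc = time_cutoff_continuous[OF \<eta>]
    have "integral {0..T} (\<lambda>t. of_real (\<eta> 1 t) * h t)
      = integral {0..T} (\<lambda>t. (of_real (\<eta> 1 t) * f t + of_real (\<eta> 0 t) * g t)
          - (of_real (\<eta> 0 t) * g t + of_real (\<eta> 1 t) * integral {0..t} g))"
      by (intro integral_cong) (simp add: h_def algebra_simps)
    also have "\<dots> = integral {0..T} (\<lambda>t. of_real (\<eta> 1 t) * f t + of_real (\<eta> 0 t) * g t)
          - integral {0..T} (\<lambda>t. of_real (\<eta> 0 t) * g t + of_real (\<eta> 1 t) * integral {0..t} g)"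
      by (intro Henstock_Kurzweil_Integration.integral_diff integrable_continuous_real continuous_intros cc f g cG)
    also have "\<dots> = 0" using p orth[OF \<eta>] by simp
    finally show ?thesis by simp
  qed
  have "h s = h (T / 2)" if "s \<in> {0<..<T}" for s
  proof (cases rule: linorder_cases[of s "T / 2"])
    case less
    then show ?thesis using that True by (intro du_Bois_Reymond_constant[where h=h and T=T] h orth_h) auto
  next
    case greater
    then show ?thesis using that True
      by (intro du_Bois_Reymond_constant[where h=h and T=T, symmetric] h orth_h) auto
  next
    case equal
    then show ?thesis by (rule arg_cong)
  qed
  note interior = this
  have closed: "h s = h (T / 2)" if "s \<in> {0..T}" for s
  proof (rule continuous_constant_on_closure[of "{0<..<T}"])
    show "continuous_on (closure {0<..<T}) h" "s \<in> closure {0<..<T}"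
      using True that h by simp_all
  qed (rule interior)
  have "h t = h (T / 2)" "h 0 = h (T / 2)" using t True by (auto intro: closed)
  then have "h t = h 0" by metis
  then show ?thesis by (simp add: h_def algebra_simps)
next
  case False
  then have "t = 0" using t by auto
  then show ?thesis by simp
qed

section \<open>Uniqueness\<close>

lemma LINT_interval_eq_integral:
  fixes f :: "real \<Rightarrow> complex"
  assumes "continuous_on {a..b} f"
  shows "(LINT t|lebesgue_on {a..b}. f t) = integral {a..b} f"
  using lebesgue_integral_eq_integral[OF continuous_imp_integrable_real[OF assms]] by simp

lemma sqrt_sqn_continuous_on:
  assumes sq: "\<And>t. t \<in> S \<Longrightarrow> sq_int (U t)"
    and lim: "\<And>t. t \<in> S \<Longrightarrow> ((\<lambda>s. sqn (\<lambda>x. U s x - U t x)) \<longlongrightarrow> 0) (at t within S)"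
  shows "continuous_on S (\<lambda>t. sqrt (sqn (U t)))"
  unfolding continuous_on_def
proof (rule ballI, rule LIM_zero_cancel)
  fix t assume t: "t \<in> S"
  show "((\<lambda>s. sqrt (sqn (U s)) - sqrt (sqn (U t))) \<longlongrightarrow> 0) (at t within S)"
  proof (rule Lim_null_comparison)
    show "((\<lambda>s. sqrt (sqn (\<lambda>x. U s x - U t x))) \<longlongrightarrow> 0) (at t within S)"
      using tendsto_real_sqrt[OF lim[OF t]] by simp
    show "\<forall>\<^sub>F s in at t within S. norm (sqrt (sqn (U s)) - sqrt (sqn (U t))) \<le> sqrt (sqn (\<lambda>x. U s x - U t x))"
      unfolding eventually_at_topological
      by (intro exI[of _ UNIV]) (simp add: sqn_reverse_triangle sq t)
  qed
qed

lemma continuous_on_if_norm_bound: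
  fixes f :: "real \<Rightarrow> complex"
  assumes "\<And>t. t \<in> S \<Longrightarrow> ((\<lambda>s. b s t) \<longlongrightarrow> 0) (at t within S)"
    "\<And>s t. s \<in> S \<Longrightarrow> t \<in> S \<Longrightarrow> cmod (f s - f t) \<le> b s t"
  shows "continuous_on S f"
  unfolding continuous_on_def
proof (rule ballI, rule LIM_zero_cancel)
  fix t assume t: "t \<in> S"
  show "((\<lambda>s. f s - f t) \<longlongrightarrow> 0) (at t within S)"
  proof (rule Lim_null_comparison[OF _ assms(1)[OF t]])
    show "\<forall>\<^sub>F s in at t within S. norm (f s - f t) \<le> b s t"
      unfolding eventually_at_topological by (intro exI[of _ UNIV]) (simp add: assms t)
  qed
qed

lemma time_cutoff_test_function:
  assumes "time_cutoff T \<eta>"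
  shows "test_function T (\<lambda>t x. of_real (\<eta> 0 t) * emode n x)"
    "dt (\<lambda>t x. of_real (\<eta> 0 t) * emode n x) t x = of_real (\<eta> 1 t) * emode n x"
    "dx (dx (\<lambda>t x. of_real (\<eta> 0 t) * emode n x)) t x
      = - (of_real ((2 * pi * of_int n)\<^sup>2)) * of_real (\<eta> 0 t) * emode n x"
proof -
  let ?c = "freq n"
  have D1: "((\<lambda>s. of_real (\<eta> k s) * z) has_vector_derivative of_real (\<eta> (Suc k) t) * z) (at t)" for k t and z :: complex
    by (rule has_vector_derivative_mult_left)
       (use assms in \<open>auto simp: time_cutoff_def intro!: has_vector_derivative_of_real
        simp: has_real_derivative_iff_has_vector_derivative[symmetric]\<close>)
  have D2: "((\<lambda>y. z * emode n y) has_vector_derivative z * ?c * emode n x) (at x)" for z x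
    using has_vector_derivative_mult_right[OF emode_has_vector_derivative[of n x UNIV], of z]
    by (simp add: mult.assoc)
  show "test_function T (\<lambda>t x. of_real (\<eta> 0 t) * emode n x)"
    unfolding test_function_def
  proof (intro conjI allI)
    show "smooth2 (\<lambda>t x. of_real (\<eta> 0 t) * emode n x)"
      unfolding smooth2_def
    proof (intro exI[of _ "\<lambda>k j t x. of_real (\<eta> k t) * ?c ^ j * emode n x"] conjI allI)
      show "continuous_on UNIV (\<lambda>(t, x). of_real (\<eta> k t) * ?c ^ j * emode n x)" for k j
        unfolding split_beta
        by (intro continuous_intros continuous_on_compose2[OF time_cutoff_continuous[OF assms, of UNIV]]
              continuous_on_compose2[OF continuous_emode[of UNIV]]) auto
      show "((\<lambda>s. of_real (\<eta> k s) * ?c ^ j * emode n x) has_vector_derivative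
          of_real (\<eta> (Suc k) t) * ?c ^ j * emode n x) (at t)" for k j t x
        using D1[of k "?c ^ j * emode n x" t] by (simp add: mult.assoc)
      show "((\<lambda>y. of_real (\<eta> k t) * ?c ^ j * emode n y) has_vector_derivative
          of_real (\<eta> k t) * ?c ^ Suc j * emode n x) (at x)" for k j t x
        using D2[of "of_real (\<eta> k t) * ?c ^ j" x] by (simp only: power_Suc2 mult.assoc)
    qed simp
    show "periodic1 (\<lambda>x. of_real (\<eta> 0 t) * emode n x)" for t
      by (simp add: periodic1_def emode_periodic)
    show "\<exists>c d. 0 < c \<and> d < T \<and> (\<forall>t x. t \<notin> {c..d} \<longrightarrow> of_real (\<eta> 0 t) * emode n x = 0)"
      using assms unfolding time_cutoff_def by fastforce
  qed
  show "dt (\<lambda>t x. of_real (\<eta> 0 t) * emode n x) t x = of_real (\<eta> 1 t) * emode n x"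
    unfolding dt_def using D1[of 0 "emode n x" t] by (intro vector_derivative_at) simp
  have dx1: "dx (\<lambda>t x. of_real (\<eta> 0 t) * emode n x) = (\<lambda>t x. of_real (\<eta> 0 t) * ?c * emode n x)"
    unfolding dx_def by (intro ext vector_derivative_at D2)
  have "dx (dx (\<lambda>t x. of_real (\<eta> 0 t) * emode n x)) t x = of_real (\<eta> 0 t) * ?c * ?c * emode n x"
    unfolding dx1 unfolding dx_def by (intro vector_derivative_at D2)
  also have "\<dots> = (?c * ?c) * of_real (\<eta> 0 t) * emode n x" by (simp only: mult_ac)
  also have "?c * ?c = - (of_real ((2 * pi * of_int n)\<^sup>2))"
    by (simp add: power2_eq_square)
  finally show "dx (dx (\<lambda>t x. of_real (\<eta> 0 t) * emode n x)) t x
      = - (of_real ((2 * pi * of_int n)\<^sup>2)) * of_real (\<eta> 0 t) * emode n x" .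
qed

text \<open>Coefficients of \<open>f\<^sup>2\<close>. The square of an \<open>L\<^sup>2\<close> function is only integrable, so the lemmas about \<open>fc\<close>, which assume
square integrability, do not cover it.\<close>

definition square_coeff :: "(real \<Rightarrow> complex) \<Rightarrow> int \<Rightarrow> complex" where
  "square_coeff f n = (LINT x|torus. emode (- n) x * (f x * f x))"

lemma square_coeff_diff:
  assumes "sq_int f" "sq_int g"
  shows "square_coeff f n - square_coeff g n = (LINT x|torus. emode (- n) x * ((f x + g x) * (f x - g x)))"
proof -
  have "integrable torus (\<lambda>x. emode (- n) x * (h x * h x))" if "sq_int h" for h
    using sq_int_mult[OF sq_int_emode_mult[OF that] that] by (simp add: mult.assoc)
  then show ?thesis unfolding square_coeff_def using assms
    by (subst Bochner_Integration.integral_diff[symmetric]) (auto simp: algebra_simps)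
qed

lemma continuous_fc:
  assumes "C0_H1 T u" shows "continuous_on {0..T} (\<lambda>t. fc (u t) n)"
proof (rule continuous_on_if_norm_bound)
  note u = C0_H1D[OF assms]
  show "((\<lambda>s. sqrt (sqn (\<lambda>x. u s x - u t x))) \<longlongrightarrow> 0) (at t within {0..T})" if "t \<in> {0..T}" for t
    using tendsto_real_sqrt[OF u(3)[OF that]] by simp
  show "cmod (fc (u s) n - fc (u t) n) \<le> sqrt (sqn (\<lambda>x. u s x - u t x))" if "s \<in> {0..T}" "t \<in> {0..T}" for s t
    using H1_pairD(1)[OF u(1)[OF that(1)]] H1_pairD(1)[OF u(1)[OF that(2)]]
    by (subst fc_diff[symmetric]) (auto intro!: norm_fc_le sq_int_diff)
qed

lemma continuous_square_coeff:
  assumes "C0_H1 T u" shows "continuous_on {0..T} (\<lambda>t. square_coeff (u t) n)"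
proof (rule continuous_on_if_norm_bound)
  note u = C0_H1D[OF assms]
  have sq: "sq_int (u t)" if "t \<in> {0..T}" for t using H1_pairD(1)[OF u(1)[OF that]] .
  have c: "continuous_on {0..T} (\<lambda>t. sqrt (sqn (u t)))" by (rule sqrt_sqn_continuous_on) (use sq u(3) in auto)
  show "((\<lambda>s. (sqrt (sqn (u s)) + sqrt (sqn (u t))) * sqrt (sqn (\<lambda>x. u s x - u t x))) \<longlongrightarrow> 0) (at t within {0..T})"
    if "t \<in> {0..T}" for t
  proof -
    have l: "((\<lambda>s. sqrt (sqn (u s))) \<longlongrightarrow> sqrt (sqn (u t))) (at t within {0..T})"
      using c that unfolding continuous_on_def by blast
    have "((\<lambda>s. (sqrt (sqn (u s)) + sqrt (sqn (u t))) * sqrt (sqn (\<lambda>x. u s x - u t x)))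
        \<longlongrightarrow> (sqrt (sqn (u t)) + sqrt (sqn (u t))) * sqrt 0) (at t within {0..T})"
      by (intro tendsto_mult tendsto_add l tendsto_const tendsto_real_sqrt[OF u(3)[OF that]])
    then show ?thesis by simp
  qed
  show "cmod (square_coeff (u s) n - square_coeff (u t) n) \<le> (sqrt (sqn (u s)) + sqrt (sqn (u t))) * sqrt (sqn (\<lambda>x. u s x - u t x))"
    if "s \<in> {0..T}" "t \<in> {0..T}" for s t
  proof -
    note ss = sq[OF that(1)] sq[OF that(2)]
    have "cmod (square_coeff (u s) n - square_coeff (u t) n)
        = cmod (LINT x|torus. (emode (- n) x * (u s x + u t x)) * (u s x - u t x))"
      by (simp add: square_coeff_diff[OF ss] mult.assoc)
    also have "\<dots> \<le> sqrt (sqn (\<lambda>x. emode (- n) x * (u s x + u t x))) * sqrt (sqn (\<lambda>x. u s x - u t x))"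
      by (intro Cauchy_Schwarz_torus sq_int_emode_mult sq_int_add sq_int_diff ss)
    also have "sqn (\<lambda>x. emode (- n) x * (u s x + u t x)) = sqn (\<lambda>x. u s x + u t x)"
      by (simp add: sqn_def norm_mult)
    finally show ?thesis
      using mult_right_mono[OF sqn_triangle[OF ss], of "sqrt (sqn (\<lambda>x. u s x - u t x))"] by simp
  qed
qed

text \<open>Testing the equation with a time cutoff times the conjugate of the mode \<open>n\<close> yields the weak form of an ordinary differential
equation for that mode, to which the lemma of du Bois-Reymond applies. The term
\<open>u \<partial>\<^sub>x u\<close> contributes \<open>\<pi> \<i> n\<close> times the coefficient of \<open>u\<^sup>2\<close> by the product rule.\<close>

lemma burgers_mode_equation:
  assumes u: "burgers_solution \<epsilon> T u0 u" and t: "t \<in> {0..T}"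
  shows "fc (u t) n = fc (u 0) n
    - integral {0..t} (\<lambda>s. of_real pi * \<i> * of_int n * square_coeff (u s) n
        + of_real (\<epsilon> * (2 * pi * of_int n)\<^sup>2) * fc (u s) n - (if n = 0 then \<i> else 0))"
proof -
  have C0: "C0_H1 T u" using u by (simp add: burgers_solution_def)
  note uD = C0_H1D[OF C0]
  have sq: "sq_int (u t)" "sq_int (weak_deriv (u t))" if "t \<in> {0..T}" for t
    using H1_pairD[OF uD(1)[OF that]] by auto
  note cf = continuous_fc[OF C0, of n] and cz = continuous_square_coeff[OF C0, of n]
  let ?k = "of_real (\<epsilon> * (2 * pi * of_int n)\<^sup>2) :: complex"
  define g where "g s = of_real pi * \<i> * of_int n * square_coeff (u s) n + ?k * fc (u s) n - (if n = 0 then \<i> else 0)" for s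
  have cg: "continuous_on {0..T} g" unfolding g_def by (intro continuous_intros cf cz)
  have nl: "fc (\<lambda>x. u t x * weak_deriv (u t) x) n = of_real pi * \<i> * of_int n * square_coeff (u t) n"
    if "t \<in> {0..T}" for t
  proof -
    have "2 * fc (\<lambda>x. u t x * weak_deriv (u t) x) n = freq n * square_coeff (u t) n"
      using H1_pair_product_fc[OF uD(1)[OF that] uD(1)[OF that], of n]
      by (simp add: fc_def square_coeff_def mult.commute[of "weak_deriv _ _"])
    then show ?thesis by (simp add: mult.assoc)
  qed
  have orth: "integral {0..T} (\<lambda>t. of_real (\<eta> 1 t) * (- fc (u t) n) + of_real (\<eta> 0 t) * g t) = 0"
    if \<eta>: "time_cutoff T \<eta>" for \<eta>
  proof -
    note cc = time_cutoff_continuous[OF \<eta>]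
    let ?\<phi> = "\<lambda>t x. of_real (\<eta> 0 t) * emode (- n) x :: complex"
    note tf = time_cutoff_test_function[OF \<eta>, of "- n"]
    have L: "(LINT x|torus. - u t x * dt ?\<phi> t x + u t x * weak_deriv (u t) x * ?\<phi> t x - of_real \<epsilon> * u t x * dx (dx ?\<phi>) t x)
        = of_real (\<eta> 1 t) * (- fc (u t) n) + of_real (\<eta> 0 t) * (of_real pi * \<i> * of_int n * square_coeff (u t) n + ?k * fc (u t) n)"
      (is "?L = ?R") if t: "t \<in> {0..T}" for t
    proof -
      have i1: "integrable torus (\<lambda>x. emode (- n) x * u t x)"
        using sq_int_mult[OF sq_int_emode sq(1)[OF t]] .
      have i2: "integrable torus (\<lambda>x. emode (- n) x * (u t x * weak_deriv (u t) x))"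
        using sq_int_mult[OF sq_int_emode_mult[OF sq(1)[OF t]] sq(2)[OF t]] by (simp add: mult.assoc)
      have "?L = (LINT x|torus. (of_real (\<eta> 0 t) * ?k - of_real (\<eta> 1 t)) * (emode (- n) x * u t x)
          + of_real (\<eta> 0 t) * (emode (- n) x * (u t x * weak_deriv (u t) x)))"
        unfolding tf by (intro Bochner_Integration.integral_cong) (auto simp: algebra_simps)
      also have "\<dots> = (of_real (\<eta> 0 t) * ?k - of_real (\<eta> 1 t)) * fc (u t) n
          + of_real (\<eta> 0 t) * fc (\<lambda>x. u t x * weak_deriv (u t) x) n"
        using i1 i2 unfolding fc_def
        by (subst Bochner_Integration.integral_add) (auto simp only: integrable_mult_right integral_mult_right_zero)
      also have "\<dots> = ?R" unfolding nl[OF t] by (simp add: algebra_simps)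
      finally show ?thesis .
    qed
    have R: "(LINT x|torus. \<i> * ?\<phi> t x) = of_real (\<eta> 0 t) * (if n = 0 then \<i> else 0)" for t
    proof -
      have "(LINT x|torus. \<i> * ?\<phi> t x) = (LINT x|torus. (\<i> * of_real (\<eta> 0 t)) * emode (- n) x)"
        by (simp add: mult.assoc)
      also have "\<dots> = (\<i> * of_real (\<eta> 0 t)) * (LINT x|torus. emode (- n) x)" by (rule integral_mult_right_zero)
      finally show ?thesis by (simp add: integral_emode)
    qed
    have "(LINT t|lebesgue_on {0..T}. LINT x|torus. - u t x * dt ?\<phi> t x + u t x * weak_deriv (u t) x * ?\<phi> t x
          - of_real \<epsilon> * u t x * dx (dx ?\<phi>) t x)
        = (LINT t|lebesgue_on {0..T}. LINT x|torus. \<i> * ?\<phi> t x)"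
      using u tf(1) unfolding burgers_solution_def by blast
    moreover have "(LINT t|lebesgue_on {0..T}. LINT x|torus. - u t x * dt ?\<phi> t x + u t x * weak_deriv (u t) x * ?\<phi> t x
          - of_real \<epsilon> * u t x * dx (dx ?\<phi>) t x)
        = (LINT t|lebesgue_on {0..T}. of_real (\<eta> 1 t) * (- fc (u t) n) + of_real (\<eta> 0 t) * (of_real pi * \<i> * of_int n * square_coeff (u t) n + ?k * fc (u t) n))"
      by (rule Bochner_Integration.integral_cong) (simp_all only: L space_lebesgue_on)
    moreover have "\<dots> = integral {0..T} (\<lambda>t. of_real (\<eta> 1 t) * (- fc (u t) n) + of_real (\<eta> 0 t) * (of_real pi * \<i> * of_int n * square_coeff (u t) n + ?k * fc (u t) n))"
      by (rule LINT_interval_eq_integral) (intro continuous_intros cc cf cz)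
    moreover have "(LINT t|lebesgue_on {0..T}. LINT x|torus. \<i> * ?\<phi> t x) = integral {0..T} (\<lambda>t. of_real (\<eta> 0 t) * (if n = 0 then \<i> else 0))"
      unfolding R by (rule LINT_interval_eq_integral) (intro continuous_intros cc)
    ultimately have eq: "integral {0..T} (\<lambda>t. of_real (\<eta> 1 t) * (- fc (u t) n) + of_real (\<eta> 0 t) * (of_real pi * \<i> * of_int n * square_coeff (u t) n + ?k * fc (u t) n))
        = integral {0..T} (\<lambda>t. of_real (\<eta> 0 t) * (if n = 0 then \<i> else 0))" (is "integral _ ?A = integral _ ?B")
      by simp
    have "integral {0..T} (\<lambda>t. of_real (\<eta> 1 t) * (- fc (u t) n) + of_real (\<eta> 0 t) * g t) = integral {0..T} (\<lambda>t. ?A t - ?B t)"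
      by (intro integral_cong) (simp only: g_def algebra_simps)
    also have "\<dots> = integral {0..T} ?A - integral {0..T} ?B"
      by (intro Henstock_Kurzweil_Integration.integral_diff integrable_continuous_real continuous_intros cc cf cz)
    finally show ?thesis using eq by simp
  qed
  have "- fc (u t) n = - fc (u 0) n + integral {0..t} g"
    by (rule du_Bois_Reymond[OF _ cg orth t]) (intro continuous_intros cf, assumption)
  then have "fc (u t) n = fc (u 0) n - integral {0..t} g" by (simp add: algebra_simps)
  then show ?thesis by (simp only: g_def[abs_def])
qed

lemma nonpos_derivative_le_initial:
  fixes f :: "real \<Rightarrow> real"
  assumes D: "\<And>s. s \<in> {0..t} \<Longrightarrow> (f has_real_derivative f' s) (at s within {0..t})"
    and "\<And>s. s \<in> {0..t} \<Longrightarrow> f' s \<le> 0" and "0 \<le> t"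
  shows "f t \<le> f 0"
proof -
  have "(f' has_integral (f t - f 0)) {0..t}"
    using D \<open>0 \<le> t\<close> by (intro fundamental_theorem_of_calculus)
      (auto simp: has_real_derivative_iff_has_vector_derivative)
  then have "f t - f 0 \<le> 0"
    by (rule has_integral_le[OF _ has_integral_0]) (use assms in auto)
  then show ?thesis by simp
qed

text \<open>The function \<open>exp (- C t)\<close> times the primitive of \<open>y\<close> is nonincreasing and starts at zero.\<close>

lemma Gronwall_zero:
  fixes y :: "real \<Rightarrow> real"
  assumes y: "continuous_on {0..T} y" and nn: "\<And>t. t \<in> {0..T} \<Longrightarrow> y t \<ge> 0"
    and le: "\<And>t. t \<in> {0..T} \<Longrightarrow> y t \<le> C * integral {0..t} y" and C: "C \<ge> 0" and t: "t \<in> {0..T}"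
  shows "y t = 0"
proof -
  define Y where "Y t = integral {0..t} y" for t
  have DY: "(Y has_real_derivative y s) (at s within {0..t})" if "s \<in> {0..t}" for s
    unfolding Y_def by (rule integral_has_real_derivative[OF continuous_on_subset[OF y] that]) (use t in auto)
  have DE: "((\<lambda>t. exp (- C * t) * Y t) has_real_derivative exp (- C * s) * (y s - C * Y s)) (at s within {0..t})"
    if "s \<in> {0..t}" for s
    by (rule derivative_eq_intros DY that refl | simp add: algebra_simps)+
  have "exp (- C * t) * Y t \<le> exp (- C * 0) * Y 0"
  proof (rule nonpos_derivative_le_initial[OF DE])
    show "exp (- C * s) * (y s - C * Y s) \<le> 0" if "s \<in> {0..t}" for s
      using le[of s] t that by (intro mult_nonneg_nonpos) (auto simp: Y_def)
  qed (use t in auto)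
  then have "Y t \<le> 0" by (simp add: Y_def mult_le_0_iff)
  then have "C * Y t \<le> 0" using C by (simp add: mult_nonneg_nonpos)
  then show ?thesis using le[OF t] nn[OF t] by (simp add: Y_def)
qed

text \<open>The dissipation \<open>8 \<pi>\<^sup>2 \<epsilon> n\<^sup>2 |W|\<^sup>2\<close> absorbs the derivative in the source term \<open>\<pi> \<i> n Z\<close>, so the
  bound does not depend on \<open>n\<close>.\<close>

lemma mode_energy_bound:
  fixes W Z :: "real \<Rightarrow> complex"
  assumes W: "continuous_on {0..T} W" and Z: "continuous_on {0..T} Z" and \<epsilon>: "\<epsilon> > 0"
    and eq: "\<And>t. t \<in> {0..T} \<Longrightarrow> W t = - integral {0..t} (\<lambda>s. of_real pi * \<i> * of_int n * Z s + of_real (\<epsilon> * (2 * pi * of_int n)\<^sup>2) * W s)"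
    and t: "t \<in> {0..T}"
  shows "(cmod (W t))\<^sup>2 \<le> 1 / (8 * \<epsilon>) * integral {0..t} (\<lambda>s. (cmod (Z s))\<^sup>2)"
proof -
  define G where "G s = of_real pi * \<i> * of_int n * Z s + of_real (\<epsilon> * (2 * pi * of_int n)\<^sup>2) * W s" for s
  have cG: "continuous_on {0..T} G" unfolding G_def by (intro continuous_intros W Z)
  have eqG: "W s = - integral {0..s} G" if "s \<in> {0..T}" for s
    using eq[OF that] by (simp only: G_def[abs_def])
  have DW: "(W has_vector_derivative - G s) (at s within {0..t})" if "s \<in> {0..t}" for s
  proof -
    have "((\<lambda>s. - integral {0..s} G) has_vector_derivative - G s) (at s within {0..t})"
      by (intro has_vector_derivative_minus integral_has_vector_derivative that continuous_on_subset[OF cG])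
         (use t in auto)
    then show ?thesis
      by (rule has_vector_derivative_transform[OF that, rotated])
         (use t eqG in auto)
  qed
  let ?E = "\<lambda>s. W s \<bullet> W s - 1 / (8 * \<epsilon>) * integral {0..s} (\<lambda>s. (cmod (Z s))\<^sup>2)"
  have DE: "(?E has_real_derivative (W s \<bullet> (- G s) + (- G s) \<bullet> W s - 1 / (8 * \<epsilon>) * (cmod (Z s))\<^sup>2)) (at s within {0..t})"
    if "s \<in> {0..t}" for s
  proof (intro DERIV_diff DERIV_cmult)
    show "((\<lambda>s. W s \<bullet> W s) has_real_derivative W s \<bullet> (- G s) + (- G s) \<bullet> W s) (at s within {0..t})"
      unfolding has_real_derivative_iff_has_vector_derivative
      by (rule bounded_bilinear.has_vector_derivative[OF bounded_bilinear_inner DW DW]) (rule that)+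
    show "((\<lambda>s. integral {0..s} (\<lambda>s. (cmod (Z s))\<^sup>2)) has_real_derivative (cmod (Z s))\<^sup>2) (at s within {0..t})"
      by (intro integral_has_real_derivative that continuous_intros continuous_on_subset[OF Z]) (use t in auto)
  qed
  have "?E t \<le> ?E 0"
  proof (rule nonpos_derivative_le_initial[OF DE])
    fix s assume "s \<in> {0..t}"
    define p where "p = pi * \<bar>of_int n\<bar> * cmod (W s)"
    define z where "z = cmod (Z s)"
    have "W s \<bullet> G s = W s \<bullet> (of_real pi * \<i> * of_int n * Z s) + \<epsilon> * (2 * pi * of_int n)\<^sup>2 * (cmod (W s))\<^sup>2"
    proof -
      have "of_real (\<epsilon> * (2 * pi * of_int n)\<^sup>2) * W s = (\<epsilon> * (2 * pi * of_int n)\<^sup>2) *\<^sub>R W s"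
        by (simp only: scaleR_conv_of_real)
      then show ?thesis unfolding G_def
        by (simp only: inner_add_right inner_scaleR_right power2_norm_eq_inner)
    qed
    moreover have "\<bar>W s \<bullet> (of_real pi * \<i> * of_int n * Z s)\<bar> \<le> p * z"
    proof -
      have "\<bar>W s \<bullet> (of_real pi * \<i> * of_int n * Z s)\<bar> \<le> cmod (W s) * cmod (of_real pi * \<i> * of_int n * Z s)"
        by (rule Cauchy_Schwarz_ineq2)
      also have "\<dots> = p * z" by (simp add: norm_mult p_def z_def)
      finally show ?thesis .
    qed
    moreover have "\<epsilon> * (2 * pi * of_int n)\<^sup>2 * (cmod (W s))\<^sup>2 = 4 * \<epsilon> * p\<^sup>2"
      by (simp add: p_def power_mult_distrib)
    ultimately have WG: "- (W s \<bullet> G s) \<le> p * z - 4 * \<epsilon> * p\<^sup>2" by linarith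
    \<comment> \<open>completing the square: \<open>2 p z\<close> is absorbed by the dissipation \<open>8 \<epsilon> p\<^sup>2\<close>\<close>
    have "0 \<le> (8 * \<epsilon> * p - z)\<^sup>2 / (8 * \<epsilon>)" using \<epsilon> by simp
    also have "\<dots> = 8 * \<epsilon> * p\<^sup>2 - 2 * (p * z) + 1 / (8 * \<epsilon>) * z\<^sup>2"
      using \<epsilon> by (simp add: power2_eq_square field_simps)
    finally show "W s \<bullet> (- G s) + (- G s) \<bullet> W s - 1 / (8 * \<epsilon>) * (cmod (Z s))\<^sup>2 \<le> 0"
      using WG by (simp add: inner_commute[of "G s"] z_def)
  qed (use t in auto)
  moreover have "W 0 = 0" using eq[of 0] t by simp
  ultimately show ?thesis by (simp add: power2_norm_eq_inner)
qed

text \<open>The difference \<open>w\<close> of two solutions has modes driven by those of \<open>w (u + v)\<close>. Since \<open>u + v\<close> is bounded uniformly in time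
by the embedding of \<open>H\<^sup>1\<close>, Bessel's inequality bounds the sum of the driving terms by \<open>M\<^sup>2 \<parallel>w\<parallel>\<^sup>2\<close>; Parseval's
identity closes the estimate on the left.\<close>

theorem burgers_solution_unique:
  assumes u: "burgers_solution \<epsilon> T u0 u" and v: "burgers_solution \<epsilon> T u0 v" and \<epsilon>: "\<epsilon> > 0"
    and t: "t \<in> {0..T}"
  shows "AE x in torus. v t x = u t x"
proof -
  have Cu: "C0_H1 T u" and Cv: "C0_H1 T v" using u v by (auto simp: burgers_solution_def)
  note uD = C0_H1D[OF Cu] and vD = C0_H1D[OF Cv]
  have squ: "sq_int (u s)" "sq_int (weak_deriv (u s))" if "s \<in> {0..T}" for s
    using H1_pairD[OF uD(1)[OF that]] by auto
  have sqv: "sq_int (v s)" "sq_int (weak_deriv (v s))" if "s \<in> {0..T}" for s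
    using H1_pairD[OF vD(1)[OF that]] by auto
  define w where "w s x = u s x - v s x" for s x
  have sqw: "sq_int (w s)" if "s \<in> {0..T}" for s
    unfolding w_def by (intro sq_int_diff squ sqv that)
  define y where "y s = sqn (w s)" for s
  have cy: "continuous_on {0..T} y"
  proof -
    have "continuous_on {0..T} (\<lambda>s. sqrt (sqn (w s)))"
    proof (rule sqrt_sqn_continuous_on[OF sqw])
      fix r assume r: "r \<in> {0..T}"
      have "((\<lambda>s. (sqrt (sqn (\<lambda>x. u s x - u r x)) + sqrt (sqn (\<lambda>x. v s x - v r x)))\<^sup>2) \<longlongrightarrow> (sqrt 0 + sqrt 0)\<^sup>2) (at r within {0..T})"
        by (intro tendsto_intros uD(3) vD(3) r)
      then have l: "((\<lambda>s. (sqrt (sqn (\<lambda>x. u s x - u r x)) + sqrt (sqn (\<lambda>x. v s x - v r x)))\<^sup>2) \<longlongrightarrow> 0) (at r within {0..T})"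
        by simp
      have "sqn (\<lambda>x. w s x - w r x) \<le> (sqrt (sqn (\<lambda>x. u s x - u r x)) + sqrt (sqn (\<lambda>x. v s x - v r x)))\<^sup>2"
        if s: "s \<in> {0..T}" for s
      proof -
        have "(\<lambda>x. w s x - w r x) = (\<lambda>x. (u s x - u r x) + (v r x - v s x))"
          by (auto simp: w_def)
        then have "sqrt (sqn (\<lambda>x. w s x - w r x)) \<le> sqrt (sqn (\<lambda>x. u s x - u r x)) + sqrt (sqn (\<lambda>x. v r x - v s x))"
          using sqn_triangle[OF sq_int_diff[OF squ(1)[OF s] squ(1)[OF r]] sq_int_diff[OF sqv(1)[OF r] sqv(1)[OF s]]] by simp
        then show ?thesis
          using sqn_minus_commute[of "v r" "v s"] by (intro sqrt_le_D) simp
      qed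
      then show "((\<lambda>s. sqn (\<lambda>x. w s x - w r x)) \<longlongrightarrow> 0) (at r within {0..T})"
        by (intro Lim_null_comparison[OF _ l]) (auto simp: eventually_at_topological intro!: exI[of _ UNIV])
    qed
    then have "continuous_on {0..T} (\<lambda>s. (sqrt (sqn (w s)))\<^sup>2)" by (rule continuous_on_power)
    then show ?thesis by (simp add: y_def)
  qed
  have "continuous_on {0..T} (\<lambda>s. (sqrt (sqn (u s)) + sobolev * sqrt (sqn (weak_deriv (u s))))
      + (sqrt (sqn (v s)) + sobolev * sqrt (sqn (weak_deriv (v s)))))" (is "continuous_on _ ?m")
    by (intro continuous_intros sqrt_sqn_continuous_on squ sqv uD vD)
  then have "bounded (?m ` {0..T})" by (intro compact_imp_bounded compact_continuous_image compact_Icc)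
  then obtain M where M0: "M > 0" "\<forall>y\<in>?m ` {0..T}. norm y \<le> M"
    unfolding bounded_pos by blast
  have M: "\<bar>?m s\<bar> \<le> M" if "s \<in> {0..T}" for s
    using bspec[OF M0(2) imageI[OF that]] by (simp only: real_norm_def)
  have AEM: "AE x in torus. cmod (u s x + v s x) \<le> M" if s: "s \<in> {0..T}" for s
    using H1_AE_bound[OF uD(1)[OF s]] H1_AE_bound[OF vD(1)[OF s]]
  proof eventually_elim
    fix x
    assume "cmod (u s x) \<le> sqrt (sqn (u s)) + sobolev * sqrt (sqn (weak_deriv (u s)))"
      "cmod (v s x) \<le> sqrt (sqn (v s)) + sobolev * sqrt (sqn (weak_deriv (v s)))"
    then show "cmod (u s x + v s x) \<le> M" using norm_triangle_ineq[of "u s x" "v s x"] M[OF s] by linarith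
  qed
  have meas: "(\<lambda>x. u s x + v s x) \<in> borel_measurable torus" if "s \<in> {0..T}" for s
    using sq_int_add[OF squ(1)[OF that] sqv(1)[OF that]] by (simp add: sq_int_def)
  define Z where "Z n s = square_coeff (u s) n - square_coeff (v s) n" for n s
  have Z: "Z n s = fc (\<lambda>x. (u s x + v s x) * w s x) n" if "s \<in> {0..T}" for n s
    using square_coeff_diff[OF squ(1)[OF that] sqv(1)[OF that]] by (simp add: Z_def fc_def w_def)
  have cZ: "continuous_on {0..T} (Z n)" for n
    unfolding Z_def by (intro continuous_intros continuous_square_coeff Cu Cv)
  define W where "W n s = fc (u s) n - fc (v s) n" for n s
  have W: "W n s = fc (w s) n" if "s \<in> {0..T}" for n s
    using fc_diff[OF squ(1)[OF that] sqv(1)[OF that]] by (simp add: W_def w_def[abs_def])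
  have cW: "continuous_on {0..T} (W n)" for n
    unfolding W_def by (intro continuous_intros continuous_fc Cu Cv)
  have init: "fc (u 0) n = fc (v 0) n" for n
  proof -
    have "0 \<in> {0..T}" using t by auto
    moreover have "AE x in torus. u 0 x = v 0 x"
      using u v unfolding burgers_solution_def by (auto elim: eventually_elim2)
    ultimately show ?thesis using squ(1)[of 0] sqv(1)[of 0] by (intro fc_cong) (auto simp: sq_int_def)
  qed
  have eqW: "W n s = - integral {0..s} (\<lambda>r. of_real pi * \<i> * of_int n * Z n r + of_real (\<epsilon> * (2 * pi * of_int n)\<^sup>2) * W n r)"
    if s: "s \<in> {0..T}" for n s
  proof -
    have sub: "{0..s} \<subseteq> {0..T}" using s by auto
    let ?F = "\<lambda>u s. of_real pi * \<i> * of_int n * square_coeff (u s) n + of_real (\<epsilon> * (2 * pi * of_int n)\<^sup>2) * fc (u s) n - (if n = 0 then \<i> else 0)"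
    have c: "continuous_on {0..s} (?F u)" if "C0_H1 T u" for u
      by (intro continuous_intros continuous_on_subset[OF continuous_fc[OF that] sub] continuous_on_subset[OF continuous_square_coeff[OF that] sub])
    have "W n s = integral {0..s} (?F v) - integral {0..s} (?F u)"
      unfolding W_def burgers_mode_equation[OF u s] burgers_mode_equation[OF v s] init by simp
    also have "\<dots> = integral {0..s} (\<lambda>r. ?F v r - ?F u r)"
      by (intro Henstock_Kurzweil_Integration.integral_diff[symmetric] integrable_continuous_real c Cu Cv)
    also have "\<dots> = integral {0..s} (\<lambda>r. - (of_real pi * \<i> * of_int n * Z n r + of_real (\<epsilon> * (2 * pi * of_int n)\<^sup>2) * W n r))"
      by (intro integral_cong) (simp add: Z_def W_def algebra_simps)
    finally show ?thesis by (simp only: integral_neg)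
  qed
  have le: "y s \<le> (M\<^sup>2 / (8 * \<epsilon>)) * integral {0..s} y" if s: "s \<in> {0..T}" for s
  proof -
    have sub: "{0..s} \<subseteq> {0..T}" using s by auto
    have "(\<Sum>n\<in>F. (cmod (fc (w s) n))\<^sup>2) \<le> (M\<^sup>2 / (8 * \<epsilon>)) * integral {0..s} y" if F: "finite F" for F
    proof -
      have iZ: "(\<lambda>r. (cmod (Z n r))\<^sup>2) integrable_on {0..s}" for n
        by (intro integrable_continuous_real continuous_intros continuous_on_subset[OF cZ sub])
      have "(\<Sum>n\<in>F. (cmod (fc (w s) n))\<^sup>2) \<le> (\<Sum>n\<in>F. 1 / (8 * \<epsilon>) * integral {0..s} (\<lambda>r. (cmod (Z n r))\<^sup>2))"
        unfolding W[OF s, symmetric] by (intro sum_mono mode_energy_bound[OF cW cZ \<epsilon> eqW s])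
      also have "\<dots> = 1 / (8 * \<epsilon>) * integral {0..s} (\<lambda>r. \<Sum>n\<in>F. (cmod (Z n r))\<^sup>2)"
        by (simp only: sum_distrib_left[symmetric] Henstock_Kurzweil_Integration.integral_sum[OF F iZ])
      also have "\<dots> \<le> 1 / (8 * \<epsilon>) * integral {0..s} (\<lambda>r. M\<^sup>2 * y r)"
      proof (intro mult_left_mono integral_le)
        show "(\<lambda>r. \<Sum>n\<in>F. (cmod (Z n r))\<^sup>2) integrable_on {0..s}" using F iZ by (intro integrable_sum)
        show "(\<lambda>r. M\<^sup>2 * y r) integrable_on {0..s}"
          by (intro integrable_continuous_real continuous_intros continuous_on_subset[OF cy sub])
        fix r assume "r \<in> {0..s}"
        then have r: "r \<in> {0..T}" using sub by auto
        have "(\<Sum>n\<in>F. (cmod (Z n r))\<^sup>2) \<le> sqn (\<lambda>x. (u r x + v r x) * w r x)"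
          unfolding Z[OF r] by (intro Bessel F sq_int_bounded_mult[OF sqw[OF r] meas[OF r] AEM[OF r]])
        also have "\<dots> \<le> M\<^sup>2 * y r"
          unfolding y_def by (rule sqn_bounded_mult[OF sqw[OF r] meas[OF r] AEM[OF r]])
        finally show "(\<Sum>n\<in>F. (cmod (Z n r))\<^sup>2) \<le> M\<^sup>2 * y r" .
      qed (use \<epsilon> in auto)
      finally show ?thesis by simp
    qed
    then have "sqn (w s) \<le> (M\<^sup>2 / (8 * \<epsilon>)) * integral {0..s} y"
      by (rule has_sum_le_finite_sums[OF Parseval[OF sqw[OF s]]])
    then show ?thesis by (simp only: y_def)
  qed
  have "y t = 0"
    by (rule Gronwall_zero[OF cy _ le _ t]) (use \<epsilon> in \<open>auto simp: y_def\<close>)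
  then have "AE x in torus. w t x = 0" unfolding y_def by (rule sqn_zero_imp_AE[OF sqw[OF t]])
  then show ?thesis by eventually_elim (simp add: w_def)
qed

section \<open>A theta-like series\<close>

lemma infsum_has_field_derivative:
  fixes f f' :: "int \<Rightarrow> complex \<Rightarrow> complex"
  assumes S: "open S" "convex S" "z \<in> S"
    and D: "\<And>m w. w \<in> S \<Longrightarrow> (f m has_field_derivative f' m w) (at w)"
    and b: "\<And>m w. w \<in> S \<Longrightarrow> cmod (f m w) \<le> A m" "\<And>m w. w \<in> S \<Longrightarrow> cmod (f' m w) \<le> B m"
    and s: "A summable_on UNIV" "B summable_on UNIV"
  shows "((\<lambda>w. \<Sum>\<^sub>\<infinity>m. f m w) has_field_derivative (\<Sum>\<^sub>\<infinity>m. f' m z)) (at z)"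
proof -
  have sm: "summable (\<lambda>n. M (int_decode n))" if "M summable_on UNIV" for M :: "int \<Rightarrow> real"
    using summable_on_reindex_bij_betw[OF bij_int_decode, of M] that by (simp add: summable_on_imp_summable)
  have eq: "(\<Sum>\<^sub>\<infinity>m. h m) = (\<Sum>n. h (int_decode n))"
    if "\<And>m. cmod (h m) \<le> M m" "M summable_on UNIV" for h :: "int \<Rightarrow> complex" and M
  proof -
    have "(\<lambda>m. norm (h m)) summable_on UNIV"
      by (rule summable_on_comparison_test[OF that(2)]) (use that(1) in auto)
    then have "h summable_on UNIV" by (rule abs_summable_summable)
    then have "(\<lambda>n. h (int_decode n)) summable_on UNIV"
      using summable_on_reindex_bij_betw[OF bij_int_decode, of h] by simp
    then have "(\<lambda>n. h (int_decode n)) sums (\<Sum>\<^sub>\<infinity>n. h (int_decode n))"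
      by (intro has_sum_imp_sums has_sum_infsum)
    then show ?thesis
      using infsum_reindex_bij_betw[OF bij_int_decode, of h] by (simp add: sums_iff)
  qed
  have "((\<lambda>w. \<Sum>n. f (int_decode n) w) has_field_derivative (\<Sum>n. f' (int_decode n) z)) (at z)"
  proof (rule has_field_derivative_series'(2)[of S _ _ z])
    show "(f (int_decode n) has_field_derivative f' (int_decode n) w) (at w within S)" if "w \<in> S" for n w
      using D[OF that] by (rule has_field_derivative_at_within)
    show "uniformly_convergent_on S (\<lambda>n w. \<Sum>i<n. f' (int_decode i) w)"
      by (rule Weierstrass_m_test'[OF _ sm[OF s(2)]]) (use b in auto)
    show "summable (\<lambda>n. f (int_decode n) z)"
      by (rule summable_comparison_test'[OF sm[OF s(1)]]) (use b S in auto)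
  qed (use S in \<open>auto simp: interior_open\<close>)
  moreover have "(\<Sum>n. f (int_decode n) w) = (\<Sum>\<^sub>\<infinity>m. f m w)" if "w \<in> S" for w
    by (rule eq[OF _ s(1), symmetric]) (use b that in auto)
  moreover have "(\<Sum>n. f' (int_decode n) z) = (\<Sum>\<^sub>\<infinity>m. f' m z)"
    by (rule eq[OF _ s(2), symmetric]) (use b S in auto)
  ultimately have "((\<lambda>w. \<Sum>n. f (int_decode n) w) has_field_derivative (\<Sum>\<^sub>\<infinity>m. f' m z)) (at z)"
    and "\<And>w. w \<in> S \<Longrightarrow> (\<Sum>n. f (int_decode n) w) = (\<Sum>\<^sub>\<infinity>m. f m w)"
    by simp_all
  then show ?thesis
    by (rule has_field_derivative_transform_within_open[OF _ S(1) S(3)])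
qed

text \<open>Bound the power by an exponential and complete the square.\<close>

lemma power_times_gaussian_le:
  fixes x A Q :: real
  assumes "x \<ge> 0" "A > 0"
  shows "x ^ n * exp (- A * x\<^sup>2 + Q * x) \<le> fact n * exp ((Q + 1)\<^sup>2 / (4 * A))"
proof -
  have "x ^ n \<le> fact n * exp x"
  proof (cases "x = 0")
    case True
    then show ?thesis by (cases n) auto
  next
    case False
    then have "exp (- 1 / (1 / x)) \<le> fact n * (1 / x) ^ n"
      using assms by (intro exp_neg_inverse_le) auto
    then show ?thesis using False assms by (simp add: exp_minus field_simps power_divide)
  qed
  then have "x ^ n * exp (- A * x\<^sup>2 + Q * x) \<le> fact n * exp x * exp (- A * x\<^sup>2 + Q * x)"
    by (rule mult_right_mono) simp
  also have "\<dots> = fact n * exp (- A * x\<^sup>2 + (Q + 1) * x)"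
    by (simp add: exp_add[symmetric] algebra_simps)
  also have "- A * x\<^sup>2 + (Q + 1) * x \<le> (Q + 1)\<^sup>2 / (4 * A)"
  proof -
    have "0 \<le> (2 * A * x - (Q + 1))\<^sup>2 / (4 * A)" using assms by simp
    also have "\<dots> = A * x\<^sup>2 - (Q + 1) * x + (Q + 1)\<^sup>2 / (4 * A)"
      using assms by (simp add: power2_eq_square field_simps)
    finally show ?thesis by simp
  qed
  finally show ?thesis by simp
qed

text \<open>After the Cole--Hopf substitution, in the variable \<open>z = N x\<close>: \<open>k\<close> stands for \<open>k\<^sub>0\<close>, the viscosity is \<open>k / N\<close>,
\<open>c\<close> is the mean of the datum and \<open>b\<close> the Fourier coefficients of the initial potential. Time and space are complex
variables here, since this gives all derivatives at once and since the lower bound needs complex \<open>z\<close>.\<close>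

locale heat_flow =
  fixes k N c :: real and b :: "int \<Rightarrow> complex"
  assumes k_pos: "k > 0" and N_pos: "N > 0"
    and b_summable: "(\<lambda>m. cmod (b m)) summable_on UNIV"
begin

text \<open>In the exponent: dissipation, transport with the imaginary velocity \<open>\<i> t\<close> (integrated in time), transport with the velocity \<open>c\<close>, and the Fourier mode itself.\<close>

definition kern :: "int \<Rightarrow> complex \<Rightarrow> complex \<Rightarrow> complex" where
  "kern m t z = exp (- of_real (4 * pi\<^sup>2 * k * N * (of_int m)\<^sup>2) * t
     + of_int m * (of_real (pi * N) * t\<^sup>2 - 2 * of_real pi * \<i> * of_real (N * c) * t + 2 * of_real pi * \<i> * z))"

text \<open>The index \<open>j\<close> counts derivatives in \<open>z\<close>.\<close>

definition theta :: "nat \<Rightarrow> complex \<Rightarrow> complex \<Rightarrow> complex" where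
  "theta j t z = (\<Sum>\<^sub>\<infinity>m. (freq m) ^ j * b m * kern m t z)"

text \<open>On each of these sets the terms of every \<open>z\<close>-derivative of the series have a common summable majorant.\<close>

definition region :: "real \<Rightarrow> real \<Rightarrow> (complex \<times> complex) set" where
  "region a R = {p. a \<le> Re (fst p) \<and> cmod (fst p) \<le> R \<and> cmod (snd p) \<le> R}"

lemma norm_b_le: "cmod (b m) \<le> (\<Sum>\<^sub>\<infinity>m. cmod (b m))"
  using finite_sum_le_infsum[OF b_summable, of "{m}"] by auto

lemma theta_term_bound:
  assumes a: "a > 0"
  obtains A where "A summable_on UNIV"
    "\<And>t z m. (t, z) \<in> region a R \<Longrightarrow> cmod ((freq m) ^ j * b m * kern m t z) \<le> A m"
proof -
  define Q where "Q = pi * N * R\<^sup>2 + 2 * pi * N * \<bar>c\<bar> * R + 2 * pi * R"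
  define G where "G = 4 * pi\<^sup>2 * k * N * a"
  define C where "C = (\<Sum>\<^sub>\<infinity>m. cmod (b m))"
  define A where "A m = (2 * pi) ^ j * C * (fact (j + 2) * exp ((Q + 1)\<^sup>2 / (4 * G))) * (1 / (of_int m)\<^sup>2) + (if m = 0 then C else 0)" for m :: int
  have "G > 0" using a k_pos N_pos by (simp add: G_def)
  have C: "C \<ge> 0" "cmod (b m) \<le> C" for m using norm_b_le[of m] norm_ge_zero[of "b m"] by (auto simp: C_def intro: infsum_nonneg)
  have "(\<lambda>m::int. if m = 0 then C else 0) summable_on UNIV"
    by (rule finite_nonzero_values_imp_summable_on) (rule finite_subset[of _ "{0}"], auto)
  then have "A summable_on UNIV"
    unfolding A_def by (intro summable_on_add summable_on_cmult_right summable_on_int_inverse_squares)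
  moreover have "cmod ((freq m) ^ j * b m * kern m t z) \<le> A m"
    if p: "(t, z) \<in> region a R" for t z m
  proof -
    let ?x = "\<bar>of_int m\<bar> :: real"
    have R: "a \<le> Re t" "cmod t \<le> R" "cmod z \<le> R" using p by (auto simp: region_def)
    then have "R \<ge> 0" using norm_ge_zero order_trans by blast
    let ?w = "of_real (pi * N) * t\<^sup>2 - 2 * of_real pi * \<i> * of_real (N * c) * t + 2 * of_real pi * \<i> * z"
    have "cmod ?w \<le> pi * N * (cmod t)\<^sup>2 + 2 * pi * (N * \<bar>c\<bar>) * cmod t + 2 * pi * cmod z"
    proof -
      have "cmod ?w \<le> cmod (of_real (pi * N) * t\<^sup>2) + cmod (2 * of_real pi * \<i> * of_real (N * c) * t) + cmod (2 * of_real pi * \<i> * z)"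
        by (meson norm_triangle_ineq norm_triangle_ineq4 add_right_mono order_trans)
      then show ?thesis using N_pos by (simp add: norm_mult norm_power abs_mult)
    qed
    also have "\<dots> \<le> Q"
      unfolding Q_def using R N_pos \<open>R \<ge> 0\<close>
      by (intro add_mono) (auto intro!: mult_left_mono power_mono simp: mult.assoc)
    finally have w: "cmod ?w \<le> Q" .
    have "Re (- of_real (4 * pi\<^sup>2 * k * N * (of_int m)\<^sup>2) * t + of_int m * ?w)
        = - (4 * pi\<^sup>2 * k * N * (of_int m)\<^sup>2) * Re t + of_int m * Re ?w" by simp
    also have "\<dots> \<le> - G * ?x\<^sup>2 + Q * ?x"
    proof (rule add_mono)
      have "(4 * pi\<^sup>2 * k * N * (of_int m)\<^sup>2) * a \<le> (4 * pi\<^sup>2 * k * N * (of_int m)\<^sup>2) * Re t"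
        using R(1) k_pos N_pos by (intro mult_left_mono) auto
      then show "- (4 * pi\<^sup>2 * k * N * (of_int m)\<^sup>2) * Re t \<le> - G * ?x\<^sup>2" by (simp add: G_def mult_ac)
      have "of_int m * Re ?w \<le> ?x * \<bar>Re ?w\<bar>" by (metis abs_ge_self abs_mult)
      also have "\<dots> \<le> ?x * Q" using abs_Re_le_cmod[of ?w] w by (intro mult_left_mono) auto
      finally show "of_int m * Re ?w \<le> Q * ?x" by (simp only: mult.commute)
    qed
    finally have ke: "cmod (kern m t z) \<le> exp (- G * ?x\<^sup>2 + Q * ?x)"
      by (simp only: kern_def norm_exp_eq_Re exp_le_cancel_iff)
    have t1: "cmod ((freq m) ^ j * b m * kern m t z)
        \<le> (2 * pi) ^ j * ?x ^ j * C * exp (- G * ?x\<^sup>2 + Q * ?x)"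
      unfolding norm_mult norm_power using C(2)[of m] ke
      by (intro mult_mono) (auto simp: power_mult_distrib C(1))
    show ?thesis
    proof (cases "m = 0")
      case True
      have "cmod (0 ^ j * b 0 * kern 0 t z) \<le> C"
        using C(2)[of 0] C(1) by (cases j) (auto simp: kern_def)
      then show ?thesis using True by (simp add: A_def)
    next
      case False
      have "(2 * pi) ^ j * ?x ^ j * C * exp (- G * ?x\<^sup>2 + Q * ?x)
          = (2 * pi) ^ j * C * (?x ^ (j + 2) * exp (- G * ?x\<^sup>2 + Q * ?x)) * (1 / (of_int m)\<^sup>2)"
      proof -
        have "K * X ^ j * C * E = K * C * (X ^ (j + 2) * E) * (1 / X\<^sup>2)" if "X > 0" for K X E :: real
          using that by (simp add: power_add power2_eq_square)
        from this[of ?x "(2 * pi) ^ j"] False show ?thesis by (simp only: power2_abs zero_less_abs_iff of_int_eq_0_iff not_False_eq_True)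
      qed
      also have "\<dots> \<le> (2 * pi) ^ j * C * (fact (j + 2) * exp ((Q + 1)\<^sup>2 / (4 * G))) * (1 / (of_int m)\<^sup>2)"
        using \<open>G > 0\<close> C(1) by (intro mult_right_mono mult_left_mono power_times_gaussian_le) auto
      also have "\<dots> = A m" using False by (simp add: A_def)
      finally show ?thesis using t1 by linarith
    qed
  qed
  ultimately show ?thesis using that by blast
qed

lemma region_ball:
  fixes t z :: complex
  assumes "Re t > 0"
  defines "a \<equiv> Re t / 2" and "R \<equiv> cmod t + cmod z + 1"
  shows "\<And>w. w \<in> ball z 1 \<Longrightarrow> (t, w) \<in> region a R"
    "\<And>s. s \<in> ball t (min 1 (Re t / 2)) \<Longrightarrow> (s, z) \<in> region a R" "a > 0"
proof -
  show "a > 0" using assms by simp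
  show "(t, w) \<in> region a R" if "w \<in> ball z 1" for w
  proof -
    have "cmod w \<le> cmod z + 1" using that norm_triangle_ineq2[of w z] by (simp add: dist_norm norm_minus_commute)
    then have "cmod w \<le> R" using norm_ge_zero[of t] unfolding R_def by linarith
    moreover have "cmod t \<le> R" using norm_ge_zero[of z] unfolding R_def by linarith
    ultimately show ?thesis using assms(1) by (simp add: region_def a_def)
  qed
  show "(s, z) \<in> region a R" if "s \<in> ball t (min 1 (Re t / 2))" for s
  proof -
    have d: "cmod (t - s) < 1" "cmod (t - s) < Re t / 2" using that by (auto simp: dist_norm)
    have "cmod s \<le> cmod t + 1" using d(1) norm_triangle_ineq2[of s t] by (simp add: norm_minus_commute)
    moreover have "Re t - Re s \<le> cmod (t - s)" using abs_Re_le_cmod[of "t - s"] by simp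
    ultimately have "cmod s \<le> R" "cmod z \<le> R" "a \<le> Re s"
      using d(2) norm_ge_zero[of z] norm_ge_zero[of t] unfolding R_def a_def by linarith+
    then show ?thesis by (simp add: region_def)
  qed
qed

lemma theta_summable:
  assumes "Re t > 0"
  shows "(\<lambda>m. cmod ((freq m) ^ j * b m * kern m t z)) summable_on UNIV"
proof -
  note r = region_ball(1,2)[OF assms, where z=z] region_ball(3)[OF assms]
  obtain A where A: "A summable_on UNIV" "\<And>t' z' m. (t', z') \<in> region (Re t / 2) (cmod t + cmod z + 1) \<Longrightarrow>
      cmod ((freq m) ^ j * b m * kern m t' z') \<le> A m"
    by (rule theta_term_bound[OF r(3)]) (rule that)
  show ?thesis
  proof (rule summable_on_comparison_test[OF A(1)])
    show "cmod ((freq m) ^ j * b m * kern m t z) \<le> A m" for m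
      by (rule A(2)[OF r(1)]) simp
  qed simp
qed

lemma theta_dz:
  assumes t: "Re t > 0"
  shows "(theta j t has_field_derivative theta (Suc j) t z) (at z)"
proof -
  note r = region_ball(1,2)[OF t, where z=z] region_ball(3)[OF t]
  let ?R = "region (Re t / 2) (cmod t + cmod z + 1)"
  obtain A where A: "A summable_on UNIV" "\<And>t z m. (t, z) \<in> ?R \<Longrightarrow>
      cmod ((freq m) ^ j * b m * kern m t z) \<le> A m"
    by (rule theta_term_bound[OF r(3)]) (rule that)
  obtain B where B: "B summable_on UNIV" "\<And>t z m. (t, z) \<in> ?R \<Longrightarrow>
      cmod ((freq m) ^ Suc j * b m * kern m t z) \<le> B m"
    by (rule theta_term_bound[OF r(3)]) (rule that)
  show ?thesis
    unfolding theta_def[abs_def]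
  proof (rule infsum_has_field_derivative[of "ball z 1" _ _ _ A B])
    show "cmod ((freq m) ^ j * b m * kern m t w) \<le> A m"
      "cmod ((freq m) ^ Suc j * b m * kern m t w) \<le> B m" if "w \<in> ball z 1" for m w
      using A(2) B(2) r(1)[OF that] by blast+
    show "((\<lambda>z. (freq m) ^ j * b m * kern m t z) has_field_derivative
        (freq m) ^ Suc j * b m * kern m t w) (at w)" for m w
      unfolding kern_def by (rule derivative_eq_intros refl | simp)+
  qed (use A B in auto)
qed

text \<open>Termwise differentiation brings down a quadratic polynomial in \<open>m\<close>; its two parts raise the number of \<open>z\<close>-derivatives by two and by one.\<close>

lemma theta_dt:
  assumes t: "Re t > 0"
  shows "((\<lambda>t. theta j t z) has_field_derivative
    of_real (k * N) * theta (Suc (Suc j)) t z - of_real N * (\<i> * t + of_real c) * theta (Suc j) t z) (at t)"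
proof -
  note r = region_ball(1,2)[OF t, where z=z] region_ball(3)[OF t]
  let ?R = "region (Re t / 2) (cmod t + cmod z + 1)"
  let ?f = "\<lambda>j m t z. (freq m) ^ j * b m * kern m t z"
  let ?f' = "\<lambda>m t. of_real (k * N) * ?f (Suc (Suc j)) m t z - of_real N * (\<i> * t + of_real c) * ?f (Suc j) m t z"
  let ?K = "N * (cmod t + cmod z + 1 + \<bar>c\<bar>)"
  obtain A where A: "A summable_on UNIV" "\<And>t z m. (t, z) \<in> ?R \<Longrightarrow> cmod (?f j m t z) \<le> A m"
    by (rule theta_term_bound[OF r(3)]) (rule that)
  obtain B where B: "B summable_on UNIV" "\<And>t z m. (t, z) \<in> ?R \<Longrightarrow> cmod (?f (Suc j) m t z) \<le> B m"
    by (rule theta_term_bound[OF r(3)]) (rule that)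
  obtain C where C: "C summable_on UNIV" "\<And>t z m. (t, z) \<in> ?R \<Longrightarrow> cmod (?f (Suc (Suc j)) m t z) \<le> C m"
    by (rule theta_term_bound[OF r(3)]) (rule that)
  have "((\<lambda>t. theta j t z) has_field_derivative (\<Sum>\<^sub>\<infinity>m. ?f' m t)) (at t)"
    unfolding theta_def
  proof (rule infsum_has_field_derivative[of "ball t (min 1 (Re t / 2))" _ _ _ A "\<lambda>m. k * N * C m + ?K * B m"])
    show "((\<lambda>t. ?f j m t z) has_field_derivative ?f' m s) (at s)" for m s
    proof -
      have "((\<lambda>t. ?f j m t z) has_field_derivative ?f j m s z *
          (- of_real (4 * pi\<^sup>2 * k * N * (of_int m)\<^sup>2) + of_int m * (of_real (pi * N) * (2 * s) - 2 * of_real pi * \<i> * of_real (N * c)))) (at s)"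
        unfolding kern_def by (rule derivative_eq_intros refl | simp)+
      moreover have "?f j m s z * (- of_real (4 * pi\<^sup>2 * k * N * (of_int m)\<^sup>2) + of_int m * (of_real (pi * N) * (2 * s) - 2 * of_real pi * \<i> * of_real (N * c)))
          = ?f' m s"
      proof -
        have i: "\<i> * (\<i> * y) = - y" for y by (simp add: mult.assoc[symmetric])
        show ?thesis by (simp add: algebra_simps power2_eq_square i)
      qed
      ultimately show ?thesis by simp
    qed
    show "cmod (?f j m s z) \<le> A m" if "s \<in> ball t (min 1 (Re t / 2))" for m s
      using A(2) r(2)[OF that] by blast
    show "cmod (?f' m s) \<le> k * N * C m + ?K * B m" if s: "s \<in> ball t (min 1 (Re t / 2))" for m s
    proof -
      have R: "(s, z) \<in> ?R" using r(2)[OF s] .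
      have "cmod (\<i> * s + of_real c) \<le> cmod t + cmod z + 1 + \<bar>c\<bar>"
        using R norm_triangle_ineq[of "\<i> * s" "of_real c"] by (simp add: region_def norm_mult)
      then have "cmod (of_real N * (\<i> * s + of_real c)) \<le> ?K"
        using N_pos by (simp add: norm_mult)
      then have "cmod (of_real N * (\<i> * s + of_real c) * ?f (Suc j) m s z) \<le> ?K * B m"
        unfolding norm_mult[of "of_real N * (\<i> * s + of_real c)"] using B(2)[OF R, of m]
        by (intro mult_mono) (auto intro: order_trans[OF norm_ge_zero])
      moreover have "cmod (of_real (k * N) * ?f (Suc (Suc j)) m s z) \<le> k * N * C m"
      proof -
        have "cmod (of_real (k * N)) = k * N" using k_pos N_pos by (simp add: norm_mult)
        then show ?thesis
          unfolding norm_mult[of "of_real (k * N)"] using C(2)[OF R, of m] k_pos N_pos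
          by (simp only: mult_left_mono mult_pos_pos less_imp_le)
      qed
      ultimately show ?thesis by (rule order_trans[OF norm_triangle_ineq4 add_mono, rotated])
    qed
    show "(\<lambda>m. k * N * C m + ?K * B m) summable_on UNIV"
      by (intro summable_on_add summable_on_cmult_right B C)
  qed (use A t in auto)
  moreover have "(\<Sum>\<^sub>\<infinity>m. ?f' m t) = of_real (k * N) * theta (Suc (Suc j)) t z - of_real N * (\<i> * t + of_real c) * theta (Suc j) t z"
  proof -
    have s: "(\<lambda>m. ?f j m t z) summable_on UNIV" for j
      by (rule abs_summable_summable[OF theta_summable[OF t]])
    have "(\<Sum>\<^sub>\<infinity>m. ?f' m t) = (\<Sum>\<^sub>\<infinity>m. of_real (k * N) * ?f (Suc (Suc j)) m t z + (- (of_real N * (\<i> * t + of_real c))) * ?f (Suc j) m t z)"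
      by simp
    also have "\<dots> = of_real (k * N) * theta (Suc (Suc j)) t z + (- (of_real N * (\<i> * t + of_real c))) * theta (Suc j) t z"
      unfolding theta_def using s[of "Suc (Suc j)"] s[of "Suc j"]
      by (subst infsum_add) (simp_all only: summable_on_cmult_right infsum_cmult_right')
    finally show ?thesis by simp
  qed
  ultimately show ?thesis by simp
qed

lemma continuous_kern: "continuous_on S (\<lambda>p. kern m (fst p) (snd p))"
  unfolding kern_def by (intro continuous_intros)

lemma continuous_theta:
  assumes "a > 0" shows "continuous_on (region a R) (\<lambda>p. theta j (fst p) (snd p))"
proof -
  obtain A where A: "A summable_on UNIV" "\<And>t z m. (t, z) \<in> region a R \<Longrightarrow>
      cmod ((freq m) ^ j * b m * kern m t z) \<le> A m"
    by (rule theta_term_bound[OF assms]) (rule that)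
  have "uniform_limit (region a R) (\<lambda>F p. \<Sum>m\<in>F. (freq m) ^ j * b m * kern m (fst p) (snd p))
      (\<lambda>p. theta j (fst p) (snd p)) (finite_subsets_at_top UNIV)"
    unfolding theta_def by (rule Weierstrass_m_test_general[OF _ A(1)]) (use A(2) in auto)
  then show ?thesis
    by (rule uniform_limit_theorem[rotated]) (auto intro!: always_eventually continuous_intros continuous_kern)
qed

lemma continuous_theta_real:
  "continuous_on ({0<..} \<times> UNIV) (\<lambda>(t, x). theta j (of_real t) (of_real x))"
proof -
  have "isCont (\<lambda>p. theta j (of_real (fst p)) (of_real (snd p))) q" if q: "q \<in> {0<..} \<times> UNIV" for q :: "real \<times> real"
  proof -
    define R where "R = \<bar>fst q\<bar> + \<bar>snd q\<bar> + 1"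
    define U where "U = {fst q / 2<..<R} \<times> {-R<..<R}"
    have U: "open U" "q \<in> U" using q by (auto simp: U_def R_def open_Times mem_Times_iff)
    define f where "f = (\<lambda>p :: real \<times> real. (complex_of_real (fst p), complex_of_real (snd p)))"
    have "continuous_on U f" unfolding f_def by (intro continuous_intros)
    moreover have "f ` U \<subseteq> region (fst q / 2) R" by (auto simp: f_def U_def region_def R_def)
    moreover have "fst q / 2 > 0" using q by auto
    ultimately have "continuous_on U (\<lambda>p. theta j (fst (f p)) (snd (f p)))"
      using continuous_on_compose2[OF continuous_theta] by blast
    then have "continuous_on U (\<lambda>p. theta j (of_real (fst p)) (of_real (snd p)))"
      by (simp only: f_def fst_conv snd_conv)
    then show ?thesis using U by (simp add: continuous_on_eq_continuous_at)
  qed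
  then show ?thesis unfolding split_beta by (intro continuous_at_imp_continuous_on) auto
qed

definition growth_factor :: "int \<Rightarrow> real \<Rightarrow> complex" where
  "growth_factor m t = kern m (of_real t) 0"

lemma kern_real: "kern m (of_real t) (of_real x) = growth_factor m t * emode m x"
  by (simp add: kern_def growth_factor_def emode_def cis_conv_exp exp_add[symmetric] algebra_simps)

definition mode_coeff :: "nat \<Rightarrow> real \<Rightarrow> int \<Rightarrow> complex" where
  "mode_coeff j t m = (freq m) ^ j * b m * growth_factor m t"

lemma theta_real: "theta j (of_real t) (of_real x) = (\<Sum>\<^sub>\<infinity>m. mode_coeff j t m * emode m x)"
  by (simp add: theta_def kern_real mode_coeff_def mult.assoc)

lemma norm_growth_factor: "cmod (growth_factor m t) = exp (pi * N * t * (of_int m * t - 4 * pi * k * (of_int m)\<^sup>2))"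
  by (simp add: growth_factor_def kern_def power2_eq_square algebra_simps flip: of_real_mult)

lemma growth_factor_0 [simp]: "growth_factor m 0 = 1" "growth_factor 0 t = 1"
  by (simp_all add: growth_factor_def kern_def)

lemma continuous_growth_factor: "continuous_on S (growth_factor m)"
  unfolding growth_factor_def[abs_def] kern_def by (intro continuous_intros)

lemma mode_coeff_summable:
  assumes "t > 0" shows "(\<lambda>m. cmod (mode_coeff j t m)) summable_on UNIV"
  using theta_summable[of "of_real t" j 0] assms by (simp add: mode_coeff_def growth_factor_def)

end

section \<open>Rescaling periodic functions\<close>

lemma has_integral_periodic_scale:
  fixes f :: "real \<Rightarrow> 'b::euclidean_space"
  assumes f: "(f has_integral I) {0..1}" and p: "periodic1 f" and n: "n \<ge> (1::nat)"
  shows "((\<lambda>x. f (real n * x)) has_integral I) {0..1}"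
proof -
  have piece: "((\<lambda>x. f (real n * x)) has_integral (1 / real n) *\<^sub>R I) {real j / real n..real (Suc j) / real n}" for j
  proof -
    have "((\<lambda>x. f (real n * x + - real j)) has_integral (1 / real n) *\<^sub>R I) {real j / real n..real (Suc j) / real n}"
      using has_integral_affinity'[of f I 0 1 "real n" "- real j"] f n
      by (simp add: divide_inverse add.commute mult.commute)
    moreover have "f (real n * x + - real j) = f (real n * x)" for x
      using periodic1_int[OF p, of "real n * x" "- int j"] by simp
    ultimately show ?thesis by simp
  qed
  have "((\<lambda>x. f (real n * x)) has_integral (real j / real n) *\<^sub>R I) {0..real j / real n}" for j
  proof (induction j)
    case (Suc j)
    have "((\<lambda>x. f (real n * x)) has_integral ((real j / real n) *\<^sub>R I + (1 / real n) *\<^sub>R I)) {0..real (Suc j) / real n}"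
      by (rule has_integral_combine[OF _ _ Suc piece]) (use n in \<open>auto simp: divide_right_mono\<close>)
    moreover have "(real j / real n) *\<^sub>R I + (1 / real n) *\<^sub>R I = (real (Suc j) / real n) *\<^sub>R I"
      by (simp add: scaleR_add_left[symmetric] add_divide_distrib add.commute)
    ultimately show ?case by simp
  next
    case 0
    have "((\<lambda>x. f (real n * x)) has_integral 0) {0..0}"
      unfolding cbox_interval[symmetric] by (rule has_integral_null) simp
    then show ?case by simp
  qed
  from this[of n] show ?thesis using n by simp
qed

lemma scale_integrable:
  fixes f :: "real \<Rightarrow> 'b::euclidean_space"
  assumes f: "integrable torus f" and p: "periodic1 f" and n: "n \<ge> (1::nat)"
  shows "integrable torus (\<lambda>x. f (real n * x))" "(LINT x|torus. f (real n * x)) = (LINT x|torus. f x)"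
proof -
  have ai: "g absolutely_integrable_on {0..1} \<longleftrightarrow> integrable torus g" for g :: "real \<Rightarrow> 'b"
    by (simp add: integrable_restrict_space set_integrable_def)
  have hf: "(f has_integral (LINT x|torus. f x)) {0..1}"
    by (rule has_integral_integral_lebesgue_on[OF f]) simp
  have "integrable torus (\<lambda>x. norm (f x))" using f by simp
  then have hn: "((\<lambda>x. norm (f x)) has_integral (LINT x|torus. norm (f x))) {0..1}"
    by (rule has_integral_integral_lebesgue_on) simp
  have pn: "periodic1 (\<lambda>x. norm (f x))" using p by (simp add: periodic1_def)
  note sf = has_integral_periodic_scale[OF hf p n] and sn = has_integral_periodic_scale[OF hn pn n]
  then have "(\<lambda>x. f (real n * x)) absolutely_integrable_on {0..1}"
    by (auto simp: absolutely_integrable_on_def)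
  then show i: "integrable torus (\<lambda>x. f (real n * x))" by (simp add: ai)
  show "(LINT x|torus. f (real n * x)) = (LINT x|torus. f x)"
    using LINT_torus_eq_integral[OF i] integral_unique[OF sf] by simp
qed

lemma scale_sq_int:
  assumes f: "sq_int f" and p: "periodic1 f" and n: "n \<ge> (1::nat)"
  shows "sq_int (\<lambda>x. f (real n * x))" "sqn (\<lambda>x. f (real n * x)) = sqn f"
proof -
  have "integrable torus (\<lambda>x. (cmod (f x))\<^sup>2)" using f by (simp add: sq_int_def)
  moreover have "periodic1 (\<lambda>x. (cmod (f x))\<^sup>2)" using p by (simp add: periodic1_def)
  ultimately have "integrable torus (\<lambda>x. (cmod (f (real n * x)))\<^sup>2)"
      "(LINT x|torus. (cmod (f (real n * x)))\<^sup>2) = (LINT x|torus. (cmod (f x))\<^sup>2)"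
    using scale_integrable[of "\<lambda>x. (cmod (f x))\<^sup>2" n] n by auto
  moreover have "integrable torus (\<lambda>x. f (real n * x))"
    using scale_integrable[OF sq_int_integrable[OF f] p n] by simp
  ultimately show "sq_int (\<lambda>x. f (real n * x))" "sqn (\<lambda>x. f (real n * x)) = sqn f"
    by (auto simp: sq_int_def sqn_def)
qed

lemma periodic_scale: "periodic1 f \<Longrightarrow> periodic1 (\<lambda>x. f (real n * x))"
  using periodic1_int[of f _ "int n"] by (simp add: periodic1_def ring_distribs)

lemma scale_AE_eq:
  assumes f: "sq_int f" "periodic1 f" and g: "sq_int g" "periodic1 g" and n: "n \<ge> (1::nat)"
    and eq: "AE x in torus. f x = g x"
  shows "AE x in torus. f (real n * x) = g (real n * x)"
proof -
  have d: "sq_int (\<lambda>x. f x - g x)" "periodic1 (\<lambda>x. f x - g x)" using f g by (auto intro: sq_int_diff periodic1_diff)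
  have "sqn (\<lambda>x. f x - g x) = sqn (\<lambda>x. 0)"
    by (rule sqn_cong) (use eq d in \<open>auto simp: sq_int_def elim: eventually_mono\<close>)
  then have "sqn (\<lambda>x. f (real n * x) - g (real n * x)) = 0"
    using scale_sq_int(2)[OF d n] by (simp add: sqn_def)
  then have "AE x in torus. f (real n * x) - g (real n * x) = 0"
    by (rule sqn_zero_imp_AE[OF scale_sq_int(1)[OF d n]])
  then show ?thesis by eventually_elim simp
qed

text \<open>The coefficients of \<open>f (n x)\<close> are those of \<open>f\<close>, moved from frequency \<open>m\<close> to \<open>n m\<close>. This is
  clear for partial sums and passes to the limit.\<close>

lemma scale_fc_tendsto:
  assumes f: "sq_int f" "periodic1 f" and n: "n \<ge> (1::nat)"
  shows "((\<lambda>F. \<Sum>m\<in>F. if int n * m = l then fc f m else 0) \<longlongrightarrow> fc (\<lambda>x. f (real n * x)) l) (finite_subsets_at_top UNIV)"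
proof -
  have e: "emode m (real n * x) = emode (int n * m) x" for m x
    by (simp add: emode_def mult_ac)
  have s: "sq_int (\<lambda>x. trig F (fc f) (real n * x))" for F
    by (intro scale_sq_int sq_int_trig periodic_trig n)
  have p: "periodic1 (\<lambda>x. trig F (fc f) x - f x)" for F
    by (intro periodic1_diff periodic_trig f)
  have "((\<lambda>F. LINT x|torus. trig F (fc f) (real n * x) * emode (- l) x) \<longlongrightarrow> (LINT x|torus. f (real n * x) * emode (- l) x)) (finite_subsets_at_top UNIV)"
  proof (rule tendsto_LINT_mult)
    have "sqn (\<lambda>x. trig F (fc f) (real n * x) - f (real n * x)) = sqn (\<lambda>x. trig F (fc f) x - f x)" for F
      using scale_sq_int(2)[OF sq_int_diff[OF sq_int_trig f(1)] p n] by simp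
    then show "((\<lambda>F. sqn (\<lambda>x. trig F (fc f) (real n * x) - f (real n * x))) \<longlongrightarrow> 0) (finite_subsets_at_top UNIV)"
      using Fourier_partial_sums_tendsto[OF f(1)] by simp
  qed (auto intro: s scale_sq_int f n sq_int_emode)
  moreover have "(LINT x|torus. trig F (fc f) (real n * x) * emode (- l) x) = (\<Sum>m\<in>F. if int n * m = l then fc f m else 0)" for F
  proof -
    have "(LINT x|torus. trig F (fc f) (real n * x) * emode (- l) x) = (LINT x|torus. (\<Sum>m\<in>F. fc f m * emode (int n * m - l) x))"
      by (simp add: trig_def e sum_distrib_right mult.assoc emode_mult)
    also have "\<dots> = (\<Sum>m\<in>F. LINT x|torus. fc f m * emode (int n * m - l) x)"
      by (intro Bochner_Integration.integral_sum) (auto intro!: sq_int_integrable sq_int_cmult sq_int_emode)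
    also have "\<dots> = (\<Sum>m\<in>F. if int n * m = l then fc f m else 0)"
      by (intro sum.cong) (auto simp: integral_emode)
    finally show ?thesis .
  qed
  ultimately show ?thesis by (simp add: fc_def mult.commute)
qed

lemma scale_H1_pair:
  assumes fg: "H1_pair f g" and p: "periodic1 f" "periodic1 g" and n: "n \<ge> (1::nat)"
  shows "H1_pair (\<lambda>x. f (real n * x)) (\<lambda>x. of_nat n * g (real n * x))"
proof -
  note f = H1_pairD[OF fg]
  have "fc (\<lambda>x. of_nat n * g (real n * x)) l = freq l * fc (\<lambda>x. f (real n * x)) l" for l
  proof (rule tendsto_unique[OF finite_subsets_at_top_neq_bot])
    show "((\<lambda>F. of_nat n * (\<Sum>m\<in>F. if int n * m = l then fc g m else 0)) \<longlongrightarrow> fc (\<lambda>x. of_nat n * g (real n * x)) l) (finite_subsets_at_top UNIV)"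
      unfolding fc_cmult by (intro tendsto_mult tendsto_const scale_fc_tendsto f p n)
    have "((\<lambda>F. (freq l) * (\<Sum>m\<in>F. if int n * m = l then fc f m else 0)) \<longlongrightarrow> freq l * fc (\<lambda>x. f (real n * x)) l) (finite_subsets_at_top UNIV)"
      by (intro tendsto_mult tendsto_const scale_fc_tendsto f p n)
    moreover have "(freq l) * (\<Sum>m\<in>F. if int n * m = l then fc f m else 0)
        = of_nat n * (\<Sum>m\<in>F. if int n * m = l then fc g m else 0)" for F
      unfolding sum_distrib_left by (intro sum.cong) (auto simp: f(3))
    ultimately show "((\<lambda>F. of_nat n * (\<Sum>m\<in>F. if int n * m = l then fc g m else 0)) \<longlongrightarrow> freq l * fc (\<lambda>x. f (real n * x)) l) (finite_subsets_at_top UNIV)"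
      by simp
  qed
  then show ?thesis
    unfolding H1_pair_def by (intro conjI allI scale_sq_int sq_int_cmult f p n) auto
qed

section \<open>Classical solutions are weak solutions\<close>

lemma periodic_test_H1_pairs:
  assumes "smooth2 \<phi>" "\<And>t. periodic1 (\<phi> t)"
  obtains \<phi>t \<phi>x \<phi>xx where
    "dt \<phi> = \<phi>t" "dx (dx \<phi>) = \<phi>xx"
    "continuous_on UNIV (\<lambda>(t, x). \<phi> t x)" "continuous_on UNIV (\<lambda>(t, x). \<phi>t t x)"
    "continuous_on UNIV (\<lambda>(t, x). \<phi>xx t x)"
    "\<And>t x. ((\<lambda>s. \<phi> s x) has_vector_derivative \<phi>t t x) (at t)"
    "\<And>t. H1_pair (\<phi> t) (\<phi>x t)" "\<And>t. H1_pair (\<phi>x t) (\<phi>xx t)"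
proof -
  obtain D where D: "D 0 0 = \<phi>" "\<And>m n. continuous_on UNIV (\<lambda>(t, x). D m n t x)"
    "\<And>m n t x. ((\<lambda>s. D m n s x) has_vector_derivative D (Suc m) n t x) (at t)"
    "\<And>m n t x. ((\<lambda>y. D m n t y) has_vector_derivative D m (Suc n) t x) (at x)"
    using assms(1) unfolding smooth2_def by blast
  have c: "continuous_on S (D m n t)" for S m n t
    using has_vector_derivative_continuous[OF D(4)[of m n t]]
    by (auto simp: continuous_on_eq_continuous_within intro: continuous_at_imp_continuous_within)
  have per: "D 0 n t (x + 1) = D 0 n t x" for n t x
  proof (induction n arbitrary: x)
    case 0
    then show ?case using assms(2)[of t] by (simp add: D(1) periodic1_def)
  next
    case (Suc n)
    have "((\<lambda>y. D 0 n t (y + 1)) has_vector_derivative D 0 (Suc n) t (x + 1)) (at x)"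
    proof -
      have "((\<lambda>y. y + 1) has_real_derivative 1) (at x)" by (auto intro!: derivative_eq_intros)
      then have "((\<lambda>y. y + 1) has_vector_derivative 1) (at x)"
        by (simp add: has_real_derivative_iff_has_vector_derivative)
      from vector_diff_chain_at[OF this D(4)[of 0 n t "x + 1"]] show ?thesis by (simp add: o_def)
    qed
    then have "(D 0 n t has_vector_derivative D 0 (Suc n) t (x + 1)) (at x)" by (simp add: Suc)
    then show ?case using D(4)[of 0 n t x] vector_derivative_unique_at by blast
  qed
  have pair: "H1_pair (D 0 n t) (D 0 (Suc n) t)" for n t
  proof (rule H1_pair_classical)
    show "(D 0 n t has_vector_derivative D 0 (Suc n) t x) (at x within {0..1})" for x
      using D(4) by (rule has_vector_derivative_at_within)
    show "D 0 n t 0 = D 0 n t 1" using per[of n t 0] by simp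
  qed (rule c)
  show ?thesis
  proof (rule that[of "D 1 0" "D 0 2" "D 0 1"])
    show "dt \<phi> = D 1 0" unfolding dt_def D(1)[symmetric] using D(3)[of 0 0] by (intro ext vector_derivative_at) simp
    have "dx \<phi> = D 0 1" unfolding dx_def D(1)[symmetric] using D(4)[of 0 0] by (intro ext vector_derivative_at) simp
    then show "dx (dx \<phi>) = D 0 2" unfolding dx_def[of "dx \<phi>"] using D(4)[of 0 1]
      by (intro ext vector_derivative_at) (simp add: numeral_2_eq_2)
    show "continuous_on UNIV (\<lambda>(t, x). \<phi> t x)" using D(2)[of 0 0] by (simp add: D(1))
    show "((\<lambda>s. \<phi> s x) has_vector_derivative D 1 0 t x) (at t)" for t x using D(3)[of 0 0 x t] by (simp add: D(1))
    show "H1_pair (\<phi> t) (D 0 1 t)" for t using pair[of 0 t] by (simp add: D(1))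
    show "H1_pair (D 0 1 t) (D 0 2 t)" for t using pair[of 1 t] by (simp add: numeral_2_eq_2)
  qed (rule D(2))+
qed

text \<open>Near \<open>t = 0\<close> the test function vanishes, so there the solution may be replaced by its value at a
  later time; all integrands become continuous on the closed rectangle.\<close>

lemma classical_imp_weak:
  fixes u ut ux uxx :: "real \<Rightarrow> real \<Rightarrow> complex"
  assumes T: "T > 0"
    and pair: "\<And>t. t \<in> {0<..T} \<Longrightarrow> H1_pair (u t) (ux t)" "\<And>t. t \<in> {0<..T} \<Longrightarrow> H1_pair (ux t) (uxx t)"
    and per: "\<And>t. t \<in> {0<..T} \<Longrightarrow> periodic1 (u t)" "\<And>t. t \<in> {0<..T} \<Longrightarrow> periodic1 (ux t)"
    and Dt: "\<And>t x. t \<in> {0<..T} \<Longrightarrow> ((\<lambda>s. u s x) has_vector_derivative ut t x) (at t)"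
    and cont: "continuous_on ({0<..T} \<times> UNIV) (\<lambda>(t, x). u t x)" "continuous_on ({0<..T} \<times> UNIV) (\<lambda>(t, x). ut t x)"
      "continuous_on ({0<..T} \<times> UNIV) (\<lambda>(t, x). ux t x)"
      "continuous_on ({0<..T} \<times> UNIV) (\<lambda>(t, x). uxx t x)"
    and pde: "\<And>t x. t \<in> {0<..T} \<Longrightarrow> ut t x + u t x * ux t x - of_real \<epsilon> * uxx t x = \<i>"
    and \<phi>: "test_function T \<phi>"
  shows "(LINT t|lebesgue_on {0..T}. LINT x|torus.
            - u t x * dt \<phi> t x + u t x * weak_deriv (u t) x * \<phi> t x - of_real \<epsilon> * u t x * dx (dx \<phi>) t x)
        = (LINT t|lebesgue_on {0..T}. LINT x|torus. \<i> * \<phi> t x)"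
proof -
  obtain c d where cd: "0 < c" "d < T" "\<And>t x. t \<notin> {c..d} \<Longrightarrow> \<phi> t x = 0"
    using \<phi> unfolding test_function_def by blast
  obtain \<phi>t \<phi>x \<phi>xx where P: "dt \<phi> = \<phi>t" "dx (dx \<phi>) = \<phi>xx"
    "continuous_on UNIV (\<lambda>(t, x). \<phi> t x)" "continuous_on UNIV (\<lambda>(t, x). \<phi>t t x)"
    "continuous_on UNIV (\<lambda>(t, x). \<phi>xx t x)"
    "\<And>t x. ((\<lambda>s. \<phi> s x) has_vector_derivative \<phi>t t x) (at t)"
    "\<And>t. H1_pair (\<phi> t) (\<phi>x t)" "\<And>t. H1_pair (\<phi>x t) (\<phi>xx t)"
    using \<phi> unfolding test_function_def by (elim conjE periodic_test_H1_pairs) auto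
  define \<delta> where "\<delta> = min c T / 2"
  have \<delta>: "0 < \<delta>" "\<delta> < c" "\<delta> < T" using cd T by (auto simp: \<delta>_def)
  have z: "\<phi> t x = 0" "\<phi>t t x = 0" "\<phi>xx t x = 0" if t: "t < c" for t x
  proof -
    show "\<phi> t x = 0" using cd(3) t by simp
    have "((\<lambda>s. \<phi> s x) has_vector_derivative 0) (at t)"
      by (rule has_vector_derivative_transform_within_open[of "\<lambda>_. 0" _ _ "{..<c}"]) (use t cd(3) in auto)
    then show "\<phi>t t x = 0" using P(6) vector_derivative_unique_at by blast
    have "\<phi> t = (\<lambda>x. 0)" using cd(3)[of t] t by auto
    then have "dx \<phi> t = (\<lambda>x. 0)" unfolding dx_def by simp
    then have "dx (dx \<phi>) t x = 0" unfolding dx_def[of "dx \<phi>"] by simp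
    then show "\<phi>xx t x = 0" by (simp add: P(2))
  qed
  have cs: "continuous_on S (f t)" if "continuous_on (A \<times> UNIV) (\<lambda>(t, x). f t x)" "t \<in> A" for f :: "real \<Rightarrow> real \<Rightarrow> complex" and A S t
  proof -
    have "continuous_on S (\<lambda>x. (\<lambda>(t, x). f t x) (t, x))"
      by (rule continuous_on_compose2[OF that(1)]) (use that(2) in \<open>auto intro!: continuous_intros\<close>)
    then show ?thesis by simp
  qed
  have cP: "continuous_on S (\<phi> t)" "continuous_on S (\<phi>t t)" "continuous_on S (\<phi>xx t)" for S t
    using P(3-5) by (auto intro!: cs[of UNIV])
  define m where "m t = max t \<delta>" for t
  have m: "m t \<in> {0<..T}" if "t \<in> {0..T}" for t using that \<delta> by (auto simp: m_def)
  have cm: "continuous_on ({0..T} \<times> {0..1}) (\<lambda>(t, x). f (m t) x)"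
    if "continuous_on ({0<..T} \<times> UNIV) (\<lambda>(t, x). f t x)" for f :: "real \<Rightarrow> real \<Rightarrow> complex"
  proof -
    have "continuous_on ({0..T} \<times> {0..1}) (\<lambda>p. (\<lambda>(t, x). f t x) (m (fst p), snd p))"
      by (rule continuous_on_compose2[OF that]) (use m in \<open>auto simp: m_def intro!: continuous_intros\<close>)
    then show ?thesis by (simp add: split_beta)
  qed
  have c\<phi>: "continuous_on ({0..T} \<times> {0..1}) (\<lambda>(t, x). \<phi> t x)" "continuous_on ({0..T} \<times> {0..1}) (\<lambda>(t, x). \<phi>t t x)"
    using P(3,4) continuous_on_subset by blast+
  define G where "G t = integral {0..1} (\<lambda>x. ut (m t) x * \<phi> t x + u (m t) x * \<phi>t t x)" for t
  define I where "I t = integral {0..1} (\<lambda>x. \<i> * \<phi> t x)" for t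
  have cG: "continuous_on {0..T} G"
    unfolding G_def cbox_interval[symmetric]
    by (rule integral_continuous_on_param)
       (use cm[OF cont(1)] cm[OF cont(2)] c\<phi> in \<open>auto simp: split_beta cbox_interval intro!: continuous_intros\<close>)
  have cI: "continuous_on {0..T} I"
    unfolding I_def cbox_interval[symmetric]
    by (rule integral_continuous_on_param)
       (use c\<phi> in \<open>auto simp: split_beta cbox_interval intro!: continuous_intros\<close>)
  have inner: "(LINT x|torus. - u t x * dt \<phi> t x + u t x * weak_deriv (u t) x * \<phi> t x - of_real \<epsilon> * u t x * dx (dx \<phi>) t x)
      = I t - G t" if t: "t \<in> {0..T}" for t
  proof (cases "t \<le> \<delta>")
    case True
    then have "t < c" using \<delta> by simp
    then show ?thesis by (simp add: z P(1,2) I_def G_def)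
  next
    case False
    then have t': "t \<in> {0<..T}" "m t = t" using t \<delta> by (auto simp: m_def)
    note cu = cs[OF cont(1) t'(1)] cs[OF cont(2) t'(1)] cs[OF cont(3) t'(1)] cs[OF cont(4) t'(1)]
    have wd: "AE x in torus. weak_deriv (u t) x = ux t x"
      by (intro weak_deriv_AE per pair t')
    have mw: "weak_deriv (u t) \<in> borel_measurable torus"
      using weak_deriv_H1_pair(1)[OF H1_torusI[OF per(1)[OF t'(1)] per(2)[OF t'(1)] pair(1)[OF t'(1)]]]
      by (simp add: H1_pair_def sq_int_def)
    have cc: "integrable torus (\<lambda>x. u t x * \<phi>xx t x)" "integrable torus (\<lambda>x. uxx t x * \<phi> t x)"
      "integrable torus (\<lambda>x. - u t x * \<phi>t t x + u t x * ux t x * \<phi> t x)"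
      by (intro continuous_integrable_torus continuous_intros cu cP)+
    have "(LINT x|torus. - u t x * dt \<phi> t x + u t x * weak_deriv (u t) x * \<phi> t x - of_real \<epsilon> * u t x * dx (dx \<phi>) t x)
        = (LINT x|torus. (- u t x * \<phi>t t x + u t x * ux t x * \<phi> t x) - of_real \<epsilon> * (u t x * \<phi>xx t x))"
      unfolding P(1,2)
    proof (rule integral_cong_AE)
      have mm: "u t \<in> borel_measurable torus" "ux t \<in> borel_measurable torus" "\<phi> t \<in> borel_measurable torus" "\<phi>t t \<in> borel_measurable torus" "\<phi>xx t \<in> borel_measurable torus"
        by (intro continuous_measurable_torus cu cP)+
      show "(\<lambda>x. - u t x * \<phi>t t x + u t x * weak_deriv (u t) x * \<phi> t x - of_real \<epsilon> * u t x * \<phi>xx t x) \<in> borel_measurable torus"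
        using mm mw by measurable
      show "(\<lambda>x. - u t x * \<phi>t t x + u t x * ux t x * \<phi> t x - of_real \<epsilon> * (u t x * \<phi>xx t x)) \<in> borel_measurable torus"
        using mm by measurable
    qed (use wd in \<open>auto elim!: eventually_mono\<close>)
    also have "\<dots> = (LINT x|torus. - u t x * \<phi>t t x + u t x * ux t x * \<phi> t x) - of_real \<epsilon> * (LINT x|torus. u t x * \<phi>xx t x)"
      using cc by (subst Bochner_Integration.integral_diff) (auto simp del: minus_mult_left)
    also have "(LINT x|torus. u t x * \<phi>xx t x) = (LINT x|torus. uxx t x * \<phi> t x)"
      using H1_pair_parts[OF pair(1)[OF t'(1)] P(8)[of t]] H1_pair_parts[OF pair(2)[OF t'(1)] P(7)[of t]] by simp
    also have "(LINT x|torus. - u t x * \<phi>t t x + u t x * ux t x * \<phi> t x) - of_real \<epsilon> * (LINT x|torus. uxx t x * \<phi> t x)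
        = (LINT x|torus. (- u t x * \<phi>t t x + u t x * ux t x * \<phi> t x) - of_real \<epsilon> * (uxx t x * \<phi> t x))"
      using cc by (subst Bochner_Integration.integral_diff) (auto simp del: minus_mult_left)
    also have "\<dots> = (LINT x|torus. \<i> * \<phi> t x - (ut (m t) x * \<phi> t x + u (m t) x * \<phi>t t x))"
    proof (rule Bochner_Integration.integral_cong)
      fix x
      have e: "\<i> = ut t x + u t x * ux t x - of_real \<epsilon> * uxx t x" using pde[OF t'(1)] by simp
      show "(- u t x * \<phi>t t x + u t x * ux t x * \<phi> t x) - of_real \<epsilon> * (uxx t x * \<phi> t x)
          = \<i> * \<phi> t x - (ut (m t) x * \<phi> t x + u (m t) x * \<phi>t t x)"
        unfolding t'(2) by (subst e) (simp add: algebra_simps)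
    qed simp
    also have "\<dots> = integral {0..1} (\<lambda>x. \<i> * \<phi> t x - (ut (m t) x * \<phi> t x + u (m t) x * \<phi>t t x))"
      unfolding t'(2) by (intro LINT_torus_eq_integral continuous_integrable_torus continuous_intros cu cP)
    also have "\<dots> = I t - G t"
      unfolding I_def G_def t'(2)
      by (intro Henstock_Kurzweil_Integration.integral_diff integrable_continuous_real continuous_intros cu cP)
    finally show ?thesis .
  qed
  have G0: "(G has_integral 0) {0..\<delta>}"
  proof (rule has_integral_is_0)
    show "G t = 0" if "t \<in> {0..\<delta>}" for t using z that \<delta> by (simp add: G_def)
  qed
  have G1: "(G has_integral (integral {0..1} (\<lambda>x. u T x * \<phi> T x) - integral {0..1} (\<lambda>x. u \<delta> x * \<phi> \<delta> x))) {\<delta>..T}"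
  proof (rule fundamental_theorem_of_calculus)
    fix t assume t: "t \<in> {\<delta>..T}"
    have "((\<lambda>t. integral (cbox 0 1) (\<lambda>x. u t x * \<phi> t x)) has_vector_derivative
        integral (cbox 0 1) (\<lambda>x. u t x * \<phi>t t x + ut t x * \<phi> t x)) (at t within {\<delta>..T})"
    proof (rule leibniz_rule_vector_derivative[OF _ _ _ t])
      show "((\<lambda>t. u t x * \<phi> t x) has_vector_derivative u s x * \<phi>t s x + ut s x * \<phi> s x) (at s within {\<delta>..T})"
        if "s \<in> {\<delta>..T}" for s x
        using that \<delta> by (intro has_vector_derivative_mult has_vector_derivative_at_within[OF Dt] has_vector_derivative_at_within[OF P(6)]) auto
      show "(\<lambda>x. u s x * \<phi> s x) integrable_on cbox 0 1" if "s \<in> {\<delta>..T}" for s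
        using that \<delta> by (intro integrable_continuous continuous_intros cs[OF cont(1)] cP) auto
      have sub: "{\<delta>..T} \<times> {0..1} \<subseteq> {0<..T} \<times> UNIV" using \<delta> by auto
      show "continuous_on ({\<delta>..T} \<times> cbox 0 1) (\<lambda>(s, x). u s x * \<phi>t s x + ut s x * \<phi> s x)"
        using continuous_on_subset[OF cont(1) sub] continuous_on_subset[OF cont(2) sub]
          continuous_on_subset[OF P(3), of "{\<delta>..T} \<times> {0..1}"] continuous_on_subset[OF P(4), of "{\<delta>..T} \<times> {0..1}"]
        by (auto simp: split_beta cbox_interval intro!: continuous_intros)
    qed simp
    moreover have "m t = t" using t by (simp add: m_def)
    ultimately show "((\<lambda>t. integral {0..1} (\<lambda>x. u t x * \<phi> t x)) has_vector_derivative G t) (at t within {\<delta>..T})"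
      by (simp add: G_def cbox_interval add.commute)
  qed (use \<delta> in auto)
  have "\<phi> T x = 0" "\<phi> \<delta> x = 0" for x using cd \<delta> by auto
  then have G1': "(G has_integral 0) {\<delta>..T}" using G1 by simp
  have "(G has_integral (0 + 0)) {0..T}" by (rule has_integral_combine[OF _ _ G0 G1']) (use \<delta> in auto)
  then have G: "integral {0..T} G = 0" by (simp add: integral_unique)
  have "(LINT t|lebesgue_on {0..T}. LINT x|torus. - u t x * dt \<phi> t x + u t x * weak_deriv (u t) x * \<phi> t x - of_real \<epsilon> * u t x * dx (dx \<phi>) t x)
      = (LINT t|lebesgue_on {0..T}. I t - G t)"
    by (rule Bochner_Integration.integral_cong) (simp_all only: inner space_lebesgue_on)
  also have "\<dots> = integral {0..T} (\<lambda>t. I t - G t)"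
    by (intro LINT_interval_eq_integral continuous_intros cI cG)
  also have "\<dots> = integral {0..T} I"
    using G integrable_continuous_real[OF cI] integrable_continuous_real[OF cG]
    by (simp add: Henstock_Kurzweil_Integration.integral_diff)
  also have "\<dots> = (LINT t|lebesgue_on {0..T}. I t)" by (rule LINT_interval_eq_integral[OF cI, symmetric])
  also have "\<dots> = (LINT t|lebesgue_on {0..T}. LINT x|torus. \<i> * \<phi> t x)"
    unfolding I_def
    by (intro Bochner_Integration.integral_cong refl LINT_torus_eq_integral[symmetric] continuous_integrable_torus continuous_intros cP)
  finally show ?thesis .
qed

section \<open>The Cole--Hopf solution\<close>

text \<open>The final time \<open>T\<close>, a bound \<open>M\<close> for all growth factors and a lower bound \<open>\<mu>\<close> for the potential are fixed. At \<open>t = 0\<close> the second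
derivative of the potential is only square integrable and its series need not converge pointwise, so a representative
\<open>h2\<close> is a separate parameter, together with the derivative of the initial quotient.\<close>

locale cole_hopf = heat_flow k N c b for k N c :: real and b :: "int \<Rightarrow> complex" +
  fixes T M \<mu> :: real and h2 :: "real \<Rightarrow> complex" and n :: nat
  assumes T_pos: "T > 0" and N_eq: "N = real n"
    and growth: "\<And>m t. t \<in> {0..T} \<Longrightarrow> cmod (growth_factor m t) \<le> M"
    and mu_pos: "\<mu> > 0"
    and theta_lower: "\<And>t x. t \<in> {0..T} \<Longrightarrow> \<mu> \<le> cmod (theta 0 (of_real t) (of_real x))"
    and b1_summable: "(\<lambda>m. cmod (freq m * b m)) summable_on UNIV"
    and h2_periodic: "periodic1 h2"
    and h2_pair: "H1_pair (\<lambda>x. theta 1 0 (of_real x)) h2"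
    and quot_pair: "H1_pair (\<lambda>x. theta 1 0 (of_real x) / theta 0 0 (of_real x))
        (\<lambda>x. h2 x / theta 0 0 (of_real x) - (theta 1 0 (of_real x) / theta 0 0 (of_real x))\<^sup>2)"
begin

text \<open>Restriction to real arguments: \<open>P\<close> for the potential and its derivatives, \<open>P2\<close> for its second derivative including the
initial time, \<open>q\<close> for the logarithmic derivative of the potential and \<open>r\<close> for the derivative of \<open>q\<close>. The solution is
\<open>u\<close>, with weak derivative \<open>w\<close>.\<close>

definition P :: "nat \<Rightarrow> real \<Rightarrow> real \<Rightarrow> complex" where
  "P j t x = theta j (of_real t) (of_real x)"

definition P2 :: "real \<Rightarrow> real \<Rightarrow> complex" where
  "P2 t x = (if t = 0 then h2 x else P 2 t x)"

definition q :: "real \<Rightarrow> real \<Rightarrow> complex" where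
  "q t x = P 1 t x / P 0 t x"

definition r :: "real \<Rightarrow> real \<Rightarrow> complex" where
  "r t x = P2 t x / P 0 t x - (q t x)\<^sup>2"

definition u :: "real \<Rightarrow> real \<Rightarrow> complex" where
  "u t x = \<i> * of_real t + of_real c - 2 * of_real k * q t (N * x)"

definition w :: "real \<Rightarrow> real \<Rightarrow> complex" where
  "w t x = - 2 * of_real k * (of_real N * r t (N * x))"

lemma n_ge_1: "n \<ge> 1"
  using N_pos N_eq by (cases n) auto

lemma M_ge_1: "M \<ge> 1"
  using growth[of 0 0] T_pos by simp

lemma P_nonzero: "t \<in> {0..T} \<Longrightarrow> P 0 t x \<noteq> 0"
  using theta_lower[of t x] mu_pos by (auto simp: P_def)

definition init_size :: "nat \<Rightarrow> int \<Rightarrow> real" where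
  "init_size j m = cmod ((freq m) ^ j * b m)"

lemma init_size_nonneg: "init_size j m \<ge> 0" by (simp add: init_size_def)

lemma init_size_summable: "j \<le> 1 \<Longrightarrow> init_size j summable_on UNIV"
  using b_summable b1_summable by (cases j) (auto simp: init_size_def[abs_def])

lemma mode_coeff_bound: "t \<in> {0..T} \<Longrightarrow> cmod (mode_coeff j t m) \<le> M * init_size j m"
  using growth[of t m] init_size_nonneg[of j m]
  by (simp add: mode_coeff_def init_size_def norm_mult mult.commute[of M] mult_left_mono)

lemma mode_coeff_summable_early:
  assumes "j \<le> 1" "t \<in> {0..T}" shows "(\<lambda>m. cmod (mode_coeff j t m)) summable_on UNIV"
  by (rule summable_on_comparison_test[OF summable_on_cmult_right[OF init_size_summable[OF assms(1)], of M]])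
     (auto intro: mode_coeff_bound assms)

lemma P_series: "P j t x = (\<Sum>\<^sub>\<infinity>m. mode_coeff j t m * emode m x)"
  by (simp add: P_def theta_real)

lemma P_periodic: "periodic1 (P j t)"
  by (simp add: periodic1_def P_series emode_periodic)

lemma P_regular:
  assumes "t \<in> {0..T}" "j \<le> 1 \<or> t > 0"
  shows "continuous_on S (P j t)" "fc (P j t) m = mode_coeff j t m"
proof -
  have s: "(\<lambda>m. cmod (mode_coeff j t m)) summable_on UNIV"
    using assms mode_coeff_summable mode_coeff_summable_early by auto
  have eq: "P j t = (\<lambda>x. \<Sum>\<^sub>\<infinity>m. mode_coeff j t m * emode m x)" by (auto simp: P_series)
  show "continuous_on S (P j t)" unfolding eq by (rule continuous_Fourier_series[OF s])
  show "fc (P j t) m = mode_coeff j t m" unfolding eq by (rule fc_Fourier_series[OF s])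
qed

definition theta_bound :: "nat \<Rightarrow> real" where
  "theta_bound j = M * (\<Sum>\<^sub>\<infinity>m. init_size j m)"

lemma P_bound:
  assumes "t \<in> {0..T}" "j \<le> 1" shows "cmod (P j t x) \<le> theta_bound j"
proof -
  note s = mode_coeff_summable_early[OF assms(2,1)]
  have "cmod (P j t x) \<le> (\<Sum>\<^sub>\<infinity>m. cmod (mode_coeff j t m))"
    unfolding P_series by (rule Fourier_series_bound[OF s])
  also have "\<dots> \<le> (\<Sum>\<^sub>\<infinity>m. M * init_size j m)"
    by (intro infsum_mono s summable_on_cmult_right init_size_summable assms mode_coeff_bound)
  also have "\<dots> = theta_bound j" by (simp add: theta_bound_def infsum_cmult_right')
  finally show ?thesis .
qed

lemma theta_bound_nonneg: "theta_bound j \<ge> 0"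
  using M_ge_1 by (auto simp: theta_bound_def intro!: mult_nonneg_nonneg infsum_nonneg init_size_nonneg)

text \<open>Continuity in time down to \<open>t = 0\<close>: the growth factors are continuous and bounded by \<open>M\<close>, so by dominated convergence it
suffices that the initial weights are summable.\<close>

lemma weighted_modulus_tendsto:
  assumes A: "A summable_on UNIV" "\<And>m. A m \<ge> 0" and t: "t \<in> {0..T}" and p: "p > 0"
  shows "((\<lambda>s. \<Sum>\<^sub>\<infinity>m. A m * cmod (growth_factor m s - growth_factor m t) ^ p) \<longlongrightarrow> 0) (at t within {0..T})"
proof -
  let ?f = "\<lambda>s. \<Sum>\<^sub>\<infinity>m. A m * cmod (growth_factor m s - growth_factor m t) ^ p"
  have "uniform_limit {0..T} (\<lambda>F s. \<Sum>m\<in>F. A m * cmod (growth_factor m s - growth_factor m t) ^ p) ?f (finite_subsets_at_top UNIV)"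
  proof (rule Weierstrass_m_test_general)
    show "(\<lambda>m. A m * (2 * M) ^ p) summable_on UNIV" by (rule summable_on_cmult_left[OF A(1)])
    show "norm (A m * cmod (growth_factor m s - growth_factor m t) ^ p) \<le> A m * (2 * M) ^ p" if "s \<in> {0..T}" for m s
    proof -
      have "cmod (growth_factor m s - growth_factor m t) \<le> 2 * M"
        using norm_triangle_ineq4[of "growth_factor m s" "growth_factor m t"] growth[OF that, of m] growth[OF t, of m] by linarith
      then have "cmod (growth_factor m s - growth_factor m t) ^ p \<le> (2 * M) ^ p" by (rule power_mono) simp
      then show ?thesis using A(2)[of m] by (simp add: abs_mult mult_left_mono)
    qed
  qed
  then have "continuous_on {0..T} ?f"
    by (rule uniform_limit_theorem[rotated]) (auto intro!: always_eventually continuous_intros continuous_growth_factor)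
  then have "(?f \<longlongrightarrow> ?f t) (at t within {0..T})" using t unfolding continuous_on_def by blast
  moreover have "?f t = 0" using p by (simp add: power_0_left)
  ultimately show ?thesis by simp
qed

definition modulus :: "nat \<Rightarrow> real \<Rightarrow> real \<Rightarrow> real" where
  "modulus j s t = (\<Sum>\<^sub>\<infinity>m. init_size j m * cmod (growth_factor m s - growth_factor m t) ^ 1)"

lemma modulus_tendsto: "j \<le> 1 \<Longrightarrow> t \<in> {0..T} \<Longrightarrow> ((\<lambda>s. modulus j s t) \<longlongrightarrow> 0) (at t within {0..T})"
  unfolding modulus_def by (rule weighted_modulus_tendsto) (auto intro: init_size_summable init_size_nonneg)

lemma P_modulus:
  assumes "j \<le> 1" "s \<in> {0..T}" "t \<in> {0..T}"
  shows "cmod (P j s x - P j t x) \<le> modulus j s t"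
proof -
  have cs: "(\<lambda>m. mode_coeff j r m * emode m x) summable_on UNIV" if "r \<in> {0..T}" for r
    by (rule abs_summable_summable) (use mode_coeff_summable_early[OF assms(1) that] in \<open>simp add: norm_mult\<close>)
  have d: "cmod (mode_coeff j s m - mode_coeff j t m) = init_size j m * cmod (growth_factor m s - growth_factor m t) ^ 1" for m
    by (simp add: mode_coeff_def init_size_def norm_mult[symmetric] right_diff_distrib)
  have sm: "(\<lambda>m. cmod (mode_coeff j s m - mode_coeff j t m)) summable_on UNIV"
    by (rule summable_on_comparison_test[OF summable_on_add[OF mode_coeff_summable_early[OF assms(1,2)] mode_coeff_summable_early[OF assms(1,3)]]])
       (auto intro: norm_triangle_ineq4)
  have "P j s x - P j t x = (\<Sum>\<^sub>\<infinity>m. mode_coeff j s m * emode m x + (- 1) * (mode_coeff j t m * emode m x))"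
    unfolding P_series by (subst infsum_add[OF cs summable_on_cmult_right[OF cs]]) (use assms in \<open>simp_all only: infsum_cmult_right'\<close>, simp)
  also have "\<dots> = (\<Sum>\<^sub>\<infinity>m. (mode_coeff j s m - mode_coeff j t m) * emode m x)"
    by (intro infsum_cong) (simp add: algebra_simps)
  also have "cmod \<dots> \<le> (\<Sum>\<^sub>\<infinity>m. cmod (mode_coeff j s m - mode_coeff j t m))"
    by (rule Fourier_series_bound[OF sm])
  also have "\<dots> = modulus j s t" by (simp only: d modulus_def)
  finally show ?thesis .
qed

lemma modulus_nonneg: "modulus j s t \<ge> 0"
  by (auto simp: modulus_def intro!: infsum_nonneg mult_nonneg_nonneg init_size_nonneg)

lemma P2_regular:
  assumes t: "t \<in> {0..T}"
  shows "sq_int (P2 t)" "periodic1 (P2 t)" "fc (P2 t) m = mode_coeff 2 t m"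
proof -
  have "sq_int (P2 t) \<and> periodic1 (P2 t) \<and> fc (P2 t) m = mode_coeff 2 t m"
  proof (cases "t = 0")
    case True
    have "fc (\<lambda>x. theta 1 0 (of_real x)) m = mode_coeff 1 0 m"
      using P_regular(2)[of 0 1 m] T_pos by (simp add: P_def[abs_def])
    then have "fc h2 m = mode_coeff 2 0 m"
      using H1_pairD(3)[OF h2_pair, of m] by (simp add: mode_coeff_def power2_eq_square)
    then show ?thesis
      using True H1_pairD(2)[OF h2_pair] h2_periodic by (simp add: P2_def[abs_def])
  next
    case False
    then have "t > 0" using t by simp
    then show ?thesis
      using P_regular[OF t, of 2] P_periodic[of 2 t] by (simp add: P2_def[abs_def] sq_int_continuous)
  qed
  then show "sq_int (P2 t)" "periodic1 (P2 t)" "fc (P2 t) m = mode_coeff 2 t m" by auto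
qed

text \<open>By Parseval's identity the distance in \<open>L\<^sup>2\<close> is a weighted sum of \<open>|g\<^sub>m(s) - g\<^sub>m(t)|\<^sup>2\<close> over the growth factors \<open>g\<^sub>m\<close>, with weights summable because \<open>h2\<close> is square integrable.\<close>

lemma P2_tendsto:
  assumes t: "t \<in> {0..T}"
  shows "((\<lambda>s. sqn (\<lambda>x. P2 s x - P2 t x)) \<longlongrightarrow> 0) (at t within {0..T})"
proof -
  have t0: "0 \<in> {0..T}" using T_pos by simp
  have "(\<lambda>m. (init_size 2 m)\<^sup>2) summable_on UNIV"
    using Parseval[OF P2_regular(1)[OF t0]] unfolding P2_regular(3)[OF t0]
    by (auto simp: mode_coeff_def init_size_def has_sum_imp_summable)
  then have lim: "((\<lambda>s. \<Sum>\<^sub>\<infinity>m. (init_size 2 m)\<^sup>2 * cmod (growth_factor m s - growth_factor m t) ^ 2) \<longlongrightarrow> 0) (at t within {0..T})"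
    by (rule weighted_modulus_tendsto) (use t in auto)
  have "sqn (\<lambda>x. P2 s x - P2 t x) = (\<Sum>\<^sub>\<infinity>m. (init_size 2 m)\<^sup>2 * cmod (growth_factor m s - growth_factor m t) ^ 2)"
    if s: "s \<in> {0..T}" for s
  proof -
    have "fc (\<lambda>x. P2 s x - P2 t x) m = mode_coeff 2 s m - mode_coeff 2 t m" for m
      using fc_diff[OF P2_regular(1)[OF s] P2_regular(1)[OF t], of m] P2_regular(3)[OF s, of m] P2_regular(3)[OF t, of m]
      by simp
    then have "(cmod (fc (\<lambda>x. P2 s x - P2 t x) m))\<^sup>2 = (init_size 2 m)\<^sup>2 * cmod (growth_factor m s - growth_factor m t) ^ 2" for m
      by (simp add: mode_coeff_def init_size_def norm_mult[symmetric] right_diff_distrib power_mult_distrib[symmetric])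
    then show ?thesis
      using infsumI[OF Parseval[OF sq_int_diff[OF P2_regular(1)[OF s] P2_regular(1)[OF t]]]] by simp
  qed
  then show ?thesis
    by (intro Lim_transform_eventually[OF lim])
       (auto simp: eventually_at_topological intro!: exI[of _ UNIV])
qed

end

lemma sqrt_sqn_bounded_mult:
  assumes f: "sq_int f" and h: "continuous_on {0..1} h" and B: "\<And>x. cmod (h x) \<le> B"
  shows "sq_int (\<lambda>x. h x * f x)" "sqrt (sqn (\<lambda>x. h x * f x)) \<le> B * sqrt (sqn f)"
proof -
  have b: "B \<ge> 0" using B[of 0] norm_ge_zero order_trans by blast
  have m: "h \<in> borel_measurable torus" "AE x in torus. cmod (h x) \<le> B"
    using B by (auto intro: continuous_measurable_torus h)
  show "sq_int (\<lambda>x. h x * f x)" by (rule sq_int_bounded_mult[OF f m])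
  have "sqrt (sqn (\<lambda>x. h x * f x)) \<le> sqrt (B\<^sup>2 * sqn f)"
    using sqn_bounded_mult[OF f m] by simp
  then show "sqrt (sqn (\<lambda>x. h x * f x)) \<le> B * sqrt (sqn f)" using b by (simp add: real_sqrt_mult)
qed

context cole_hopf
begin

lemma continuous_q: "t \<in> {0..T} \<Longrightarrow> continuous_on S (q t)"
  unfolding q_def[abs_def] by (intro continuous_on_divide P_regular P_nonzero ballI disjI1 order_refl) auto

lemma q_periodic: "periodic1 (q t)"
  using P_periodic[of 0 t] P_periodic[of 1 t] by (simp add: periodic1_def q_def)

lemma P_inverse_bound: "t \<in> {0..T} \<Longrightarrow> cmod (1 / P 0 t x) \<le> 1 / \<mu>"
  using theta_lower[of t x] mu_pos by (simp add: P_def norm_divide frac_le)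

lemma q_bound: assumes "t \<in> {0..T}" shows "cmod (q t x) \<le> theta_bound 1 / \<mu>"
proof -
  have "cmod (P 1 t x * (1 / P 0 t x)) \<le> theta_bound 1 * (1 / \<mu>)"
    unfolding norm_mult by (intro mult_mono P_bound P_inverse_bound assms theta_bound_nonneg) auto
  then show ?thesis by (simp add: q_def)
qed

lemma inverse_diff_bound:
  assumes "s \<in> {0..T}" "t \<in> {0..T}"
  shows "cmod (1 / P 0 s x - 1 / P 0 t x) \<le> modulus 0 s t / \<mu>\<^sup>2"
proof -
  have "1 / P 0 s x - 1 / P 0 t x = (P 0 t x - P 0 s x) * ((1 / P 0 s x) * (1 / P 0 t x))"
    using P_nonzero[OF assms(1)] P_nonzero[OF assms(2)] by (simp add: field_simps)
  also have "cmod \<dots> \<le> modulus 0 s t * ((1 / \<mu>) * (1 / \<mu>))"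
    unfolding norm_mult norm_minus_commute[of "P 0 t x"]
    by (intro mult_mono P_modulus P_inverse_bound assms modulus_nonneg) (use mu_pos in auto)
  finally show ?thesis by (simp add: power2_eq_square)
qed

definition quot_modulus :: "real \<Rightarrow> real \<Rightarrow> real" where
  "quot_modulus s t = modulus 1 s t * (1 / \<mu>) + theta_bound 1 * (modulus 0 s t / \<mu>\<^sup>2)"

lemma q_modulus:
  assumes "s \<in> {0..T}" "t \<in> {0..T}" shows "cmod (q s x - q t x) \<le> quot_modulus s t"
proof -
  have "q s x - q t x = (P 1 s x - P 1 t x) * (1 / P 0 s x) + P 1 t x * (1 / P 0 s x - 1 / P 0 t x)"
    by (simp add: q_def algebra_simps diff_divide_distrib)
  also have "cmod \<dots> \<le> modulus 1 s t * (1 / \<mu>) + theta_bound 1 * (modulus 0 s t / \<mu>\<^sup>2)"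
    by (rule norm_triangle_le, unfold norm_mult, intro add_mono mult_mono P_modulus P_inverse_bound P_bound
        inverse_diff_bound assms modulus_nonneg theta_bound_nonneg) auto
  finally show ?thesis by (simp add: quot_modulus_def)
qed

lemma quot_modulus_nonneg: "quot_modulus s t \<ge> 0"
  using modulus_nonneg theta_bound_nonneg mu_pos by (simp add: quot_modulus_def)

lemma quot_modulus_tendsto:
  assumes "t \<in> {0..T}" shows "((\<lambda>s. quot_modulus s t) \<longlongrightarrow> 0) (at t within {0..T})"
proof -
  have "((\<lambda>s. modulus 1 s t * (1 / \<mu>) + theta_bound 1 * (modulus 0 s t / \<mu>\<^sup>2)) \<longlongrightarrow> 0 * (1 / \<mu>) + theta_bound 1 * (0 / \<mu>\<^sup>2)) (at t within {0..T})"
    using mu_pos by (intro tendsto_intros modulus_tendsto assms) auto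
  then show ?thesis by (simp add: quot_modulus_def)
qed

lemma r_regular:
  assumes t: "t \<in> {0..T}" shows "sq_int (r t)" "periodic1 (r t)"
proof -
  have "sq_int (\<lambda>x. (1 / P 0 t x) * P2 t x)"
    by (rule sqrt_sqn_bounded_mult[OF P2_regular(1)[OF t] _ P_inverse_bound[OF t]])
       (intro continuous_on_divide continuous_intros P_regular t, auto simp: P_nonzero[OF t, simplified])
  moreover have "sq_int (\<lambda>x. (q t x)\<^sup>2)" by (intro sq_int_continuous continuous_intros continuous_q t)
  ultimately show "sq_int (r t)" using sq_int_diff unfolding r_def[abs_def] by fastforce
  show "periodic1 (r t)"
    using P2_regular(2)[OF t] P_periodic[of 0 t] q_periodic[of t] by (simp add: periodic1_def r_def)
qed

text \<open>Split the difference so that in each part one factor is uniformly bounded and the other tends to zero, either in \<open>L\<^sup>2\<close> or uniformly.\<close>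

lemma r_tendsto:
  assumes t: "t \<in> {0..T}"
  shows "((\<lambda>s. sqn (\<lambda>x. r s x - r t x)) \<longlongrightarrow> 0) (at t within {0..T})"
proof -
  let ?B = "\<lambda>s. (1 / \<mu>) * sqrt (sqn (\<lambda>x. P2 s x - P2 t x)) + modulus 0 s t / \<mu>\<^sup>2 * sqrt (sqn (P2 t))
      + quot_modulus s t * (2 * (theta_bound 1 / \<mu>))"
  have bound: "sqn (\<lambda>x. r s x - r t x) \<le> (?B s)\<^sup>2" if s: "s \<in> {0..T}" for s
  proof -
    let ?f = "\<lambda>x. (1 / P 0 s x) * (P2 s x - P2 t x)"
    let ?g = "\<lambda>x. (1 / P 0 s x - 1 / P 0 t x) * P2 t x"
    let ?h = "\<lambda>x. - ((q s x - q t x) * (q s x + q t x))"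
    have ci: "continuous_on S (\<lambda>x. 1 / P 0 a x)" if "a \<in> {0..T}" for a S
      using P_nonzero[OF that] by (intro continuous_on_divide continuous_intros P_regular that) auto
    have f: "sq_int ?f" "sqrt (sqn ?f) \<le> (1 / \<mu>) * sqrt (sqn (\<lambda>x. P2 s x - P2 t x))"
      by (rule sqrt_sqn_bounded_mult[OF sq_int_diff[OF P2_regular(1)[OF s] P2_regular(1)[OF t]] ci[OF s] P_inverse_bound[OF s]])+
    have g: "sq_int ?g" "sqrt (sqn ?g) \<le> modulus 0 s t / \<mu>\<^sup>2 * sqrt (sqn (P2 t))"
      by (rule sqrt_sqn_bounded_mult[OF P2_regular(1)[OF t] continuous_on_diff[OF ci[OF s] ci[OF t]] inverse_diff_bound[OF s t]])+
    have h: "sq_int ?h" by (intro sq_int_continuous continuous_intros continuous_q s t)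
    have "sqn ?h \<le> (quot_modulus s t * (2 * (theta_bound 1 / \<mu>)))\<^sup>2"
    proof (rule sqn_bounded[OF h], rule AE_I2)
      fix x
      have "cmod (q s x + q t x) \<le> 2 * (theta_bound 1 / \<mu>)"
        using norm_triangle_ineq[of "q s x" "q t x"] q_bound[OF s, of x] q_bound[OF t, of x] by simp
      then show "cmod (?h x) \<le> quot_modulus s t * (2 * (theta_bound 1 / \<mu>))"
        unfolding norm_minus_cancel norm_mult by (intro mult_mono q_modulus s t quot_modulus_nonneg) auto
    qed
    then have "sqrt (sqn ?h) \<le> quot_modulus s t * (2 * (theta_bound 1 / \<mu>))"
      using quot_modulus_nonneg theta_bound_nonneg mu_pos by (intro real_le_lsqrt) auto
    moreover have "(\<lambda>x. r s x - r t x) = (\<lambda>x. ?f x + ?g x + ?h x)"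
      by (rule ext) (simp add: r_def algebra_simps power2_eq_square diff_divide_distrib)
    moreover have "sqrt (sqn (\<lambda>x. ?f x + ?g x + ?h x)) \<le> sqrt (sqn ?f) + sqrt (sqn ?g) + sqrt (sqn ?h)"
      using sqn_triangle[OF sq_int_add[OF f(1) g(1)] h] sqn_triangle[OF f(1) g(1)] by linarith
    ultimately have "sqrt (sqn (\<lambda>x. r s x - r t x)) \<le> ?B s" using f(2) g(2) by (simp only:)
    then show ?thesis by (rule sqrt_le_D)
  qed
  have "((\<lambda>s. (?B s)\<^sup>2) \<longlongrightarrow> ((1 / \<mu>) * sqrt 0 + 0 / \<mu>\<^sup>2 * sqrt (sqn (P2 t)) + 0 * (2 * (theta_bound 1 / \<mu>)))\<^sup>2) (at t within {0..T})"
    by (intro tendsto_power tendsto_add tendsto_mult tendsto_const tendsto_divide tendsto_real_sqrt P2_tendsto modulus_tendsto quot_modulus_tendsto t)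
       (use mu_pos in auto)
  then have lim: "((\<lambda>s. (?B s)\<^sup>2) \<longlongrightarrow> 0) (at t within {0..T})" by simp
  show ?thesis
    by (rule Lim_null_comparison[OF _ lim])
       (use bound in \<open>auto simp: eventually_at_topological intro!: exI[of _ UNIV]\<close>)
qed

text \<open>The quotients \<open>A = \<theta>\<^sub>1 / \<theta>\<^sub>0\<close>, \<open>B = \<theta>\<^sub>2 / \<theta>\<^sub>0\<close>, \<open>C = \<theta>\<^sub>3 / \<theta>\<^sub>0\<close> turn all derivatives of
  the solution into polynomials, and the equation into a ring identity.\<close>

definition theta_quot :: "nat \<Rightarrow> complex \<Rightarrow> complex \<Rightarrow> complex" where
  "theta_quot j t z = theta j t z / theta 0 t z"

lemma theta_quot_dz:
  assumes "Re t > 0" "theta 0 t z \<noteq> 0"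
  shows "(theta_quot j t has_field_derivative theta_quot (Suc j) t z - theta_quot j t z * theta_quot 1 t z) (at z)"
proof -
  have "(theta_quot j t has_field_derivative (theta (Suc j) t z * theta 0 t z - theta j t z * theta (Suc 0) t z) / (theta 0 t z * theta 0 t z)) (at z)"
    unfolding theta_quot_def[abs_def] by (rule DERIV_divide[OF theta_dz[OF assms(1)] theta_dz[OF assms(1)] assms(2)])
  moreover have "(theta (Suc j) t z * theta 0 t z - theta j t z * theta (Suc 0) t z) / (theta 0 t z * theta 0 t z) = theta_quot (Suc j) t z - theta_quot j t z * theta_quot 1 t z"
    using assms(2) by (simp add: theta_quot_def field_simps)
  ultimately show ?thesis by simp
qed

lemma theta_quot1_dt:
  assumes "Re t > 0" "theta 0 t z \<noteq> 0"
  shows "((\<lambda>t. theta_quot 1 t z) has_field_derivative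
    (of_real (k * N) * theta_quot 3 t z - of_real N * (\<i> * t + of_real c) * theta_quot 2 t z)
      - theta_quot 1 t z * (of_real (k * N) * theta_quot 2 t z - of_real N * (\<i> * t + of_real c) * theta_quot 1 t z)) (at t)"
proof -
  let ?d = "\<lambda>j. of_real (k * N) * theta (Suc (Suc j)) t z - of_real N * (\<i> * t + of_real c) * theta (Suc j) t z"
  have "((\<lambda>t. theta_quot 1 t z) has_field_derivative (?d 1 * theta 0 t z - theta 1 t z * ?d 0) / (theta 0 t z * theta 0 t z)) (at t)"
    unfolding theta_quot_def by (rule DERIV_divide[OF theta_dt[OF assms(1)] theta_dt[OF assms(1)] assms(2)])
  moreover have "(?d 1 * theta 0 t z - theta 1 t z * ?d 0) / (theta 0 t z * theta 0 t z)
      = (of_real (k * N) * theta_quot 3 t z - of_real N * (\<i> * t + of_real c) * theta_quot 2 t z)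
      - theta_quot 1 t z * (of_real (k * N) * theta_quot 2 t z - of_real N * (\<i> * t + of_real c) * theta_quot 1 t z)"
  proof -
    have "(X3 * y - X1 * X2) / (y * y) = X3 / y - X1 / y * (X2 / y)" if "y \<noteq> 0" for X1 X2 X3 y :: complex
      using that by (simp add: field_simps)
    from this[OF assms(2), of "?d 1" "theta 1 t z" "?d 0"] show ?thesis
      by (simp add: theta_quot_def diff_divide_distrib numeral_2_eq_2 numeral_3_eq_3)
  qed
  ultimately show ?thesis by simp
qed

lemma q_theta_quot: "q t x = theta_quot 1 (of_real t) (of_real x)"
  by (simp add: q_def P_def theta_quot_def)

lemma theta_quot_dx:
  assumes "t \<in> {0<..T}"
  shows "((\<lambda>x. theta_quot j (of_real t) (of_real (N * x))) has_vector_derivative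
    of_real N * (theta_quot (Suc j) (of_real t) (of_real (N * x)) - theta_quot j (of_real t) (of_real (N * x)) * theta_quot 1 (of_real t) (of_real (N * x)))) (at x within S)"
proof -
  have nz: "theta 0 (of_real t) (of_real (N * x)) \<noteq> 0" using P_nonzero[of t "N * x"] assms by (simp add: P_def)
  have "((\<lambda>x. theta_quot j (of_real t) (of_real N * x)) has_field_derivative
      (theta_quot (Suc j) (of_real t) (of_real N * of_real x) - theta_quot j (of_real t) (of_real N * of_real x) * theta_quot 1 (of_real t) (of_real N * of_real x)) * of_real N) (at (of_real x))"
  proof (rule DERIV_chain2[where f = "theta_quot j (of_real t)" and g = "\<lambda>z. of_real N * z"])
    show "(theta_quot j (of_real t) has_field_derivative theta_quot (Suc j) (of_real t) (of_real N * of_real x) - theta_quot j (of_real t) (of_real N * of_real x) * theta_quot 1 (of_real t) (of_real N * of_real x)) (at (of_real N * of_real x))"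
      by (rule theta_quot_dz) (use nz assms in auto)
    show "((\<lambda>z. complex_of_real N * z) has_field_derivative of_real N) (at (of_real x))"
      by (auto intro!: derivative_eq_intros)
  qed
  from has_vector_derivative_at_within[OF has_vector_derivative_real_field[OF this]] show ?thesis
    by (simp add: mult.commute[of "complex_of_real N" "_ - _"])
qed

lemma continuous_theta_quot:
  "continuous_on ({0<..T} \<times> UNIV) (\<lambda>(t, x). theta_quot j (of_real t) (of_real (N * x)))"
proof -
  have c: "continuous_on ({0<..T} \<times> UNIV) (\<lambda>p. theta j (of_real (fst p)) (of_real (N * snd p)))" for j
  proof -
    have "continuous_on ({0<..T} \<times> UNIV) (\<lambda>p. (\<lambda>(t, x). theta j (of_real t) (of_real x)) (fst p, N * snd p))"
      by (rule continuous_on_compose2[OF continuous_theta_real]) (auto intro!: continuous_intros)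
    then show ?thesis by simp
  qed
  show ?thesis
    unfolding split_beta theta_quot_def
    by (intro continuous_on_divide c) (use P_nonzero in \<open>auto simp: P_def simp del: of_real_mult\<close>)
qed

lemma q_r_pair:
  assumes t: "t \<in> {0..T}" shows "H1_pair (q t) (r t)"
proof (cases "t = 0")
  case True
  then show ?thesis
    using quot_pair by (simp add: q_def[abs_def] r_def[abs_def] P_def P2_def)
next
  case False
  then have t: "t > 0" "t \<in> {0..T}" using t by auto
  show ?thesis
  proof (rule H1_pair_classical)
    fix x
    have nz: "theta 0 (of_real t) (of_real x) \<noteq> 0" using P_nonzero[OF t(2), of x] by (simp add: P_def)
    have "(theta_quot 1 (of_real t) has_field_derivative theta_quot (Suc 1) (of_real t) (of_real x) - theta_quot 1 (of_real t) (of_real x) * theta_quot 1 (of_real t) (of_real x)) (at (of_real x))"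
      by (rule theta_quot_dz) (use nz t in auto)
    from has_vector_derivative_at_within[OF has_vector_derivative_real_field[OF this]]
    show "(q t has_vector_derivative r t x) (at x within {0..1})"
      using False by (simp add: q_theta_quot[abs_def] r_def P2_def P_def theta_quot_def power2_eq_square numeral_2_eq_2)
  next
    have "continuous_on {0..1} (\<lambda>x. P 2 t x / P 0 t x - (q t x)\<^sup>2)"
      by (intro continuous_on_diff continuous_on_divide continuous_on_power continuous_q P_regular t ballI P_nonzero) (use t in auto)
    then show "continuous_on {0..1} (r t)" using False by (simp add: r_def[abs_def] P2_def)
    show "q t 0 = q t 1" using q_periodic[of t] unfolding periodic1_def by (metis add_0)
  qed
qed

lemma of_nat_n: "of_nat n = complex_of_real N"
  by (simp add: N_eq)

lemma u_w_pair:
  assumes t: "t \<in> {0..T}" shows "H1_pair (u t) (w t)"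
proof -
  have "H1_pair (\<lambda>x. \<i> * of_real t + of_real c) (\<lambda>x. 0)"
    by (rule H1_pair_classical) (auto intro!: derivative_eq_intros)
  moreover have "H1_pair (\<lambda>x. - 2 * of_real k * q t (real n * x)) (\<lambda>x. - 2 * of_real k * (of_nat n * r t (real n * x)))"
    by (intro H1_pair_cmult scale_H1_pair q_r_pair q_periodic r_regular t n_ge_1)
  ultimately have "H1_pair (\<lambda>x. (\<i> * of_real t + of_real c) + - 2 * of_real k * q t (real n * x)) (\<lambda>x. 0 + - 2 * of_real k * (of_nat n * r t (real n * x)))"
    by (rule H1_pair_add)
  then show ?thesis by (simp add: u_def[abs_def] w_def[abs_def] N_eq[symmetric] of_nat_n)
qed

lemma u_w_periodic: "periodic1 (u t)" "t \<in> {0..T} \<Longrightarrow> periodic1 (w t)"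
  using periodic_scale[OF q_periodic[of t], of n] periodic_scale[OF r_regular(2), of t n]
  by (auto simp: periodic1_def u_def w_def N_eq[symmetric])

lemma u_C0_H1: "C0_H1 T u"
proof (rule C0_H1I[OF u_w_periodic u_w_pair])
  fix t assume t: "t \<in> {0..T}"
  have cu: "continuous_on S (u s)" if "s \<in> {0..T}" for s S
    unfolding u_def[abs_def]
    by (intro continuous_intros continuous_on_compose2[OF continuous_q[OF that, of UNIV]]) auto
  show "((\<lambda>s. sqn (\<lambda>x. u s x - u t x)) \<longlongrightarrow> 0) (at t within {0..T})"
  proof (rule Lim_null_comparison)
    have "((\<lambda>s. (\<bar>s - t\<bar> + 2 * k * quot_modulus s t)\<^sup>2) \<longlongrightarrow> (\<bar>t - t\<bar> + 2 * k * 0)\<^sup>2) (at t within {0..T})"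
      by (intro tendsto_intros quot_modulus_tendsto t)
    then show "((\<lambda>s. (\<bar>s - t\<bar> + 2 * k * quot_modulus s t)\<^sup>2) \<longlongrightarrow> 0) (at t within {0..T})" by simp
    have "sqn (\<lambda>x. u s x - u t x) \<le> (\<bar>s - t\<bar> + 2 * k * quot_modulus s t)\<^sup>2" if s: "s \<in> {0..T}" for s
    proof (rule sqn_bounded, intro sq_int_diff sq_int_continuous cu s t, rule AE_I2)
      fix x
      have "u s x - u t x = \<i> * of_real (s - t) - 2 * of_real k * (q s (N * x) - q t (N * x))"
        by (simp add: u_def algebra_simps)
      also have "cmod \<dots> \<le> cmod (\<i> * of_real (s - t)) + cmod (2 * of_real k * (q s (N * x) - q t (N * x)))"
        by (rule norm_triangle_ineq4)
      also have "\<dots> \<le> \<bar>s - t\<bar> + 2 * k * quot_modulus s t"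
      proof (intro add_mono)
        have "cmod (2 * of_real k * (q s (N * x) - q t (N * x))) = 2 * k * cmod (q s (N * x) - q t (N * x))"
          using k_pos by (simp add: norm_mult)
        also have "\<dots> \<le> 2 * k * quot_modulus s t" using k_pos by (intro mult_left_mono q_modulus s t) auto
        finally show "cmod (2 * of_real k * (q s (N * x) - q t (N * x))) \<le> 2 * k * quot_modulus s t" .
        show "cmod (\<i> * of_real (s - t)) \<le> \<bar>s - t\<bar>" by (simp add: norm_mult del: of_real_diff)
      qed
      finally show "cmod (u s x - u t x) \<le> \<bar>s - t\<bar> + 2 * k * quot_modulus s t" .
    qed
    then show "\<forall>\<^sub>F s in at t within {0..T}. norm (sqn (\<lambda>x. u s x - u t x)) \<le> (\<bar>s - t\<bar> + 2 * k * quot_modulus s t)\<^sup>2"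
      by (auto simp: eventually_at_topological intro!: exI[of _ UNIV])
  qed
  show "((\<lambda>s. sqn (\<lambda>x. w s x - w t x)) \<longlongrightarrow> 0) (at t within {0..T})"
  proof (rule Lim_transform_eventually)
    show "((\<lambda>s. (2 * k * N)\<^sup>2 * sqn (\<lambda>x. r s x - r t x)) \<longlongrightarrow> 0) (at t within {0..T})"
      by (rule tendsto_mult_right_zero[OF r_tendsto[OF t]])
    have "(2 * k * N)\<^sup>2 * sqn (\<lambda>x. r s x - r t x) = sqn (\<lambda>x. w s x - w t x)" if s: "s \<in> {0..T}" for s
    proof -
      have "(\<lambda>x. w s x - w t x) = (\<lambda>x. (- 2 * of_real k * of_real N) * (r s (real n * x) - r t (real n * x)))"
        by (rule ext) (simp add: w_def N_eq[symmetric] algebra_simps)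
      then have "sqn (\<lambda>x. w s x - w t x) = (cmod (- 2 * of_real k * of_real N))\<^sup>2 * sqn (\<lambda>x. r s (real n * x) - r t (real n * x))"
        by (simp only: sqn_cmult)
      also have "sqn (\<lambda>x. r s (real n * x) - r t (real n * x)) = sqn (\<lambda>x. r s x - r t x)"
        by (rule scale_sq_int(2)[OF sq_int_diff periodic1_diff n_ge_1]) (intro r_regular s t)+
      finally show ?thesis by (simp add: norm_mult power_mult_distrib)
    qed
    then show "\<forall>\<^sub>F s in at t within {0..T}. (2 * k * N)\<^sup>2 * sqn (\<lambda>x. r s x - r t x) = sqn (\<lambda>x. w s x - w t x)"
      by (auto simp: eventually_at_topological intro!: exI[of _ UNIV])
  qed
qed auto

theorem u_burgers_solution:
  assumes "AE x in torus. u 0 x = u0 x"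
  shows "burgers_solution (k / N) T u0 u"
  unfolding burgers_solution_def
proof (intro conjI allI impI u_C0_H1 assms)
  fix \<phi> assume \<phi>: "test_function T \<phi>"
  let ?A = "\<lambda>t x. theta_quot 1 (of_real t) (of_real (N * x))"
  let ?B = "\<lambda>t x. theta_quot 2 (of_real t) (of_real (N * x))"
  let ?C = "\<lambda>t x. theta_quot 3 (of_real t) (of_real (N * x))"
  let ?K = "complex_of_real k" and ?N = "complex_of_real N"
  let ?v = "\<lambda>t :: real. \<i> * of_real t + complex_of_real c"
  define ux where "ux t x = - 2 * ?K * (?N * (?B t x - ?A t x * ?A t x))" for t x
  define uxx where "uxx t x = - 2 * ?K * (?N * (?N * (?C t x - ?B t x * ?A t x)
      - (?A t x * (?N * (?B t x - ?A t x * ?A t x)) + (?N * (?B t x - ?A t x * ?A t x)) * ?A t x)))" for t x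
  define ut where "ut t x = \<i> - 2 * ?K * ((of_real (k * N) * ?C t x - ?N * ?v t * ?B t x)
      - ?A t x * (of_real (k * N) * ?B t x - ?N * ?v t * ?A t x))" for t x
  have ueq: "u t x = ?v t - 2 * ?K * ?A t x" for t x by (simp add: u_def q_theta_quot)
  note cA = continuous_theta_quot[of 1] and cB = continuous_theta_quot[of 2] and cC = continuous_theta_quot[of 3]
  have cont: "continuous_on ({0<..T} \<times> UNIV) (\<lambda>(t, x). u t x)" "continuous_on ({0<..T} \<times> UNIV) (\<lambda>(t, x). ut t x)"
      "continuous_on ({0<..T} \<times> UNIV) (\<lambda>(t, x). ux t x)" "continuous_on ({0<..T} \<times> UNIV) (\<lambda>(t, x). uxx t x)"
    using cA cB cC unfolding ueq ux_def uxx_def ut_def split_beta by (auto intro!: continuous_intros)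
  have cs: "continuous_on S (f t)" if "continuous_on ({0<..T} \<times> UNIV) (\<lambda>(t, x). f t x)" "t \<in> {0<..T}" for f :: "real \<Rightarrow> real \<Rightarrow> complex" and S t
  proof -
    have "continuous_on S (\<lambda>x. (\<lambda>(t, x). f t x) (t, x))"
      by (rule continuous_on_compose2[OF that(1)]) (use that(2) in \<open>auto intro!: continuous_intros\<close>)
    then show ?thesis by simp
  qed
  have QP: "theta_quot j (of_real t) (of_real (N * (x + 1))) = theta_quot j (of_real t) (of_real (N * x))" for j t x
    using periodic_scale[OF P_periodic[of j t], of n] periodic_scale[OF P_periodic[of 0 t], of n]
    by (simp add: periodic1_def theta_quot_def P_def N_eq[symmetric] del: of_real_mult of_real_add)
  have DA: "(?A t has_vector_derivative ?N * (?B t x - ?A t x * ?A t x)) (at x within S)" if "t \<in> {0<..T}" for t x S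
    using theta_quot_dx[OF that, of 1 x S] by (simp add: numeral_2_eq_2)
  have DB: "(?B t has_vector_derivative ?N * (?C t x - ?B t x * ?A t x)) (at x within S)" if "t \<in> {0<..T}" for t x S
    using theta_quot_dx[OF that, of 2 x S] by (simp add: numeral_3_eq_3 numeral_2_eq_2)
  show "(LINT t|lebesgue_on {0..T}. LINT x|torus.
            - u t x * dt \<phi> t x + u t x * weak_deriv (u t) x * \<phi> t x - of_real (k / N) * u t x * dx (dx \<phi>) t x)
        = (LINT t|lebesgue_on {0..T}. LINT x|torus. \<i> * \<phi> t x)"
  proof (rule classical_imp_weak[OF T_pos _ _ _ _ _ cont _ \<phi>])
    fix t assume t: "t \<in> {0<..T}"
    show "periodic1 (u t)" by (rule u_w_periodic)
    show "periodic1 (ux t)" unfolding periodic1_def ux_def QP by simp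
    show "H1_pair (u t) (ux t)"
    proof (rule H1_pair_classical)
      show "(u t has_vector_derivative ux t x) (at x within {0..1})" for x
        unfolding ueq ux_def
        using has_vector_derivative_diff[OF has_vector_derivative_const[of "?v t"] has_vector_derivative_mult_right[OF DA[OF t], of "2 * ?K"]]
        by simp
      show "u t 0 = u t 1" using u_w_periodic(1)[of t] unfolding periodic1_def by (metis add_0)
    qed (rule cs[OF cont(3) t])
    show "H1_pair (ux t) (uxx t)"
    proof (rule H1_pair_classical)
      show "(ux t has_vector_derivative uxx t x) (at x within {0..1})" for x
        unfolding ux_def uxx_def
        by (intro has_vector_derivative_mult_right has_vector_derivative_diff has_vector_derivative_mult DA DB t)
      show "ux t 0 = ux t 1" using QP[of _ t 0] by (simp add: ux_def)
    qed (rule cs[OF cont(4) t])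
    fix x
    have nz: "theta 0 (of_real t) (of_real (N * x)) \<noteq> 0" using P_nonzero[of t "N * x"] t by (simp add: P_def)
    have "((\<lambda>s. theta_quot 1 s (of_real (N * x))) has_field_derivative
        ((of_real (k * N) * ?C t x - ?N * ?v t * ?B t x) - ?A t x * (of_real (k * N) * ?B t x - ?N * ?v t * ?A t x))) (at (of_real t))"
      by (rule theta_quot1_dt) (use nz t in auto)
    from has_vector_derivative_real_field[OF this]
    have "((\<lambda>s. ?A s x) has_vector_derivative
        ((of_real (k * N) * ?C t x - ?N * ?v t * ?B t x) - ?A t x * (of_real (k * N) * ?B t x - ?N * ?v t * ?A t x))) (at t)" .
    moreover have "(?v has_vector_derivative \<i>) (at t)"
      by (auto intro!: derivative_eq_intros)
    ultimately show "((\<lambda>s. u s x) has_vector_derivative ut t x) (at t)"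
      unfolding ueq ut_def by (intro has_vector_derivative_diff has_vector_derivative_mult_right)
    have e: "complex_of_real (k / N) * (?N * y) = ?K * y" for y using N_pos by simp
    have "ut t x + u t x * ux t x - ?K * (- 2 * ?K * ((?N * (?C t x - ?B t x * ?A t x)
      - (?A t x * (?N * (?B t x - ?A t x * ?A t x)) + (?N * (?B t x - ?A t x * ?A t x)) * ?A t x)))) = \<i>"
      unfolding ueq ut_def ux_def of_real_mult by (simp add: algebra_simps)
    moreover have "complex_of_real (k / N) * uxx t x = ?K * (- 2 * ?K * ((?N * (?C t x - ?B t x * ?A t x)
      - (?A t x * (?N * (?B t x - ?A t x * ?A t x)) + (?N * (?B t x - ?A t x * ?A t x)) * ?A t x))))"
      unfolding uxx_def using N_pos by (simp add: field_simps)
    ultimately show "ut t x + u t x * ux t x - of_real (k / N) * uxx t x = \<i>" by simp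
  qed
qed

end

section \<open>Lower bound for the first mode\<close>

text \<open>By periodicity the integral of a holomorphic function over a period does not change when the
  line of integration is shifted in the imaginary direction.\<close>

lemma period_integral_shift:
  fixes f f' :: "complex \<Rightarrow> complex" and \<sigma> :: real
  assumes D: "\<And>x \<tau>. x \<in> {0..1} \<Longrightarrow> \<tau> \<in> {0..1} \<Longrightarrow>
      (f has_field_derivative f' (of_real x + \<i> * of_real (\<sigma> * \<tau>))) (at (of_real x + \<i> * of_real (\<sigma> * \<tau>)))"
    and c: "continuous_on ((\<lambda>(\<tau>, x). of_real x + \<i> * of_real (\<sigma> * \<tau>)) ` ({0..1} \<times> {0..1})) f'"
    and p: "\<And>z. f (z + 1) = f z"
  shows "integral {0..1} (\<lambda>x. f (of_real x + \<i> * of_real \<sigma>)) = integral {0..1} (\<lambda>x. f (of_real x))"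
proof -
  let ?z = "\<lambda>\<tau> x. complex_of_real x + \<i> * of_real (\<sigma> * \<tau>)"
  have cf: "continuous_on ((\<lambda>(\<tau>, x). ?z \<tau> x) ` ({0..1} \<times> {0..1})) f"
    by (intro continuous_at_imp_continuous_on ballI) (use DERIV_isCont[OF D] in auto)
  have cx: "continuous_on {0..1} (\<lambda>x. g (?z \<tau> x))" if "\<tau> \<in> {0..1}"
    "continuous_on ((\<lambda>(\<tau>, x). ?z \<tau> x) ` ({0..1} \<times> {0..1})) g" for g \<tau>
    by (rule continuous_on_compose2[OF that(2)]) (use that(1) in \<open>auto intro!: continuous_intros\<close>)
  have Dt: "((\<lambda>\<tau>. f (?z \<tau> x)) has_vector_derivative (\<i> * of_real \<sigma>) * f' (?z \<tau> x)) (at \<tau> within {0..1})"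
    if "\<tau> \<in> {0..1}" "x \<in> {0..1}" for \<tau> x
  proof -
    have "((\<lambda>w. f (of_real x + \<i> * of_real \<sigma> * w)) has_field_derivative f' (of_real x + \<i> * of_real \<sigma> * of_real \<tau>) * (\<i> * of_real \<sigma>)) (at (of_real \<tau>))"
    proof (rule DERIV_chain2[where f=f and g="\<lambda>w. of_real x + \<i> * of_real \<sigma> * w"])
      show "(f has_field_derivative f' (of_real x + \<i> * of_real \<sigma> * of_real \<tau>)) (at (of_real x + \<i> * of_real \<sigma> * of_real \<tau>))"
        using D[OF that(2,1)] by (simp add: mult.assoc)
    qed (auto intro!: derivative_eq_intros)
    from has_vector_derivative_at_within[OF has_vector_derivative_real_field[OF this]] show ?thesis
      by (simp add: mult_ac)
  qed
  have Dx: "((\<lambda>x. f (?z \<tau> x)) has_vector_derivative f' (?z \<tau> x)) (at x within {0..1})"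
    if "\<tau> \<in> {0..1}" "x \<in> {0..1}" for \<tau> x
  proof -
    have "((\<lambda>w. f (w + \<i> * of_real (\<sigma> * \<tau>))) has_field_derivative f' (of_real x + \<i> * of_real (\<sigma> * \<tau>)) * 1) (at (of_real x))"
      by (rule DERIV_chain2[where f=f and g="\<lambda>w. w + \<i> * of_real (\<sigma> * \<tau>)"], rule D[OF that(2,1)])
         (auto intro!: derivative_eq_intros)
    from has_vector_derivative_at_within[OF has_vector_derivative_real_field[OF this]] show ?thesis by simp
  qed
  have zero: "integral (cbox 0 1) (\<lambda>x. (\<i> * of_real \<sigma>) * f' (?z \<tau> x)) = 0" if \<tau>: "\<tau> \<in> {0..1}" for \<tau>
  proof -
    have "((\<lambda>x. f' (?z \<tau> x)) has_integral f (?z \<tau> 1) - f (?z \<tau> 0)) {0..1}"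
      by (rule fundamental_theorem_of_calculus) (use Dx[OF \<tau>] in auto)
    moreover have "f (?z \<tau> 1) = f (?z \<tau> 0)" using p[of "?z \<tau> 0"] by (simp add: add.commute)
    ultimately have "integral {0..1} (\<lambda>x. f' (?z \<tau> x)) = 0" by (simp add: integral_unique)
    then show ?thesis unfolding cbox_interval by (subst integral_mult_right) simp
  qed
  let ?I = "\<lambda>\<tau>. integral (cbox 0 1) (\<lambda>x. f (?z \<tau> x))"
  have DI: "(?I has_vector_derivative 0) (at \<tau> within {0..1})" if \<tau>: "\<tau> \<in> {0..1}" for \<tau>
  proof -
    have "(?I has_vector_derivative integral (cbox 0 1) (\<lambda>x. (\<i> * of_real \<sigma>) * f' (?z \<tau> x))) (at \<tau> within {0..1})"
    proof (rule leibniz_rule_vector_derivative[OF _ _ _ \<tau>])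
      show "((\<lambda>\<tau>. f (?z \<tau> x)) has_vector_derivative (\<i> * of_real \<sigma>) * f' (?z s x)) (at s within {0..1})"
        if "s \<in> {0..1}" "x \<in> cbox 0 1" for s x using Dt[of s x] that by (simp add: cbox_interval)
      show "(\<lambda>x. f (?z s x)) integrable_on cbox 0 1" if "s \<in> {0..1}" for s
        using cx[OF that cf] by (simp add: cbox_interval integrable_continuous_real)
      have "continuous_on ({0..1} \<times> {0..1}) (\<lambda>p. f' ((\<lambda>(\<tau>, x). ?z \<tau> x) p))"
        by (rule continuous_on_compose2[OF c]) (auto simp: split_beta intro!: continuous_intros)
      then show "continuous_on ({0..1} \<times> cbox 0 1) (\<lambda>(s, x). (\<i> * of_real \<sigma>) * f' (?z s x))"
        by (auto simp: split_beta cbox_interval intro!: continuous_intros)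
    qed simp
    then show ?thesis by (simp only: zero[OF \<tau>])
  qed
  have "((\<lambda>_ :: real. 0) has_integral ?I 1 - ?I 0) {0..1}"
    by (rule fundamental_theorem_of_calculus[where f = ?I and f' = "\<lambda>_. 0"]) (simp, rule DI)
  then have "?I 1 - ?I 0 = 0" by (rule has_integral_unique) simp
  then show ?thesis by (simp add: cbox_interval)
qed

context heat_flow
begin

lemma kern_shift: "kern m (of_real t) (of_real x + z) = kern m (of_real t) z * emode m x"
  by (simp add: kern_def emode_def cis_conv_exp exp_add[symmetric] algebra_simps)

text \<open>The height \<open>\<sigma>\<close> is \<open>1 / (2 \<pi>)\<close> times the logarithm of the first growth factor. Between the real line and the
shifted line the logarithm of each term is affine in the height, so the bounds at the two ends extend to the strip.\<close>

lemma kern_strip_bound: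
  assumes M: "\<And>m. cmod (growth_factor m t) \<le> M" and t: "t \<ge> 0" and \<tau>: "\<tau> \<in> {0..1}"
  defines "\<sigma> \<equiv> (pi * N * t\<^sup>2 - 4 * pi\<^sup>2 * k * N * t) / (2 * pi)"
  shows "cmod (kern m (of_real t) (of_real x + \<i> * of_real (\<sigma> * \<tau>))) \<le> M"
    "cmod (kern m (of_real t) (of_real x + \<i> * of_real \<sigma>)) \<le> 1"
    "cmod (kern 1 (of_real t) (\<i> * of_real \<sigma>)) = 1"
proof -
  \<comment> \<open>logarithms of the moduli on the real line and on the shifted line\<close>
  define L where "L m = pi * N * t * (of_int m * t - 4 * pi * k * (of_int m)\<^sup>2)" for m :: int
  define L' where "L' m = - (4 * pi\<^sup>2 * k * N * t * ((of_int m)\<^sup>2 - of_int m))" for m :: int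
  have ex: "cmod (kern m (of_real t) (of_real x + \<i> * of_real (\<sigma> * \<tau>))) = exp ((1 - \<tau>) * L m + \<tau> * L' m)" for m x \<tau>
  proof -
    have "cmod (kern m (of_real t) (of_real x + \<i> * of_real (\<sigma> * \<tau>))) = exp (- (4 * pi\<^sup>2 * k * N * (of_int m)\<^sup>2 * t) + of_int m * (pi * N * t\<^sup>2 - 2 * pi * (\<sigma> * \<tau>)))"
      by (simp add: kern_def flip: of_real_mult of_real_power)
    also have "2 * pi * (\<sigma> * \<tau>) = (pi * N * t\<^sup>2 - 4 * pi\<^sup>2 * k * N * t) * \<tau>" by (simp add: \<sigma>_def)
    also have "- (4 * pi\<^sup>2 * k * N * (of_int m)\<^sup>2 * t) + of_int m * (pi * N * t\<^sup>2 - (pi * N * t\<^sup>2 - 4 * pi\<^sup>2 * k * N * t) * \<tau>)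
        = (1 - \<tau>) * L m + \<tau> * L' m"
      by (simp add: L_def L'_def power2_eq_square algebra_simps)
    finally show ?thesis .
  qed
  have M1: "M \<ge> 1" using M[of 0] by simp
  have L: "L m \<le> ln M" using M[of m] M1 by (simp add: norm_growth_factor L_def[symmetric] ln_ge_iff)
  have sq: "(of_int m)\<^sup>2 - of_int m \<ge> (0::real)"
  proof -
    have "m \<le> m\<^sup>2" by (cases "m \<le> 0") (auto simp: power2_eq_square intro: order_trans[of _ 0] mult_left_mono[of 1 m m, simplified])
    then have "real_of_int m \<le> real_of_int (m\<^sup>2)" by (simp only: of_int_le_iff)
    then show ?thesis by simp
  qed
  then have L': "L' m \<le> 0" using t k_pos N_pos by (simp add: L'_def)
  have "(1 - \<tau>) * L m + \<tau> * L' m \<le> (1 - \<tau>) * ln M + \<tau> * ln M"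
    using \<tau> L L' M1 by (intro add_mono mult_left_mono) (auto intro: order_trans[of _ 0])
  then have "exp ((1 - \<tau>) * L m + \<tau> * L' m) \<le> exp (ln M)" by (simp add: algebra_simps)
  then show "cmod (kern m (of_real t) (of_real x + \<i> * of_real (\<sigma> * \<tau>))) \<le> M" using ex M1 by simp
  show "cmod (kern m (of_real t) (of_real x + \<i> * of_real \<sigma>)) \<le> 1" using ex[of m x 1] L' by simp
  show "cmod (kern 1 (of_real t) (\<i> * of_real \<sigma>)) = 1" using ex[of 1 0 1] by (simp add: L'_def)
qed

text \<open>This one number controls both the derivative of the potential and its deviation from the mean, because \<open>|b\<^sub>m| \<le> 2 \<pi> |m| |b\<^sub>m|\<close> for \<open>m \<noteq> 0\<close>.\<close>

definition deriv_norm :: real where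
  "deriv_norm = (\<Sum>\<^sub>\<infinity>m. cmod (freq m * b m))"

lemma theta1_bound:
  assumes b1: "(\<lambda>m. cmod (freq m * b m)) summable_on UNIV"
    and K: "\<And>m. cmod (kern m t z) \<le> K"
  shows "cmod (theta 1 t z) \<le> K * deriv_norm"
proof -
  let ?f = "\<lambda>m. freq m * b m * kern m t z"
  have le: "cmod (?f m) \<le> K * cmod (freq m * b m)" for m
    unfolding norm_mult[of _ "kern m t z"] using mult_left_mono[OF K[of m] norm_ge_zero] by (simp only: mult.commute[of K])
  have s: "(\<lambda>m. norm (?f m)) summable_on UNIV"
    by (rule summable_on_comparison_test[OF summable_on_cmult_right[OF b1, of K]]) (auto simp only: le norm_ge_zero)
  have "cmod (infsum ?f UNIV) \<le> infsum (\<lambda>m. cmod (?f m)) UNIV" by (rule norm_infsum_bound[OF s])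
  also have "\<dots> \<le> infsum (\<lambda>m. K * cmod (freq m * b m)) UNIV"
    by (intro infsum_mono s summable_on_cmult_right b1 le)
  also have "\<dots> = K * deriv_norm" unfolding deriv_norm_def by (rule infsum_cmult_right')
  finally show ?thesis by (simp add: theta_def)
qed

lemma theta0_deviation:
  assumes b1: "(\<lambda>m. cmod (freq m * b m)) summable_on UNIV"
    and K: "\<And>m. cmod (kern m t z) \<le> K"
  shows "cmod (theta 0 t z - b 0) \<le> K * deriv_norm"
proof -
  let ?f = "\<lambda>m. b m * kern m t z"
  let ?g = "\<lambda>m. if m = 0 then 0 else ?f m"
  let ?B = "\<lambda>m. K * cmod (freq m * b m)"
  have K0: "K \<ge> 0" using K[of 0] norm_ge_zero order_trans by blast
  have le: "cmod (?g m) \<le> ?B m" for m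
  proof (cases "m = 0")
    case False
    then have "1 * 1 \<le> 2 * pi * \<bar>real_of_int m\<bar>"
      using pi_gt3 by (intro mult_mono) auto
    then have "1 * cmod (b m) \<le> (2 * pi * \<bar>real_of_int m\<bar>) * cmod (b m)" by (intro mult_right_mono) auto
    then have "cmod (b m) * cmod (kern m t z) \<le> ((2 * pi * \<bar>real_of_int m\<bar>) * cmod (b m)) * K"
      using K[of m] K0 by (intro mult_mono) auto
    then show ?thesis using False by (simp add: norm_mult mult_ac)
  qed simp
  have sB: "?B summable_on UNIV" by (rule summable_on_cmult_right[OF b1])
  have s: "(\<lambda>m. norm (?g m)) summable_on UNIV"
    by (rule summable_on_comparison_test[OF sB]) (auto simp only: le norm_ge_zero)
  have h0: "((\<lambda>m. if m = 0 then ?f 0 else 0) has_sum ?f 0) UNIV"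
    by (rule has_sum_finite_neutralI[of "{0}"]) auto
  have "((\<lambda>m. ?g m + (if m = 0 then ?f 0 else 0)) has_sum (infsum ?g UNIV + ?f 0)) UNIV"
    by (rule has_sum_add[OF has_sum_infsum[OF abs_summable_summable[OF s]] h0])
  moreover have "(\<lambda>m. ?g m + (if m = 0 then ?f 0 else 0)) = ?f" by auto
  ultimately have "infsum ?f UNIV = infsum ?g UNIV + ?f 0" by (simp add: infsumI)
  then have "theta 0 t z - b 0 = infsum ?g UNIV" by (simp add: theta_def kern_def)
  also have "cmod \<dots> \<le> infsum (\<lambda>m. cmod (?g m)) UNIV" by (rule norm_infsum_bound[OF s])
  also have "\<dots> \<le> infsum ?B UNIV" by (intro infsum_mono s sB le)
  also have "\<dots> = K * deriv_norm" unfolding deriv_norm_def by (rule infsum_cmult_right')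
  finally show ?thesis .
qed

lemma continuous_theta_z: "Re t > 0 \<Longrightarrow> continuous_on S (theta j t)"
  by (intro continuous_at_imp_continuous_on ballI DERIV_isCont[OF theta_dz])

lemma kern_periodic: "kern m t (z + 1) = kern m t z"
proof -
  have "kern m t (z + 1) = kern m t z * exp (freq m)"
    unfolding kern_def exp_add[symmetric] by (rule arg_cong[where f = exp]) (simp add: algebra_simps)
  moreover have "exp (freq m) = (1::complex)"
    using exp_integer_2pi[of "of_int m"] by (simp add: mult_ac)
  ultimately show ?thesis by simp
qed

text \<open>On the line \<open>Im z = \<sigma>\<close> the mode \<open>m\<close> of \<open>\<theta>\<^sub>0\<close> has size \<open>exp (- 4 \<pi>\<^sup>2 k N t (m\<^sup>2 - m)) \<le> 1\<close> relative to
  its initial value and the first mode has exactly its initial size, so there the quotient is governed by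
  the linear term, while the shift multiplies the first coefficient by the full linear growth factor.\<close>

lemma quotient_mode_lower_bound:
  assumes b1: "(\<lambda>m. cmod (freq m * b m)) summable_on UNIV"
    and M: "\<And>m. cmod (growth_factor m t) \<le> M" and t: "t > 0" and small: "M * deriv_norm < cmod (b 0)"
  shows "cmod (fc (\<lambda>x. theta 1 (of_real t) (of_real x) / theta 0 (of_real t) (of_real x)) 1)
    \<ge> exp (pi * N * t\<^sup>2 - 4 * pi\<^sup>2 * k * N * t) *
      (cmod (2 * of_real pi * \<i> * b 1) / cmod (b 0) - deriv_norm\<^sup>2 / (cmod (b 0) * (cmod (b 0) - deriv_norm)))"
proof -
  define r where "r = pi * N * t\<^sup>2 - 4 * pi\<^sup>2 * k * N * t"
  define \<sigma> where "\<sigma> = r / (2 * pi)"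
  have \<sigma>: "\<sigma> = (pi * N * t\<^sup>2 - 4 * pi\<^sup>2 * k * N * t) / (2 * pi)" by (simp add: \<sigma>_def r_def)
  note ks = kern_strip_bound[OF M less_imp_le[OF t], folded \<sigma>]
  let ?t = "complex_of_real t"
  let ?z = "\<lambda>\<tau> x. complex_of_real x + \<i> * of_real (\<sigma> * \<tau>)"
  have Ret: "Re ?t > 0" using t by simp
  have M1: "M \<ge> 1" using M[of 0] by simp
  have e0: "deriv_norm \<ge> 0" unfolding deriv_norm_def by (intro infsum_nonneg) simp
  have small1: "deriv_norm < cmod (b 0)" using small mult_right_mono[OF M1 e0] by simp
  then have b0: "cmod (b 0) > 0" using e0 by linarith
  have nz: "theta 0 ?t (?z \<tau> x) \<noteq> 0" if "\<tau> \<in> {0..1}" for \<tau> x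
  proof
    assume "theta 0 ?t (?z \<tau> x) = 0"
    then show False using theta0_deviation[OF b1 ks(1)[OF that], of x] small by simp
  qed
  define E where "E z = exp (- 2 * of_real pi * \<i> * z)" for z
  define Q where "Q z = theta 1 ?t z / theta 0 ?t z" for z
  define f where "f z = E z * Q z" for z
  define f' where "f' z = E z * ((theta 2 ?t z * theta 0 ?t z - theta 1 ?t z * theta 1 ?t z) / (theta 0 ?t z * theta 0 ?t z))
      + (- 2 * of_real pi * \<i> * E z) * Q z" for z
  have DE: "(E has_field_derivative (- 2 * of_real pi * \<i> * E z)) (at z)" for z
    unfolding E_def[abs_def] by (auto intro!: derivative_eq_intros)
  have Df: "(f has_field_derivative f' z) (at z)" if "theta 0 ?t z \<noteq> 0" for z
  proof -
    have "(Q has_field_derivative (theta 2 ?t z * theta 0 ?t z - theta 1 ?t z * theta 1 ?t z) / (theta 0 ?t z * theta 0 ?t z)) (at z)"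
      using DERIV_divide[OF theta_dz[OF Ret, of 1] theta_dz[OF Ret, of 0] that]
      by (simp add: Q_def[abs_def] numeral_2_eq_2)
    from DERIV_mult'[OF DE this] show ?thesis unfolding f_def[abs_def] f'_def by simp
  qed
  have shift: "integral {0..1} (\<lambda>x. f (of_real x + \<i> * of_real \<sigma>)) = integral {0..1} (\<lambda>x. f (of_real x))"
  proof (rule period_integral_shift)
    show "(f has_field_derivative f' (?z \<tau> x)) (at (?z \<tau> x))" if "x \<in> {0..1}" "\<tau> \<in> {0..1}" for x \<tau>
      by (rule Df[OF nz[OF that(2)]])
    show "continuous_on ((\<lambda>(\<tau>, x). ?z \<tau> x) ` ({0..1} \<times> {0..1})) f'"
      unfolding f'_def Q_def E_def
      by (intro continuous_intros continuous_theta_z Ret) (use nz in \<open>auto simp del: of_real_mult\<close>)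
    have "E (z + 1) = E z" for z
      using exp_integer_2pi[of "- 1"] by (simp add: E_def ring_distribs exp_add mult_ac exp_diff exp_minus)
    then show "f (z + 1) = f z" for z
      by (simp add: f_def Q_def theta_def kern_periodic)
  qed
  have cq: "continuous_on {0..1} (\<lambda>x. Q (of_real x))"
    unfolding Q_def using nz[of 0]
    by (intro continuous_on_divide continuous_on_compose2[OF continuous_theta_z[OF Ret, of UNIV]] continuous_intros) auto
  have cqs: "continuous_on {0..1} (\<lambda>x. Q (of_real x + \<i> * of_real \<sigma>))"
    unfolding Q_def using nz[of 1]
    by (intro continuous_on_divide continuous_on_compose2[OF continuous_theta_z[OF Ret, of UNIV]] continuous_intros) auto
  have Ex: "E (of_real x) = emode (- 1) x" for x
    by (simp add: E_def emode_def cis_conv_exp mult_ac)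
  have Exs: "E (of_real x + \<i> * of_real \<sigma>) = of_real (exp r) * emode (- 1) x" for x
  proof -
    have "- 2 * of_real pi * \<i> * (\<i> * of_real \<sigma>) = complex_of_real r" by (simp add: \<sigma>_def)
    then have "E (of_real x + \<i> * of_real \<sigma>) = E (of_real x) * exp (of_real r)"
      by (simp only: E_def distrib_left exp_add)
    then show ?thesis by (simp add: Ex exp_of_real mult.commute)
  qed
  have "fc (\<lambda>x. Q (of_real x)) 1 = integral {0..1} (\<lambda>x. f (of_real x))"
    unfolding fc_def f_def Ex by (intro LINT_torus_eq_integral continuous_integrable_torus continuous_intros cq)
  also have "\<dots> = integral {0..1} (\<lambda>x. of_real (exp r) * (emode (- 1) x * Q (of_real x + \<i> * of_real \<sigma>)))"
    unfolding shift[symmetric] unfolding f_def Exs by (simp add: mult.assoc)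
  also have "\<dots> = of_real (exp r) * fc (\<lambda>x. Q (of_real x + \<i> * of_real \<sigma>)) 1"
    unfolding fc_def by (subst LINT_torus_eq_integral) (auto intro!: continuous_integrable_torus continuous_intros cqs)
  finally have main: "cmod (fc (\<lambda>x. Q (of_real x)) 1) = exp r * cmod (fc (\<lambda>x. Q (of_real x + \<i> * of_real \<sigma>)) 1)"
    by (simp add: norm_mult)
  define A where "A x = theta 1 ?t (of_real x + \<i> * of_real \<sigma>)" for x
  define D where "D x = theta 0 ?t (of_real x + \<i> * of_real \<sigma>)" for x
  have K1: "cmod (kern m ?t (of_real x + \<i> * of_real \<sigma>)) \<le> 1" for m x
    using ks(2)[of 1] by simp
  have Ab: "cmod (A x) \<le> deriv_norm" for x unfolding A_def using theta1_bound[OF b1 K1] by simp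
  have Db: "cmod (D x - b 0) \<le> deriv_norm" for x unfolding D_def using theta0_deviation[OF b1 K1] by simp
  have Dl: "cmod (b 0) - deriv_norm \<le> cmod (D x)" for x
    using Db[of x] norm_triangle_ineq2[of "b 0" "D x"] by (simp add: norm_minus_commute)
  have Dnz: "D x \<noteq> 0" for x using Dl[of x] small1 by auto
  have bnz: "b 0 \<noteq> 0" using b0 by auto
  have cA: "continuous_on {0..1} A" and cD: "continuous_on {0..1} D" unfolding A_def D_def
    by (intro continuous_on_compose2[OF continuous_theta_z[OF Ret, of UNIV]] continuous_intros; simp)+
  have fA: "fc A 1 = 2 * of_real pi * \<i> * b 1 * kern 1 ?t (\<i> * of_real \<sigma>)"
  proof -
    let ?c = "\<lambda>m. freq m * b m * kern m ?t (\<i> * of_real \<sigma>)"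
    have "A = (\<lambda>x. \<Sum>\<^sub>\<infinity>m. ?c m * emode m x)"
      by (rule ext) (simp add: A_def theta_def kern_shift mult.assoc)
    moreover have "(\<lambda>m. cmod (?c m)) summable_on UNIV"
    proof (rule summable_on_comparison_test[OF b1])
      show "cmod (?c m) \<le> cmod (freq m * b m)" for m
        unfolding norm_mult[of _ "kern m ?t _"] using K1[of m 0] by (intro mult_left_le) auto
    qed simp
    ultimately show ?thesis using fc_Fourier_series by simp
  qed
  define R where "R x = A x * (D x - b 0) / (b 0 * D x)" for x
  have cR: "continuous_on {0..1} R" unfolding R_def using Dnz bnz by (intro continuous_intros cA cD) auto
  have QA: "Q (of_real x + \<i> * of_real \<sigma>) = (1 / b 0) * A x - R x" for x
  proof -
    have "Q (of_real x + \<i> * of_real \<sigma>) = A x / D x" by (simp only: Q_def A_def D_def)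
    then show ?thesis using Dnz[of x] bnz by (simp add: R_def field_simps)
  qed
  have Rb: "cmod (R x) \<le> deriv_norm\<^sup>2 / (cmod (b 0) * (cmod (b 0) - deriv_norm))" for x
    unfolding R_def norm_divide norm_mult power2_eq_square
    using Ab Db Dl[of x] small1 b0 e0 by (intro frac_le mult_mono) auto
  have "cmod (fc R 1) \<le> deriv_norm\<^sup>2 / (cmod (b 0) * (cmod (b 0) - deriv_norm))"
  proof -
    have sR: "sq_int R" by (rule sq_int_continuous[OF cR])
    have "sqn R \<le> (deriv_norm\<^sup>2 / (cmod (b 0) * (cmod (b 0) - deriv_norm)))\<^sup>2"
      by (rule sqn_bounded[OF sR]) (use Rb in auto)
    then have "sqrt (sqn R) \<le> deriv_norm\<^sup>2 / (cmod (b 0) * (cmod (b 0) - deriv_norm))"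
      using small1 b0 by (intro real_le_lsqrt) auto
    then show ?thesis using norm_fc_le[OF sR, of 1] by linarith
  qed
  moreover have "fc (\<lambda>x. Q (of_real x + \<i> * of_real \<sigma>)) 1 = (1 / b 0) * fc A 1 - fc R 1"
    unfolding QA by (subst fc_diff) (auto simp: fc_cmult[of "1 / b 0", simplified] intro!: sq_int_continuous continuous_intros cA cR bnz)
  moreover have "cmod ((1 / b 0) * fc A 1) = cmod (2 * of_real pi * \<i> * b 1) / cmod (b 0)"
    unfolding fA using ks(3)[of 0] by (simp add: norm_mult norm_divide)
  moreover have "cmod ((1 / b 0) * fc A 1) - cmod (fc R 1) \<le> cmod ((1 / b 0) * fc A 1 - fc R 1)"
    by (rule norm_triangle_ineq2)
  ultimately have "cmod (2 * of_real pi * \<i> * b 1) / cmod (b 0) - deriv_norm\<^sup>2 / (cmod (b 0) * (cmod (b 0) - deriv_norm))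
      \<le> cmod (fc (\<lambda>x. Q (of_real x + \<i> * of_real \<sigma>)) 1)" by simp
  then show ?thesis unfolding main[unfolded Q_def[abs_def]] r_def[symmetric] Q_def[abs_def]
    by (intro mult_left_mono) auto
qed

end

section \<open>The Cole--Hopf transform of the initial datum\<close>

text \<open>Here \<open>f\<close> is the datum without its scaling, and \<open>g\<close> the continuous representative of \<open>f\<close> minus its mean, with primitive \<open>G\<close>. The
initial potential is \<open>E = exp (- \<delta> G)\<close>, its derivative is \<open>\<delta> F\<close>, and \<open>h\<close> is the weak derivative of \<open>F\<close>. All
bounds are uniform in \<open>0 < \<delta> \<le> 1\<close>; the constant \<open>C\<close> is a common upper bound for those needed later.\<close>

locale periodic_datum =
  fixes f f' :: "real \<Rightarrow> complex"
  assumes pair: "H1_pair f f'" and f_periodic: "periodic1 f" and f'_periodic: "periodic1 f'"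
begin

definition S :: real where "S = (\<Sum>\<^sub>\<infinity>m. cmod (fc f m))"

definition g :: "real \<Rightarrow> complex" where
  "g x = (\<Sum>\<^sub>\<infinity>m. fc f m * emode m x) - fc f 0"

definition G :: "real \<Rightarrow> complex" where "G x = integral {0..x} g"

definition E :: "real \<Rightarrow> real \<Rightarrow> complex" where "E \<delta> x = exp (- of_real \<delta> * G x)"

definition F :: "real \<Rightarrow> real \<Rightarrow> complex" where "F \<delta> x = - (g x * E \<delta> x)"

definition h :: "real \<Rightarrow> real \<Rightarrow> complex" where
  "h \<delta> x = - (f' x * E \<delta> x) + of_real \<delta> * ((g x)\<^sup>2 * E \<delta> x)"

definition K :: real where "K = exp (2 * S)"

definition C :: real where
  "C = 2 * S * K + sobolev * (K * sqrt (sqn f') + (2 * S)\<^sup>2 * K) + (2 * S)\<^sup>2 * K"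

lemma f_summable: "(\<lambda>m. cmod (fc f m)) summable_on UNIV"
  by (rule H1_fc_summable(1)[OF pair])

lemma S_nonneg: "S \<ge> 0" unfolding S_def by (intro infsum_nonneg) simp

lemma K_ge_1: "K \<ge> 1" using S_nonneg by (simp add: K_def)

lemma C_parts: "2 * S * K \<le> C" "2 * S * K + sobolev * (K * sqrt (sqn f') + (2 * S)\<^sup>2 * K) \<le> C" "(2 * S)\<^sup>2 * K \<le> C" "C \<ge> 0"
proof -
  have "0 \<le> 2 * S * K" "0 \<le> sobolev * (K * sqrt (sqn f') + (2 * S)\<^sup>2 * K)" "0 \<le> (2 * S)\<^sup>2 * K"
    using S_nonneg K_ge_1 sobolev_nonneg by auto
  then show "2 * S * K \<le> C" "2 * S * K + sobolev * (K * sqrt (sqn f') + (2 * S)\<^sup>2 * K) \<le> C" "(2 * S)\<^sup>2 * K \<le> C" "C \<ge> 0"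
    unfolding C_def by linarith+
qed

lemma continuous_g: "continuous_on A g"
  unfolding g_def[abs_def] by (intro continuous_on_diff continuous_Fourier_series f_summable continuous_on_const)

lemma g_AE: "AE x in torus. g x = f x - fc f 0"
  using H1_AE_Fourier_series[OF pair] by eventually_elim (simp add: g_def)

lemma g_bound: "cmod (g x) \<le> 2 * S"
proof -
  have "cmod (fc f 0) \<le> S"
    using finite_sum_le_infsum[OF f_summable, of "{0}"] by (simp add: S_def)
  moreover have "cmod (\<Sum>\<^sub>\<infinity>m. fc f m * emode m x) \<le> S"
    unfolding S_def by (rule Fourier_series_bound[OF f_summable])
  ultimately show ?thesis
    using norm_triangle_ineq4[of "\<Sum>\<^sub>\<infinity>m. fc f m * emode m x" "fc f 0"] unfolding g_def by linarith
qed

lemma const_pair: "H1_pair (\<lambda>x. c) (\<lambda>x. 0)"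
  by (rule H1_pair_classical) (auto intro!: derivative_eq_intros)

lemma g_pair: "H1_pair g f'"
proof (rule H1_pair_cong)
  show "H1_pair (\<lambda>x. f x - fc f 0) (\<lambda>x. f' x - 0)" by (rule H1_pair_diff[OF pair const_pair])
  show "AE x in torus. f x - fc f 0 = g x" using g_AE by eventually_elim simp
  show "f' \<in> borel_measurable torus" using H1_pairD(2)[OF pair] by (simp add: sq_int_def)
qed (auto intro: continuous_measurable_torus continuous_g)

lemma g_fc: "fc g 0 = 0" "fc g 1 = fc f 1"
proof -
  have sf: "sq_int f" using H1_pairD(1)[OF pair] .
  have c: "fc (\<lambda>x. z) n = (if n = 0 then z else 0)" for z n
    using fc_cmult[of z "emode 0" n] fc_emode[of 0 n] by simp
  have "fc g n = fc (\<lambda>x. f x - fc f 0) n" for n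
    by (rule fc_cong[OF g_AE]) (use sf in \<open>auto simp: sq_int_def intro: continuous_measurable_torus continuous_g\<close>)
  then have "fc g n = fc f n - (if n = 0 then fc f 0 else 0)" for n
    using fc_diff[OF sf sq_int_const] by (simp add: c)
  then show "fc g 0 = 0" "fc g 1 = fc f 1" by simp_all
qed

lemma G_derivative: "x \<in> {0..1} \<Longrightarrow> (G has_vector_derivative g x) (at x within {0..1})"
  unfolding G_def[abs_def] by (rule integral_has_vector_derivative[OF continuous_g])

lemma G_ends: "G 0 = 0" "G 1 = 0"
proof -
  have "integral {0..1} g = fc g 0"
    unfolding fc_def by (simp add: LINT_torus_eq_integral continuous_integrable_torus continuous_g)
  then show "G 0 = 0" "G 1 = 0" using g_fc(1) by (simp_all add: G_def)
qed

lemma G_bound: assumes "x \<in> {0..1}" shows "cmod (G x) \<le> 2 * S"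
proof -
  have "cmod (G x) \<le> 2 * S * (x - 0)"
    unfolding G_def using assms by (intro integral_bound continuous_g) (auto intro: g_bound)
  also have "\<dots> \<le> 2 * S * 1" using assms S_nonneg by (intro mult_left_mono) auto
  finally show ?thesis by simp
qed

lemma E_bounds:
  assumes x: "x \<in> {0..1}" and \<delta>: "0 < \<delta>" "\<delta> \<le> 1"
  shows "cmod (E \<delta> x) \<le> K" "cmod (E \<delta> x - 1) \<le> \<delta> * (2 * S * K)"
proof -
  let ?z = "- of_real \<delta> * G x"
  have n: "cmod ?z \<le> \<delta> * (2 * S)" using G_bound[OF x] \<delta> by (simp add: norm_mult)
  also have "\<dots> \<le> 1 * (2 * S)" using \<delta> S_nonneg by (intro mult_right_mono) auto
  finally have n1: "cmod ?z \<le> 2 * S" by simp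
  have "cmod (exp ?z) \<le> exp (cmod ?z)" by (rule norm_exp)
  also have "\<dots> \<le> K" using n1 by (simp add: K_def)
  finally show "cmod (E \<delta> x) \<le> K" by (simp add: E_def)
  have "cmod (exp ?z - 1) \<le> exp (cmod ?z) * cmod ?z"
    using Taylor_exp_field[of ?z 0] by simp
  also have "\<dots> \<le> K * (\<delta> * (2 * S))" using n n1 by (intro mult_mono) (auto simp: K_def)
  finally show "cmod (E \<delta> x - 1) \<le> \<delta> * (2 * S * K)" by (simp add: E_def mult_ac)
qed

lemma continuous_E: "continuous_on {0..1} (E \<delta>)"
proof -
  have "continuous_on {0..1} G"
    using has_vector_derivative_continuous[OF G_derivative] by (auto simp: continuous_on_eq_continuous_within)
  then show ?thesis unfolding E_def[abs_def] by (intro continuous_intros)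
qed

lemma E_pair: "H1_pair (E \<delta>) (\<lambda>x. of_real \<delta> * F \<delta> x)"
proof (rule H1_pair_classical)
  show "(E \<delta> has_vector_derivative of_real \<delta> * F \<delta> x) (at x within {0..1})" if x: "x \<in> {0..1}" for x
  proof -
    have "((\<lambda>z. exp (- of_real \<delta> * z)) has_field_derivative exp (- of_real \<delta> * G x) * (- of_real \<delta>)) (at (G x) within G ` {0..1})"
      by (auto intro!: derivative_eq_intros)
    from field_vector_diff_chain_within[OF G_derivative[OF x] this] show ?thesis
      by (simp add: o_def E_def[abs_def] F_def mult_ac)
  qed
  show "continuous_on {0..1} (\<lambda>x. of_real \<delta> * F \<delta> x)"
    unfolding F_def by (intro continuous_intros continuous_E continuous_g)
  show "E \<delta> 0 = E \<delta> 1" by (simp add: E_def G_ends)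
qed

lemma f'_E_sq_int: "sq_int (\<lambda>x. f' x * E \<delta> x)"
proof -
  have "bounded (E \<delta> ` {0..1})"
    by (intro compact_imp_bounded compact_continuous_image continuous_E compact_Icc)
  then obtain B where "\<forall>x\<in>{0..1}. cmod (E \<delta> x) \<le> B" unfolding bounded_iff by auto
  then have "sq_int (\<lambda>x. E \<delta> x * f' x)"
    by (intro sq_int_bounded_mult[OF H1_pairD(2)[OF pair]] continuous_measurable_torus continuous_E AE_I2) auto
  then show ?thesis by (simp add: mult.commute)
qed

text \<open>The product rule for \<open>g\<close>, which has only a square integrable derivative, and the continuously differentiable \<open>E\<close>.\<close>

lemma F_pair: "H1_pair (F \<delta>) (h \<delta>)"
proof -
  have "H1_pair (\<lambda>x. g x * E \<delta> x) (\<lambda>x. f' x * E \<delta> x + g x * (of_real \<delta> * F \<delta> x))"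
    by (rule H1_pair_product[OF g_pair E_pair _ f'_E_sq_int])
       (auto simp: F_def intro!: sq_int_continuous continuous_intros continuous_E continuous_g)
  from H1_pair_cmult[OF this, of "- 1"] show ?thesis
    by (simp add: F_def[abs_def] h_def[abs_def] power2_eq_square mult_ac)
qed

lemma F_bound:
  assumes "x \<in> {0..1}" "0 < \<delta>" "\<delta> \<le> 1" shows "cmod (F \<delta> x) \<le> 2 * S * K"
  unfolding F_def norm_minus_cancel norm_mult
  by (intro mult_mono g_bound E_bounds assms) (use S_nonneg in auto)

lemma h_sqn:
  assumes \<delta>: "0 < \<delta>" "\<delta> \<le> 1" shows "sqrt (sqn (h \<delta>)) \<le> K * sqrt (sqn f') + (2 * S)\<^sup>2 * K"
proof -
  let ?a = "\<lambda>x. - (f' x * E \<delta> x)" and ?b = "\<lambda>x. of_real \<delta> * ((g x)\<^sup>2 * E \<delta> x)"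
  have a: "sq_int ?a" by (intro sq_int_minus f'_E_sq_int)
  have b: "sq_int ?b" by (intro sq_int_continuous continuous_intros continuous_E continuous_g)
  have "sqn ?a = sqn (\<lambda>x. E \<delta> x * f' x)" by (simp add: sqn_def norm_mult mult.commute)
  also have "\<dots> \<le> K\<^sup>2 * sqn f'"
    by (intro sqn_bounded_mult[OF H1_pairD(2)[OF pair]] continuous_measurable_torus continuous_E AE_I2)
       (use E_bounds(1) \<delta> in auto)
  finally have "sqrt (sqn ?a) \<le> sqrt (K\<^sup>2 * sqn f')" by (rule real_sqrt_le_mono)
  then have A: "sqrt (sqn ?a) \<le> K * sqrt (sqn f')" using K_ge_1 by (simp add: real_sqrt_mult)
  have "sqn ?b \<le> ((2 * S)\<^sup>2 * K)\<^sup>2"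
  proof (rule sqn_bounded[OF b], rule AE_I2)
    fix x assume "x \<in> space torus"
    then have x: "x \<in> {0..1}" by simp
    have "cmod (?b x) = \<delta> * ((cmod (g x))\<^sup>2 * cmod (E \<delta> x))" using \<delta> by (simp add: norm_mult norm_power)
    also have "\<dots> \<le> 1 * ((2 * S)\<^sup>2 * K)"
      by (intro mult_mono power_mono g_bound E_bounds x \<delta>) auto
    finally show "cmod (?b x) \<le> (2 * S)\<^sup>2 * K" by simp
  qed
  then have B: "sqrt (sqn ?b) \<le> (2 * S)\<^sup>2 * K" using K_ge_1 by (intro real_le_lsqrt) auto
  show ?thesis using sqn_triangle[OF a b] A B unfolding h_def[abs_def] by linarith
qed

definition b :: "real \<Rightarrow> int \<Rightarrow> complex" where "b \<delta> m = fc (E \<delta>) m"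

lemma b_deriv: "freq m * b \<delta> m = of_real \<delta> * fc (F \<delta>) m"
  using H1_pairD(3)[OF E_pair, of \<delta> m] by (simp add: b_def fc_cmult)

lemma b_summable: "(\<lambda>m. cmod (b \<delta> m)) summable_on UNIV"
  unfolding b_def by (rule H1_fc_summable(1)[OF E_pair])

lemma b_deriv_summable: "(\<lambda>m. cmod (freq m * b \<delta> m)) summable_on UNIV"
  unfolding b_deriv norm_mult by (intro summable_on_cmult_right H1_fc_summable(1)[OF F_pair])

lemma b_deriv_sum:
  assumes \<delta>: "0 < \<delta>" "\<delta> \<le> 1"
  shows "(\<Sum>\<^sub>\<infinity>m. cmod (freq m * b \<delta> m)) \<le> \<delta> * C"
proof -
  have sF: "sq_int (F \<delta>)" using H1_pairD(1)[OF F_pair] .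
  have "sqn (F \<delta>) \<le> (2 * S * K)\<^sup>2" by (rule sqn_bounded[OF sF], rule AE_I2) (use F_bound \<delta> in auto)
  then have "sqrt (sqn (F \<delta>)) \<le> 2 * S * K" using S_nonneg K_ge_1 by (intro real_le_lsqrt) auto
  then have 1: "cmod (fc (F \<delta>) 0) \<le> 2 * S * K" using norm_fc_le[OF sF, of 0] by linarith
  have 2: "sobolev * sqrt (sqn (h \<delta>)) \<le> sobolev * (K * sqrt (sqn f') + (2 * S)\<^sup>2 * K)"
    by (intro mult_left_mono h_sqn \<delta> sobolev_nonneg)
  have "(\<Sum>\<^sub>\<infinity>m. cmod (fc (F \<delta>) m)) \<le> C"
    using H1_fc_summable(2)[OF F_pair, of \<delta>] 1 2 C_parts(2) by linarith
  then have "\<delta> * (\<Sum>\<^sub>\<infinity>m. cmod (fc (F \<delta>) m)) \<le> \<delta> * C" using \<delta> by (intro mult_left_mono) auto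
  moreover have "(\<Sum>\<^sub>\<infinity>m. cmod (freq m * b \<delta> m)) = (\<Sum>\<^sub>\<infinity>m. \<delta> * cmod (fc (F \<delta>) m))"
    unfolding b_deriv using \<delta> by (simp add: norm_mult)
  ultimately show ?thesis by (simp add: infsum_cmult_right')
qed

lemma fc_bounded:
  assumes "sq_int y" "\<And>x. x \<in> {0..1} \<Longrightarrow> cmod (y x) \<le> B" "B \<ge> 0" shows "cmod (fc y n) \<le> B"
proof -
  have "sqn y \<le> B\<^sup>2" by (rule sqn_bounded[OF assms(1)], rule AE_I2) (use assms in auto)
  then have "sqrt (sqn y) \<le> B" using assms by (intro real_le_lsqrt) auto
  then show ?thesis using norm_fc_le[OF assms(1), of n] by linarith
qed

lemma b_0:
  assumes \<delta>: "0 < \<delta>" "\<delta> \<le> 1" shows "cmod (b \<delta> 0 - 1) \<le> \<delta> * C"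
proof -
  have "fc (\<lambda>x. E \<delta> x - 1) 0 = b \<delta> 0 - 1"
    unfolding b_def by (subst fc_diff[OF H1_pairD(1)[OF E_pair] sq_int_const]) (simp add: fc_def)
  moreover have "cmod (fc (\<lambda>x. E \<delta> x - 1) 0) \<le> \<delta> * (2 * S * K)"
    by (rule fc_bounded) (use E_bounds \<delta> S_nonneg K_ge_1 in \<open>auto intro!: sq_int_continuous continuous_intros continuous_E\<close>)
  moreover have "\<delta> * (2 * S * K) \<le> \<delta> * C" using \<delta> C_parts by (intro mult_left_mono) auto
  ultimately show ?thesis by simp
qed

text \<open>To first order in \<open>\<delta>\<close> the potential is \<open>1 - \<delta> G\<close>, so the first mode of its derivative is \<open>- \<delta>\<close> times that of the datum up to \<open>O(\<delta>\<^sup>2)\<close>; the remainder comes from \<open>g (E - 1)\<close>.\<close>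

lemma b_1:
  assumes \<delta>: "0 < \<delta>" "\<delta> \<le> 1" shows "cmod (2 * of_real pi * \<i> * b \<delta> 1 + of_real \<delta> * fc f 1) \<le> \<delta>\<^sup>2 * C"
proof -
  have "fc (\<lambda>x. F \<delta> x + g x) 1 = fc (F \<delta>) 1 + fc g 1"
    by (rule fc_add[OF H1_pairD(1)[OF F_pair] H1_pairD(1)[OF g_pair]])
  then have e: "2 * of_real pi * \<i> * b \<delta> 1 + of_real \<delta> * fc f 1 = of_real \<delta> * fc (\<lambda>x. F \<delta> x + g x) 1"
    using b_deriv[of 1 \<delta>] g_fc(2) by (simp add: ring_distribs)
  have "cmod (fc (\<lambda>x. F \<delta> x + g x) 1) \<le> (2 * S) * (\<delta> * (2 * S * K))"
  proof (rule fc_bounded)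
    show "sq_int (\<lambda>x. F \<delta> x + g x)"
      by (rule sq_int_add[OF H1_pairD(1)[OF F_pair] H1_pairD(1)[OF g_pair]])
    show "cmod (F \<delta> x + g x) \<le> (2 * S) * (\<delta> * (2 * S * K))" if "x \<in> {0..1}" for x
    proof -
      have "F \<delta> x + g x = - (g x * (E \<delta> x - 1))" by (simp add: F_def algebra_simps)
      also have "cmod \<dots> \<le> (2 * S) * (\<delta> * (2 * S * K))"
        unfolding norm_minus_cancel norm_mult by (intro mult_mono g_bound E_bounds that \<delta>) (use S_nonneg in auto)
      finally show ?thesis .
    qed
  qed (use S_nonneg K_ge_1 \<delta> in auto)
  also have "\<dots> = \<delta> * ((2 * S)\<^sup>2 * K)" by (simp add: power2_eq_square)
  also have "\<dots> \<le> \<delta> * C" using \<delta> C_parts by (intro mult_left_mono) auto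
  finally have "\<delta> * cmod (fc (\<lambda>x. F \<delta> x + g x) 1) \<le> \<delta> * (\<delta> * C)" using \<delta> by (intro mult_left_mono) auto
  then show ?thesis unfolding e using \<delta> by (simp add: norm_mult power2_eq_square)
qed

text \<open>The potential and its derivative, as the everywhere convergent Fourier series that the heat flow produces at \<open>t = 0\<close>; they agree with \<open>E\<close> and \<open>\<delta> F\<close> on \<open>[0,1]\<close> almost everywhere.\<close>

definition T0 :: "real \<Rightarrow> real \<Rightarrow> complex" where
  "T0 \<delta> x = (\<Sum>\<^sub>\<infinity>m. b \<delta> m * emode m x)"

definition T1 :: "real \<Rightarrow> real \<Rightarrow> complex" where
  "T1 \<delta> x = (\<Sum>\<^sub>\<infinity>m. freq m * b \<delta> m * emode m x)"

text \<open>A representative of the weak derivative of \<open>T1\<close> that is periodic everywhere.\<close>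

definition h2 :: "real \<Rightarrow> real \<Rightarrow> complex" where
  "h2 \<delta> x = of_real \<delta> * h \<delta> (frac x)"

lemma h2_periodic: "periodic1 (h2 \<delta>)"
  by (simp add: periodic1_def h2_def frac_1_eq)

lemma T_AE:
  "AE x in torus. T0 \<delta> x = E \<delta> x" "AE x in torus. T1 \<delta> x = of_real \<delta> * F \<delta> x"
  "AE x in torus. h2 \<delta> x = of_real \<delta> * h \<delta> x"
proof -
  show "AE x in torus. T0 \<delta> x = E \<delta> x"
    using H1_AE_Fourier_series[OF E_pair[of \<delta>]] by eventually_elim (simp add: T0_def b_def)
  show "AE x in torus. T1 \<delta> x = of_real \<delta> * F \<delta> x"
    using H1_AE_Fourier_series[OF H1_pair_cmult[OF F_pair[of \<delta>], of "of_real \<delta>"]]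
    by eventually_elim (simp only: T1_def b_deriv fc_cmult)
  have "AE x in lebesgue. x \<notin> {1::real}"
    by (intro AE_not_in) (simp flip: negligible_iff_null_sets)
  then have "AE x in torus. x \<noteq> 1"
    by (subst AE_restrict_space_iff) (auto elim: eventually_mono)
  then show "AE x in torus. h2 \<delta> x = of_real \<delta> * h \<delta> x"
  proof (rule AE_mp, intro AE_I2 impI)
    fix x :: real assume "x \<in> space torus" "x \<noteq> 1"
    then have "frac x = x" by (simp add: frac_eq)
    then show "h2 \<delta> x = of_real \<delta> * h \<delta> x" by (simp add: h2_def)
  qed
qed

lemma T_continuous: "continuous_on A (T0 \<delta>)" "continuous_on A (T1 \<delta>)"
  unfolding T0_def[abs_def] T1_def[abs_def]
  by (intro continuous_Fourier_series b_summable b_deriv_summable)+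

lemma h2_measurable: "h2 \<delta> \<in> borel_measurable torus"
proof -
  have [measurable]: "h \<delta> \<in> borel_measurable torus" using H1_pairD(2)[OF F_pair] by (simp add: sq_int_def)
  have "(\<lambda>x. of_real \<delta> * (if x \<in> {1} then h \<delta> 0 else h \<delta> x)) \<in> borel_measurable torus"
    by (intro borel_measurable_times measurable_const measurable_If_set) (auto simp: sets_restrict_space)
  moreover have "h2 \<delta> x = of_real \<delta> * (if x \<in> {1} then h \<delta> 0 else h \<delta> x)" if "x \<in> space torus" for x
    using that frac_eq[of x] by (auto simp: h2_def)
  ultimately show ?thesis using measurable_cong by (metis (no_types, lifting))
qed

lemma T1_h2_pair: "H1_pair (T1 \<delta>) (h2 \<delta>)"
proof (rule H1_pair_cong[OF H1_pair_cmult[OF F_pair, of "of_real \<delta>" \<delta>]])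
  show "AE x in torus. of_real \<delta> * F \<delta> x = T1 \<delta> x" using T_AE(2)[of \<delta>] by eventually_elim simp
  show "AE x in torus. of_real \<delta> * h \<delta> x = h2 \<delta> x" using T_AE(3)[of \<delta>] by eventually_elim simp
qed (intro continuous_measurable_torus T_continuous h2_measurable)+

lemma quotient_AE: "AE x in torus. T1 \<delta> x / T0 \<delta> x = - of_real \<delta> * g x"
  using T_AE(1,2)[of \<delta>] by eventually_elim (simp add: F_def E_def)

lemma quotient_pair:
  "H1_pair (\<lambda>x. T1 \<delta> x / T0 \<delta> x) (\<lambda>x. h2 \<delta> x / T0 \<delta> x - (T1 \<delta> x / T0 \<delta> x)\<^sup>2)"
proof (rule H1_pair_cong[OF H1_pair_cmult[OF g_pair, of "- of_real \<delta>"]])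
  have m: "T0 \<delta> \<in> borel_measurable torus" "T1 \<delta> \<in> borel_measurable torus" "h2 \<delta> \<in> borel_measurable torus"
    by (intro continuous_measurable_torus T_continuous h2_measurable)+
  show "AE x in torus. - of_real \<delta> * g x = T1 \<delta> x / T0 \<delta> x" using quotient_AE[of \<delta>] by eventually_elim simp
  show "AE x in torus. - of_real \<delta> * f' x = h2 \<delta> x / T0 \<delta> x - (T1 \<delta> x / T0 \<delta> x)\<^sup>2"
    using T_AE[of \<delta>] by eventually_elim (simp add: h_def F_def E_def power2_eq_square field_simps)
  show "(\<lambda>x. T1 \<delta> x / T0 \<delta> x) \<in> borel_measurable torus"
    "(\<lambda>x. h2 \<delta> x / T0 \<delta> x - (T1 \<delta> x / T0 \<delta> x)\<^sup>2) \<in> borel_measurable torus"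
    using m by measurable
qed

end

section \<open>Viscous instability\<close>

lemma (in heat_flow) theta_initial:
  "theta 0 0 (of_real x) = (\<Sum>\<^sub>\<infinity>m. b m * emode m x)"
  "theta 1 0 (of_real x) = (\<Sum>\<^sub>\<infinity>m. freq m * b m * emode m x)"
  using theta_real[of 0 0 x] theta_real[of 1 0 x] by (simp_all add: mode_coeff_def)

text \<open>The last quantity is the lower bound of \<open>linear_term_dominates\<close> divided by \<open>d\<close>; it tends to \<open>A\<close> as \<open>d\<close> tends to zero, so half of
\<open>A\<close> is left for small \<open>d\<close>.\<close>

lemma small_parameter:
  fixes A C M :: real
  assumes "A > 0"
  obtains d0 where "d0 > 0" "\<And>d. 0 < d \<Longrightarrow> d < d0 \<Longrightarrow> d \<le> 1 \<and> (1 + M) * (d * C) \<le> 1 / 4 \<and> d * C < A \<and>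
    (A - d * C) / (1 + d * C) - d * C\<^sup>2 / ((1 - d * C) * (1 - 2 * (d * C))) \<ge> A / 2"
proof -
  have "((\<lambda>d. (A - d * C) / (1 + d * C) - d * C\<^sup>2 / ((1 - d * C) * (1 - 2 * (d * C)))) \<longlongrightarrow>
      (A - 0 * C) / (1 + 0 * C) - 0 * C\<^sup>2 / ((1 - 0 * C) * (1 - 2 * (0 * C)))) (at_right 0)"
    by (intro tendsto_intros) auto
  then have "\<forall>\<^sub>F d in at_right 0. (A - d * C) / (1 + d * C) - d * C\<^sup>2 / ((1 - d * C) * (1 - 2 * (d * C))) > A / 2"
    using assms by (intro order_tendstoD(1)) auto
  moreover have "((\<lambda>d. (1 + M) * (d * C)) \<longlongrightarrow> (1 + M) * (0 * C)) (at_right 0)" by (intro tendsto_intros)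
  then have "\<forall>\<^sub>F d in at_right 0. (1 + M) * (d * C) < 1 / 4" by (intro order_tendstoD(2)) auto
  moreover have "((\<lambda>d. d * C) \<longlongrightarrow> 0 * C) (at_right 0)" by (intro tendsto_intros)
  then have "\<forall>\<^sub>F d in at_right 0. d * C < A" using assms by (intro order_tendstoD(2)) auto
  moreover have "\<forall>\<^sub>F d in at_right 0. d < (1::real)" unfolding eventually_at_right_field by (intro exI[of _ 1]) auto
  ultimately have "\<forall>\<^sub>F d in at_right 0. d \<le> 1 \<and> (1 + M) * (d * C) \<le> 1 / 4 \<and> d * C < A \<and>
    (A - d * C) / (1 + d * C) - d * C\<^sup>2 / ((1 - d * C) * (1 - 2 * (d * C))) \<ge> A / 2"
    by eventually_elim auto
  then obtain d0 where "d0 > 0" "\<forall>d>0. d < d0 \<longrightarrow> d \<le> 1 \<and> (1 + M) * (d * C) \<le> 1 / 4 \<and> d * C < A \<and>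
    (A - d * C) / (1 + d * C) - d * C\<^sup>2 / ((1 - d * C) * (1 - 2 * (d * C))) \<ge> A / 2"
    unfolding eventually_at_right_field by auto
  then show ?thesis using that by blast
qed

lemma linear_term_dominates:
  fixes A C d B X e :: real
  assumes d: "0 < d" and C: "C \<ge> 0" "2 * (d * C) < 1" "d * C < A"
    and B: "\<bar>B - 1\<bar> \<le> d * C" and X: "X \<ge> d * A - d\<^sup>2 * C" and e: "0 \<le> e" "e \<le> d * C"
    and main: "(A - d * C) / (1 + d * C) - d * C\<^sup>2 / ((1 - d * C) * (1 - 2 * (d * C))) \<ge> A / 2"
  shows "X / B - e\<^sup>2 / (B * (B - e)) \<ge> d * A / 2"
proof -
  have dC: "0 \<le> d * C" using d C by simp
  have B': "1 - d * C \<le> B" "B \<le> 1 + d * C" "B > 0" "1 - 2 * (d * C) \<le> B - e" using B e C dC by linarith+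
  have X': "d * (A - d * C) \<le> X" using X by (simp add: power2_eq_square algebra_simps)
  moreover have "0 \<le> d * (A - d * C)" using d C by simp
  ultimately have "d * (A - d * C) / (1 + d * C) \<le> X / B"
    using B' by (intro frac_le) auto
  moreover have "e\<^sup>2 / (B * (B - e)) \<le> (d * C)\<^sup>2 / ((1 - d * C) * (1 - 2 * (d * C)))"
    using e B' C dC by (intro frac_le mult_mono power_mono mult_pos_pos) auto
  moreover have "d * ((A - d * C) / (1 + d * C) - d * C\<^sup>2 / ((1 - d * C) * (1 - 2 * (d * C)))) \<ge> d * (A / 2)"
    using main d by (intro mult_left_mono) auto
  moreover have "d * ((A - d * C) / (1 + d * C) - d * C\<^sup>2 / ((1 - d * C) * (1 - 2 * (d * C))))
      = d * (A - d * C) / (1 + d * C) - (d * C)\<^sup>2 / ((1 - d * C) * (1 - 2 * (d * C)))"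
    by (simp add: right_diff_distrib power2_eq_square)
  moreover have "d * (A / 2) = d * A / 2" by simp
  ultimately show ?thesis by linarith
qed

text \<open>For \<open>m = 1\<close> the exponent becomes positive only after \<open>4 \<pi> k\<close>, hence by at most \<open>\<epsilon> T\<close> times \<open>\<pi> N t\<close>, and
\<open>N \<epsilon> = k\<close>. For \<open>m \<ge> 2\<close> it would become positive only after \<open>8 \<pi> k\<close>, which is not before the end of the time interval.\<close>

lemma linear_growth_bound:
  fixes k N T \<epsilon> t :: real and m :: int
  assumes k: "k > 0" and N: "N > 0" "N * \<epsilon> = k" and T: "T > 0" and \<epsilon>: "0 < \<epsilon>" "\<epsilon> \<le> 1" "\<epsilon> * T \<le> 4 * pi * k"
    and t: "0 \<le> t" "t \<le> 4 * pi * k + \<epsilon> * T"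
  shows "pi * N * t * (of_int m * t - 4 * pi * k * (of_int m)\<^sup>2) \<le> pi * k * T * (4 * pi * k + T)"
proof -
  have pos: "0 \<le> pi * k * T * (4 * pi * k + T)" using k T by simp
  have nonpos: "pi * N * t * (of_int m * t - 4 * pi * k * (of_int m)\<^sup>2) \<le> pi * k * T * (4 * pi * k + T)"
    if "of_int m * t \<le> 4 * pi * k * (of_int m)\<^sup>2"
  proof -
    have "pi * N * t * (of_int m * t - 4 * pi * k * (of_int m)\<^sup>2) \<le> 0"
      using that N t by (intro mult_nonneg_nonpos) auto
    then show ?thesis using pos by linarith
  qed
  consider "m \<le> 0" | "m = 1" | "m \<ge> 2" by linarith
  then show ?thesis
  proof cases
    case 1
    then have "of_int m * t \<le> 0" using t by (intro mult_nonpos_nonneg) auto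
    moreover have "0 \<le> 4 * pi * k * (of_int m)\<^sup>2" using k by simp
    ultimately show ?thesis by (intro nonpos) linarith
  next
    case 2
    have "pi * N * t * (t - 4 * pi * k) \<le> pi * N * t * (\<epsilon> * T)"
      using N t by (intro mult_left_mono) auto
    also have "\<dots> = pi * (N * \<epsilon>) * T * t" by simp
    also have "\<dots> \<le> pi * k * T * (4 * pi * k + T)"
    proof -
      have "\<epsilon> * T \<le> 1 * T" using \<epsilon> T by (intro mult_right_mono) auto
      then have "t \<le> 4 * pi * k + T" using t by linarith
      then show ?thesis unfolding N(2) using k T by (intro mult_left_mono) auto
    qed
    finally show ?thesis using 2 by simp
  next
    case 3
    then have m: "real_of_int m \<ge> 2" by simp
    have "t \<le> 4 * pi * k * 2" using t \<epsilon> by linarith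
    also have "\<dots> \<le> 4 * pi * k * of_int m" using m k by (intro mult_left_mono) auto
    finally have "of_int m * t \<le> of_int m * (4 * pi * k * of_int m)" using m by (intro mult_left_mono) auto
    then show ?thesis by (intro nonpos) (simp add: power2_eq_square mult_ac)
  qed
qed

theorem theorem2:
  fixes k0 :: int and T \<alpha> :: real and a :: "real \<Rightarrow> real"
  assumes "k0 \<ge> 1" and "T > 0" and "\<alpha> > 1 / 3"
    and "H1_torus (\<lambda>x. complex_of_real (a x))"
    and "(LINT x|torus. exp (- 2 * \<i> * of_real pi * of_real x) * complex_of_real (a x)) \<noteq> 0"
  shows "\<exists>\<epsilon>0>0. \<forall>\<epsilon>. 0 < \<epsilon> \<and> \<epsilon> < \<epsilon>0 \<and> real_of_int k0 / \<epsilon> \<in> \<int> \<longrightarrow>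
    (\<exists>u :: real \<Rightarrow> real \<Rightarrow> complex.
       let T' = 4 * pi * real_of_int k0 + \<epsilon> * T;
           u0 = (\<lambda>x. complex_of_real (\<epsilon> powr \<alpha> * a (real_of_int k0 * x / \<epsilon>)));
           coeff = (\<lambda>t. LINT x|torus.
             exp (- 2 * \<i> * of_real pi * of_real (real_of_int k0 * x / \<epsilon>)) * u t x)
       in burgers_solution \<epsilon> T' u0 u \<and>
          (\<forall>v. burgers_solution \<epsilon> T' u0 v \<longrightarrow>
             (\<forall>t\<in>{0..T'}. AE x in torus. v t x = u t x)) \<and>
          (\<forall>t\<in>{0..T'}.
             cmod (coeff t) \<ge>
               1 / 2 * exp (pi * real_of_int k0 * (t - 2 * pi * real_of_int k0)\<^sup>2 / \<epsilon>
                            - 4 * (pi * real_of_int k0) ^ 3 / \<epsilon>)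
               * cmod (coeff 0)))"
proof -
  define k where "k = real_of_int k0"
  have k: "k > 0" using assms(1) by (simp add: k_def)
  define aC where "aC x = complex_of_real (a x)" for x
  have aH: "H1_torus aC" using assms(4) by (simp add: aC_def[abs_def])
  interpret d: periodic_datum aC "weak_deriv aC"
    using weak_deriv_H1_pair[OF aH] aH by unfold_locales (auto simp: H1_torus_iff)
  have ex: "exp (- 2 * \<i> * of_real pi * of_real y) = emode (- 1) y" for y
    by (simp add: emode_def cis_conv_exp mult_ac)
  define A where "A = cmod (fc aC 1)"
  have A: "A > 0" using assms(5) unfolding ex by (simp add: A_def fc_def aC_def)
  define a0 where "a0 = (LINT x|torus. a x)"
  have a0: "fc aC 0 = of_real a0" by (simp add: fc_def aC_def a0_def)
  define M where "M = exp (pi * k * T * (4 * pi * k + T))"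
  have M1: "M \<ge> 1" using k assms(2) by (simp add: M_def)
  obtain d0 where d0: "d0 > 0" "\<And>d. 0 < d \<Longrightarrow> d < d0 \<Longrightarrow> d \<le> 1 \<and> (1 + M) * (d * d.C) \<le> 1 / 4 \<and> d * d.C < A \<and>
    (A - d * d.C) / (1 + d * d.C) - d * d.C\<^sup>2 / ((1 - d * d.C) * (1 - 2 * (d * d.C))) \<ge> A / 2"
    by (rule small_parameter[OF A]) (rule that)
  \<comment> \<open>the middle bound gives \<open>\<epsilon> T \<le> 4 \<pi> k\<close> for \<open>linear_growth_bound\<close>, the last one \<open>\<delta> < d0\<close>\<close>
  define \<epsilon>0 where "\<epsilon>0 = min 1 (min (4 * pi * k / T) ((2 * k * d0) powr (1 / \<alpha>)))"
  have "\<epsilon>0 > 0" using k d0 assms(2) by (simp add: \<epsilon>0_def)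
  moreover have "\<exists>u :: real \<Rightarrow> real \<Rightarrow> complex.
       let T' = 4 * pi * real_of_int k0 + \<epsilon> * T;
           u0 = (\<lambda>x. complex_of_real (\<epsilon> powr \<alpha> * a (real_of_int k0 * x / \<epsilon>)));
           coeff = (\<lambda>t. LINT x|torus.
             exp (- 2 * \<i> * of_real pi * of_real (real_of_int k0 * x / \<epsilon>)) * u t x)
       in burgers_solution \<epsilon> T' u0 u \<and>
          (\<forall>v. burgers_solution \<epsilon> T' u0 v \<longrightarrow>
             (\<forall>t\<in>{0..T'}. AE x in torus. v t x = u t x)) \<and>
          (\<forall>t\<in>{0..T'}.
             cmod (coeff t) \<ge>
               1 / 2 * exp (pi * real_of_int k0 * (t - 2 * pi * real_of_int k0)\<^sup>2 / \<epsilon>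
                            - 4 * (pi * real_of_int k0) ^ 3 / \<epsilon>)
               * cmod (coeff 0))"
    if \<epsilon>: "0 < \<epsilon>" "\<epsilon> < \<epsilon>0" and int: "real_of_int k0 / \<epsilon> \<in> \<int>" for \<epsilon>
  proof -
    define N where "N = k / \<epsilon>"
    have N: "N > 0" "N * \<epsilon> = k" "k / N = \<epsilon>" using k \<epsilon> by (simp_all add: N_def)
    obtain n where n: "N = real n"
    proof -
      obtain z where z: "N = of_int z" using int unfolding N_def k_def by (elim Ints_cases)
      then have "N = real (nat z)" using N(1) by simp
      then show thesis by (rule that)
    qed
    have n1: "n \<ge> 1" using N(1) n by (cases n) auto
    define \<delta> where "\<delta> = \<epsilon> powr \<alpha> / (2 * k)"
    have \<delta>0: "0 < \<delta>" using \<epsilon> k by (simp add: \<delta>_def)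
    have "\<epsilon> powr \<alpha> < ((2 * k * d0) powr (1 / \<alpha>)) powr \<alpha>"
      using \<epsilon> assms(3) by (intro powr_less_mono2) (auto simp: \<epsilon>0_def)
    also have "\<dots> = 2 * k * d0" using assms(3) k d0 by (simp add: powr_powr)
    finally have "\<delta> < d0" using k by (simp add: \<delta>_def field_simps)
    note \<delta>s = d0(2)[OF \<delta>0 this]
    then have \<delta>: "0 < \<delta>" "\<delta> \<le> 1" using \<delta>0 by auto
    have dC: "0 \<le> \<delta> * d.C" using \<delta> d.C_parts(4) by simp
    have dC1: "\<delta> * d.C + M * (\<delta> * d.C) \<le> 1 / 4" using \<delta>s by (simp add: ring_distribs)
    have dC2: "\<delta> * d.C \<le> M * (\<delta> * d.C)" using mult_right_mono[OF M1 dC] by simp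
    define T' where "T' = 4 * pi * k + \<epsilon> * T"
    have T': "T' > 0" using k \<epsilon> assms(2) by (simp add: T'_def add_pos_pos)
    define c where "c = \<epsilon> powr \<alpha> * a0"
    interpret hf: heat_flow k N c "d.b \<delta>"
      using k N d.b_summable by unfold_locales
    have eta: "hf.deriv_norm \<le> \<delta> * d.C" "0 \<le> hf.deriv_norm"
      unfolding hf.deriv_norm_def by (rule d.b_deriv_sum[OF \<delta>]) (intro infsum_nonneg, simp)
    have growth: "cmod (hf.growth_factor m t) \<le> M" if "t \<in> {0..T'}" for m t
      unfolding hf.norm_growth_factor M_def exp_le_cancel_iff
      by (rule linear_growth_bound[where \<epsilon>=\<epsilon>])
         (use that k N \<epsilon> assms(2) in \<open>auto simp: T'_def \<epsilon>0_def field_simps\<close>)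
    have b0: "\<bar>cmod (d.b \<delta> 0) - 1\<bar> \<le> \<delta> * d.C"
      using d.b_0[OF \<delta>] norm_triangle_ineq3[of "d.b \<delta> 0" 1] by simp
    have small: "M * hf.deriv_norm < cmod (d.b \<delta> 0)" "1 / 2 \<le> cmod (d.b \<delta> 0) - M * hf.deriv_norm"
    proof -
      have "M * hf.deriv_norm \<le> M * (\<delta> * d.C)" using eta M1 by (intro mult_left_mono) auto
      then show "M * hf.deriv_norm < cmod (d.b \<delta> 0)" "1 / 2 \<le> cmod (d.b \<delta> 0) - M * hf.deriv_norm"
        using b0 dC1 by linarith+
    qed
    have th0: "hf.theta 0 0 (of_real x) = d.T0 \<delta> x" "hf.theta 1 0 (of_real x) = d.T1 \<delta> x" for x
      unfolding hf.theta_initial d.T0_def d.T1_def by (rule refl)+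
    interpret ch: cole_hopf k N c "d.b \<delta>" T' M "1 / 2" "d.h2 \<delta>" n
    proof unfold_locales
      show "cmod (hf.growth_factor m t) \<le> M" if "t \<in> {0..T'}" for m t using growth[OF that] .
      show "1 / 2 \<le> cmod (hf.theta 0 (of_real t) (of_real x))" if "t \<in> {0..T'}" for t x
      proof -
        have "cmod (hf.kern m (of_real t) (of_real x)) \<le> M" for m
          unfolding hf.kern_real using growth[OF that, of m] by (simp add: norm_mult)
        from hf.theta0_deviation[OF d.b_deriv_summable this]
        show ?thesis using small(2) norm_triangle_ineq2[of "d.b \<delta> 0" "hf.theta 0 (of_real t) (of_real x)"]
          by (simp add: norm_minus_commute)
      qed
      show "H1_pair (\<lambda>x. hf.theta 1 0 (of_real x)) (d.h2 \<delta>)"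
        unfolding th0 by (rule d.T1_h2_pair)
      show "H1_pair (\<lambda>x. hf.theta 1 0 (of_real x) / hf.theta 0 0 (of_real x))
        (\<lambda>x. d.h2 \<delta> x / hf.theta 0 0 (of_real x) - (hf.theta 1 0 (of_real x) / hf.theta 0 0 (of_real x))\<^sup>2)"
        unfolding th0 by (rule d.quotient_pair)
    qed (use T' n d.b_deriv_summable d.h2_periodic in auto)
    define u0 where "u0 x = complex_of_real (\<epsilon> powr \<alpha> * a (real_of_int k0 * x / \<epsilon>))" for x
    have t0: "0 \<in> {0..T'}" using T' by simp
    have q0: "AE x in torus. ch.q 0 x = - of_real \<delta> * (aC x - fc aC 0)"
      using d.quotient_AE[of \<delta>] d.g_AE
      by eventually_elim (simp add: ch.q_def ch.P_def th0[simplified])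
    have sq0: "sq_int (\<lambda>x. - of_real \<delta> * (aC x - fc aC 0))"
      by (intro sq_int_cmult sq_int_diff sq_int_const H1_pairD(1)[OF d.pair])
    have sqq: "sq_int (ch.q t)" if "t \<in> {0..T'}" for t
      by (intro sq_int_continuous ch.continuous_q that)
    have init: "AE x in torus. ch.u 0 x = u0 x"
    proof -
      have "AE x in torus. ch.q 0 (real n * x) = - of_real \<delta> * (aC (real n * x) - fc aC 0)"
        by (rule scale_AE_eq[OF sqq[OF t0] ch.q_periodic sq0 _ n1 q0])
           (use d.f_periodic in \<open>simp add: periodic1_def\<close>)
      then show ?thesis
      proof eventually_elim
        fix x
        assume "ch.q 0 (real n * x) = - of_real \<delta> * (aC (real n * x) - fc aC 0)"
        then have e: "ch.q 0 (N * x) = - of_real \<delta> * (aC (N * x) - fc aC 0)"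
          by (simp only: n[symmetric])
        have "2 * k * \<delta> = \<epsilon> powr \<alpha>" using k by (simp add: \<delta>_def)
        then have kd: "2 * complex_of_real k * of_real \<delta> = of_real (\<epsilon> powr \<alpha>)"
          by (metis of_real_mult of_real_numeral)
        have nx: "N * x = real_of_int k0 * x / \<epsilon>"
          by (simp add: N_def k_def)
        have "ch.u 0 x = of_real c + (2 * complex_of_real k * of_real \<delta>) * (aC (N * x) - fc aC 0)"
          by (simp add: ch.u_def e algebra_simps)
        also have "\<dots> = u0 x" unfolding kd a0 by (simp add: c_def u0_def aC_def nx algebra_simps)
        finally show "ch.u 0 x = u0 x" .
      qed
    qed
    have sol: "burgers_solution \<epsilon> T' u0 ch.u"
      using ch.u_burgers_solution[OF init] by (simp only: N(3))
    have uniq: "AE x in torus. v t x = ch.u t x" if "burgers_solution \<epsilon> T' u0 v" "t \<in> {0..T'}" for v t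
      by (rule burgers_solution_unique[OF sol that(1) \<epsilon>(1) that(2)])
    define coeff where "coeff t = (LINT x|torus. exp (- 2 * \<i> * of_real pi * of_real (real_of_int k0 * x / \<epsilon>)) * ch.u t x)" for t
    have coeff: "coeff t = - 2 * of_real k * fc (ch.q t) 1" if t: "t \<in> {0..T'}" for t
    proof -
      have e: "exp (- 2 * \<i> * of_real pi * of_real (real_of_int k0 * x / \<epsilon>)) = emode (- int n) x" for x
      proof -
        have "real_of_int k0 * x / \<epsilon> = real n * x" unfolding n[symmetric] by (simp add: N_def k_def)
        then show ?thesis unfolding ex by (simp add: emode_def mult_ac)
      qed
      have s: "sq_int (\<lambda>x. ch.q t (real n * x))" by (rule scale_sq_int(1)[OF sqq[OF t] ch.q_periodic n1])
      have "(LINT x|torus. emode (- 1) (real n * x) * ch.q t (real n * x)) = (LINT x|torus. emode (- 1) x * ch.q t x)"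
      proof (rule scale_integrable(2)[OF _ _ n1])
        show "integrable torus (\<lambda>x. emode (- 1) x * ch.q t x)" by (rule sq_int_mult[OF sq_int_emode sqq[OF t]])
        show "periodic1 (\<lambda>x. emode (- 1) x * ch.q t x)"
          using ch.q_periodic[of t] by (simp add: periodic1_def emode_periodic)
      qed
      moreover have "emode (- 1) (real n * x) = emode (- int n) x" for x by (simp add: emode_def mult_ac)
      ultimately have q1: "fc (\<lambda>x. ch.q t (real n * x)) (int n) = fc (ch.q t) 1" by (simp add: fc_def)
      have "coeff t = fc (\<lambda>x. (\<i> * of_real t + of_real c) + (- 2 * of_real k) * ch.q t (real n * x)) (int n)"
        unfolding coeff_def e fc_def by (simp add: ch.u_def n[symmetric])
      also have "\<dots> = fc (\<lambda>x. \<i> * of_real t + of_real c) (int n) + fc (\<lambda>x. (- 2 * of_real k) * ch.q t (real n * x)) (int n)"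
        by (rule fc_add[OF sq_int_const sq_int_cmult[OF s]])
      also have "fc (\<lambda>x. \<i> * of_real t + of_real c) (int n) = 0"
        using fc_cmult[of "\<i> * of_real t + of_real c" "emode 0" "int n"] n1 by (simp add: fc_emode)
      also have "fc (\<lambda>x. (- 2 * of_real k) * ch.q t (real n * x)) (int n) = - 2 * of_real k * fc (ch.q t) 1"
        by (simp only: fc_cmult q1)
      finally show ?thesis by simp
    qed
    have coeff0: "cmod (coeff 0) = 2 * k * (\<delta> * A)"
    proof -
      have "fc (ch.q 0) 1 = fc (\<lambda>x. - of_real \<delta> * (aC x - fc aC 0)) 1"
        by (rule fc_cong[OF q0]) (use sqq[OF t0] sq0 in \<open>auto simp: sq_int_def\<close>)
      also have "\<dots> = - of_real \<delta> * (fc aC 1 - fc (\<lambda>x. fc aC 0) 1)"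
        by (simp only: fc_cmult fc_diff[OF H1_pairD(1)[OF d.pair] sq_int_const])
      also have "fc (\<lambda>x. fc aC 0) 1 = 0"
        using fc_cmult[of "fc aC 0" "emode 0" 1] by (simp add: fc_emode)
      finally show ?thesis using coeff[OF t0] k \<delta> by (simp add: norm_mult A_def)
    qed
    have bound: "cmod (coeff t) \<ge> 1 / 2 * exp (pi * k * (t - 2 * pi * k)\<^sup>2 / \<epsilon> - 4 * (pi * k) ^ 3 / \<epsilon>) * cmod (coeff 0)"
      if t: "t \<in> {0..T'}" for t
    proof -
      have expo: "pi * N * t\<^sup>2 - 4 * pi\<^sup>2 * k * N * t = pi * k * (t - 2 * pi * k)\<^sup>2 / \<epsilon> - 4 * (pi * k) ^ 3 / \<epsilon>"
        using \<epsilon> by (simp add: N_def power2_eq_square power3_eq_cube field_simps)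
      show ?thesis
      proof (cases "t = 0")
        case True
        have one: "exp (pi * k * (0 - 2 * pi * k)\<^sup>2 / \<epsilon> - 4 * (pi * k) ^ 3 / \<epsilon>) = 1"
          unfolding expo[unfolded True, symmetric] by simp
        show ?thesis unfolding True one by simp
      next
        case False
        then have tp: "t > 0" using t by simp
        let ?B = "cmod (d.b \<delta> 0)" and ?X = "cmod (2 * of_real pi * \<i> * d.b \<delta> 1)"
        have X: "?X \<ge> \<delta> * A - \<delta>\<^sup>2 * d.C"
        proof -
          have "cmod (of_real \<delta> * fc aC 1) \<le> cmod (2 * of_real pi * \<i> * d.b \<delta> 1 + of_real \<delta> * fc aC 1) + ?X"
            using norm_triangle_ineq4[of "2 * of_real pi * \<i> * d.b \<delta> 1 + of_real \<delta> * fc aC 1" "2 * of_real pi * \<i> * d.b \<delta> 1"] by simp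
          moreover have "cmod (of_real \<delta> * fc aC 1) = \<delta> * A" using \<delta> by (simp add: norm_mult A_def)
          ultimately show ?thesis using d.b_1[OF \<delta>] by linarith
        qed
        have "2 * (\<delta> * d.C) < 1" using dC1 dC2 by linarith
        then have dom: "?X / ?B - hf.deriv_norm\<^sup>2 / (?B * (?B - hf.deriv_norm)) \<ge> \<delta> * A / 2"
          using \<delta>s by (intro linear_term_dominates[OF \<delta>(1) d.C_parts(4) _ _ b0 X eta(2,1)]) auto
        have "exp (pi * N * t\<^sup>2 - 4 * pi\<^sup>2 * k * N * t) * (\<delta> * A / 2)
            \<le> exp (pi * N * t\<^sup>2 - 4 * pi\<^sup>2 * k * N * t) * (?X / ?B - hf.deriv_norm\<^sup>2 / (?B * (?B - hf.deriv_norm)))"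
          using dom by (intro mult_left_mono) auto
        also have "\<dots> \<le> cmod (fc (ch.q t) 1)"
          using hf.quotient_mode_lower_bound[OF d.b_deriv_summable growth[OF t] tp small(1)]
          by (simp add: ch.q_def[abs_def] ch.P_def)
        finally have "2 * k * (exp (pi * N * t\<^sup>2 - 4 * pi\<^sup>2 * k * N * t) * (\<delta> * A / 2)) \<le> 2 * k * cmod (fc (ch.q t) 1)"
          using k by (intro mult_left_mono) auto
        also have "\<dots> = cmod (coeff t)" using coeff[OF t] k by (simp add: norm_mult)
        finally show ?thesis unfolding coeff0 expo by (simp add: mult_ac)
      qed
    qed
    define U where "U = ch.u"
    note facts = sol uniq bound
    show ?thesis
      unfolding Let_def
      using facts[unfolded coeff_def, folded U_def, unfolded T'_def u0_def[abs_def] k_def]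
      by (intro exI[of _ U]) blast
  qed
  ultimately show ?thesis by blast
qed

end
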